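(* Let $(L,\mathcal G)$ be a nestoid. (i) The maximal lightcone refinement of $\Sigma^{2\mathcal G}$ is a unimodular simplicial fan. Its simplices (cones) are given by $$\mathrm{Span}_{\mathbb R_+}(w_t\mid t\in\mathcal T),$$ where $\mathcal T$ is a tubing of $\overline T_N$ for a nested set $N$ such that $\mathcal T$ does not contain $\overline T_N$ and crosses each edge of $\overline T_N$ at least once. (ii) The simplices of the induced triangulation of $\mathcal U_{\mathcal G}$ correspond to those $\mathcal T$ in (i) that define tubings of the Hasse diagram $F_N$ of $N$, i.e. such that no tube in $\mathcal T$ contains the root of $\overline T_N$.
   Context: All lattices are finite. Let $L$ be a lattice with minimum $\hat 0$ and maximum $\hat 1$. A subset $\mathcal G\subseteq L_{>\hat 0}$ is nestable if $\hat 1\in\mathcal G$ and for any two incomparable $f,g\in\mathcal G$, $f\vee g\notin\mathcal G$ implies $f\wedge g=\hat 0$. A subset $N\subseteq\mathcal G$ is nested if for all $k\ge 2$ and pairwise incomparable $f_1,\dots,f_k\in N$ one has $f_1\vee\dots\vee f_k\notin\mathcal G$. $\mathcal N(L,\mathcal G)$ is the simplicial complex of nested sets. $(L,\mathcal G)$ is a nestoid if $\mathcal G$ is nestable and for every $f\in\mathcal G$ the complex $\mathcal N([\hat 0,f],\mathcal G\cap[\hat 0,f])$ is pure. $\mathbb R^{2\mathcal G}$ is the real vector space with basis $f^+,f^-$ ($f\in\mathcal G$), with the lattice spanned by this basis; $p_f,m_f$ are the dual coordinates. For a nested set $N$, $\mathbb R^{2N}$ is the span of $f^\pm$, $f\in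 N$, and $\mathbb R_+^{2N}$ the cone they span. The fan $\Sigma^{2\mathcal G}$ consists of all faces of the cones $\mathbb R_+^{2N}$, $N\in\mathcal N(L,\mathcal G)$. For $g\in\mathcal G$ put $F_g:=p_{\hat 1}+\sum_{f\in\mathcal G,\ g<f<\hat 1}(p_f-m_f)-m_g$. The causal cone is $\{m_{\hat 1}=0,\ p_g\ge0,\ m_g\ge0,\ F_g\ge 0\ \forall g\in\mathcal G\}$. The universe fan $\mathcal U_{\mathcal G}$ is obtained by intersecting the cones of $\Sigma^{2\mathcal G}$ with the causal cone (its cones are these intersections and all their faces). Trees: for a nested set $N$, the Hasse diagram $F_N$ is a rooted forest on vertex set $N$ (largest elements on top); $\overline T_N$ is the rooted tree obtained by adjoining a root vertex $\star$ above all maximal elements of $N$. Each edge is labelled by its lower endpoint, so edges of $\overline T_N$ are identified with elements of $N$. A tube is a nonempty vertex set inducing a connected subgraph; a tubing is a laminar family of tubes (any two are disjoint or one contains the other; no non-adjacency condition). "$\mathcal T$ does not contain $\overline T_N$" means the full vertex set is not a tube in $\mathcal T$; $\mathcal T$ crosses an edge if some tube contains exactly one of its endpoints. For a tube $t$, $w_t:=\sum_{e\in\delta^+(t)}e^++\sum_{e\in\delta^-(t)}e^-$, where $\delta^+(t)$ is the set of edges entering $t$ (lower endpoint in $t$, upper endpoint not) and $\delta^-(t)$ the set of edges leaving $t$ (upper endpoint in $t$, lower endpoint not). Lightcone subdivisions: let $\mathcal B_N$ be a Boolean building set on $N$ (a collection of nonempty subsets of $N$ containing all singletons and closed under unions of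 intersecting members). Let $u_{\mathrm{tot}}=\sum_{g\in N}g$ and $\phi:\mathbb R^{2N}\to\mathbb R^N/\langle u_{\mathrm{tot}}\rangle$, $\phi(f^+)=\sum_{g\in N,\,g<f}g$, $\phi(f^-)=\sum_{g\in N,\ g>f\text{ or }g\wedge f=\hat 0}g$. The domains of linearity of $x\mapsto\sum_{t\in\mathcal B_N}\min_{g\in t}x_g$ define a complete fan in $\mathbb R^N/\langle u_{\mathrm{tot}}\rangle$; the lightcone subdivision of $\mathbb R_+^{2N}$ associated to $\mathcal B_N$ is the intersection with $\mathbb R_+^{2N}$ of its pullback under $\phi$. The maximal lightcone refinement of $\Sigma^{2\mathcal G}$ is the fan assembled from the lightcone subdivisions of all $\mathbb R_+^{2N}$ associated to the graphical building sets $\mathcal B_N=\{\emptyset\ne S\subseteq N\mid S\text{ is the edge set of a connected subgraph of }\overline T_N\}$. It has a subfan refining $\mathcal U_{\mathcal G}$ (the induced triangulation of $\mathcal U_{\mathcal G}$), consisting of its cones contained in the support of $\mathcal U_{\mathcal G}$. A simplicial fan is unimodular if the primitive generators of each cone are part of a $\mathbb Z$-basis of the lattice. *)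

theory Defs
  imports "HOL-Analysis.Analysis"
begin

section \<open>Nestoids\<close>

text \<open>
  A finite lattice is a type of class \<^class>\<open>finite\<close> and \<^class>\<open>bounded_lattice\<close>, with minimum
  \<^const>\<open>bot\<close> and maximum \<^const>\<open>top\<close>. Joins, meets and the minimum of an interval
  \<open>{bot..f}\<close> are those of the ambient lattice, so its nested sets are given by
  \<open>nested_complex (G \<inter> {bot..f})\<close>.
\<close>

definition incomparable :: "'a::order \<Rightarrow> 'a \<Rightarrow> bool" where
  "incomparable f g \<longleftrightarrow> \<not> f \<le> g \<and> \<not> g \<le> f"

definition nestable :: "'a::{finite,bounded_lattice} set \<Rightarrow> bool" where
  "nestable G \<longleftrightarrow> bot \<notin> G \<and> top \<in> G \<and>
     (\<forall>f\<in>G. \<forall>g\<in>G. incomparable f g \<and> sup f g \<notin> G \<longrightarrow> inf f g = bot)"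

definition nested_complex :: "'a::{finite,bounded_lattice} set \<Rightarrow> 'a set set" where
  "nested_complex G = {N. N \<subseteq> G \<and>
     (\<forall>S\<subseteq>N. card S \<ge> 2 \<and> pairwise incomparable S \<longrightarrow> Sup_fin S \<notin> G)}"

definition pure_complex :: "'b set set \<Rightarrow> bool" where
  "pure_complex K \<longleftrightarrow>
     (\<forall>M\<in>K. \<forall>M'\<in>K. (\<forall>S\<in>K. M \<subseteq> S \<longrightarrow> S = M) \<and> (\<forall>S\<in>K. M' \<subseteq> S \<longrightarrow> S = M') \<longrightarrow> card M = card M')"

definition nestoid :: "'a::{finite,bounded_lattice} set \<Rightarrow> bool" where
  "nestoid G \<longleftrightarrow> nestable G \<and> (\<forall>f\<in>G. pure_complex (nested_complex (G \<inter> {bot..f})))"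

section \<open>Fans\<close>

text \<open>
  Faces of cones are the nonempty sets \<open>F\<close> with \<open>F face_of C\<close>
  (the library also counts the empty set as a face).
\<close>

definition cone_faces :: "'v::real_vector set \<Rightarrow> 'v set set" where
  "cone_faces C = {F. F face_of C \<and> F \<noteq> {}}"

text \<open>Fans are taken with respect to a lattice \<open>\<Lambda>\<close> in a real vector space.\<close>

definition is_fan :: "'v::real_vector set \<Rightarrow> 'v set set \<Rightarrow> bool" where
  "is_fan \<Lambda> \<Sigma> \<longleftrightarrow> finite \<Sigma> \<and>
     (\<forall>\<sigma>\<in>\<Sigma>. (\<exists>S. finite S \<and> S \<subseteq> \<Lambda> \<and> \<sigma> = convex_cone hull S) \<and> \<sigma> \<inter> uminus ` \<sigma> = {0}) \<and>
     (\<forall>\<sigma>\<in>\<Sigma>. cone_faces \<sigma> \<subseteq> \<Sigma>) \<and>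
     (\<forall>\<sigma>\<in>\<Sigma>. \<forall>\<tau>\<in>\<Sigma>. \<sigma> \<inter> \<tau> \<in> cone_faces \<sigma> \<and> \<sigma> \<inter> \<tau> \<in> cone_faces \<tau>)"

definition simplicial_fan :: "'v::real_vector set \<Rightarrow> 'v set set \<Rightarrow> bool" where
  "simplicial_fan \<Lambda> \<Sigma> \<longleftrightarrow> is_fan \<Lambda> \<Sigma> \<and>
     (\<forall>\<sigma>\<in>\<Sigma>. \<exists>S. finite S \<and> independent S \<and> \<sigma> = convex_cone hull S)"

definition primitive_generators :: "'v::real_vector set \<Rightarrow> 'v set \<Rightarrow> 'v set" where
  "primitive_generators \<Lambda> \<sigma> = {v\<in>\<Lambda>. v \<noteq> 0 \<and> convex_cone hull {v} \<in> cone_faces \<sigma> \<and>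
     (\<forall>w\<in>\<Lambda>. \<forall>k::nat. v = real k *\<^sub>R w \<longrightarrow> k = 1)}"

definition int_basis :: "'v::real_vector set \<Rightarrow> 'v set \<Rightarrow> bool" where
  "int_basis \<Lambda> B \<longleftrightarrow> finite B \<and> B \<subseteq> \<Lambda> \<and>
     (\<forall>x\<in>\<Lambda>. \<exists>!c::'v \<Rightarrow> int. (\<forall>b. b \<notin> B \<longrightarrow> c b = 0) \<and> x = (\<Sum>b\<in>B. of_int (c b) *\<^sub>R b))"

definition unimodular_simplicial_fan :: "'v::real_vector set \<Rightarrow> 'v set set \<Rightarrow> bool" where
  "unimodular_simplicial_fan \<Lambda> \<Sigma> \<longleftrightarrow> simplicial_fan \<Lambda> \<Sigma> \<and>
     (\<forall>\<sigma>\<in>\<Sigma>. \<exists>B. int_basis \<Lambda> B \<and> primitive_generators \<Lambda> \<sigma> \<subseteq> B)"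

section \<open>The universe fan\<close>

text \<open>
  For \<open>S\<close> a subset of the finite lattice \<open>'a\<close>, the space with basis \<open>f\<^sup>+, f\<^sup>-\<close> (\<open>f \<in> S\<close>) is the
  coordinate subspace \<open>double_space S\<close> of \<^typ>\<open>real ^ ('a + 'a::finite)\<close>; the index \<open>Inl f\<close>
  stands for \<open>f\<^sup>+\<close> and \<open>Inr f\<close> for \<open>f\<^sup>-\<close>. Hence \<open>p\<^sub>f x = x $ Inl f\<close> and \<open>m\<^sub>f x = x $ Inr f\<close>.
\<close>

definition plus_vec :: "'a::finite \<Rightarrow> real ^ ('a + 'a)" where
  "plus_vec f = axis (Inl f) 1"

definition minus_vec :: "'a::finite \<Rightarrow> real ^ ('a + 'a)" where
  "minus_vec f = axis (Inr f) 1"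

definition double_space :: "'a::finite set \<Rightarrow> (real ^ ('a + 'a)) set" where
  "double_space S = span (plus_vec ` S \<union> minus_vec ` S)"

definition double_lattice :: "'a::finite set \<Rightarrow> (real ^ ('a + 'a)) set" where
  "double_lattice S = {x \<in> double_space S. \<forall>i. x $ i \<in> \<int>}"

definition double_cone :: "'a::finite set \<Rightarrow> (real ^ ('a + 'a)) set" where
  "double_cone N = convex_cone hull (plus_vec ` N \<union> minus_vec ` N)"

definition double_fan :: "'a::{finite,bounded_lattice} set \<Rightarrow> (real ^ ('a + 'a)) set set" where
  "double_fan G = (\<Union>N\<in>nested_complex G. cone_faces (double_cone N))"

definition causal_form :: "'a::{finite,bounded_lattice} set \<Rightarrow> 'a \<Rightarrow> real ^ ('a + 'a) \<Rightarrow> real" where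
  "causal_form G g x =
     x $ Inl top + (\<Sum>f | f \<in> G \<and> g < f \<and> f < top. x $ Inl f - x $ Inr f) - x $ Inr g"

definition causal_cone :: "'a::{finite,bounded_lattice} set \<Rightarrow> (real ^ ('a + 'a)) set" where
  "causal_cone G = {x \<in> double_space G. x $ Inr top = 0 \<and>
     (\<forall>g\<in>G. x $ Inl g \<ge> 0 \<and> x $ Inr g \<ge> 0 \<and> causal_form G g x \<ge> 0)}"

definition universe_fan :: "'a::{finite,bounded_lattice} set \<Rightarrow> (real ^ ('a + 'a)) set set" where
  "universe_fan G = (\<Union>\<sigma>\<in>double_fan G. cone_faces (\<sigma> \<inter> causal_cone G))"

section \<open>The rooted tree of a nested set and its tubings\<close>

text \<open>
  The vertices of the rooted tree are \<open>None\<close> (the root) and \<open>Some g\<close> for \<open>g \<in> N\<close>.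
  The edge labelled \<open>e \<in> N\<close> joins its lower endpoint \<open>Some e\<close> to its upper endpoint
  \<open>upper_end N e\<close>. The definite description is meaningful when the Hasse diagram of \<open>N\<close>
  is a forest, as it is for nested sets of a nestable \<open>G\<close>.
\<close>

definition hasse_covers :: "'a::order set \<Rightarrow> 'a \<Rightarrow> 'a \<Rightarrow> bool" where
  "hasse_covers N e g \<longleftrightarrow> e \<in> N \<and> g \<in> N \<and> e < g \<and> \<not> (\<exists>h\<in>N. e < h \<and> h < g)"

definition upper_end :: "'a::order set \<Rightarrow> 'a \<Rightarrow> 'a option" where
  "upper_end N e = (if \<exists>g\<in>N. e < g then Some (THE g. hasse_covers N e g) else None)"

definition tree_vertices :: "'a set \<Rightarrow> 'a option set" where
  "tree_vertices N = insert None (Some ` N)"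

definition edge_rel :: "'a::order set \<Rightarrow> 'a set \<Rightarrow> ('a option \<times> 'a option) set" where
  "edge_rel N S = {(u, v). \<exists>e\<in>S. {u, v} = {Some e, upper_end N e}}"

definition connected_subtree :: "'a::order set \<Rightarrow> 'a option set \<Rightarrow> 'a set \<Rightarrow> bool" where
  "connected_subtree N W S \<longleftrightarrow> W \<noteq> {} \<and> W \<subseteq> tree_vertices N \<and> S \<subseteq> N \<and>
     (\<forall>e\<in>S. Some e \<in> W \<and> upper_end N e \<in> W) \<and>
     (\<forall>u\<in>W. \<forall>v\<in>W. (u, v) \<in> (edge_rel N S)\<^sup>*)"

definition tube :: "'a::order set \<Rightarrow> 'a option set \<Rightarrow> bool" where
  "tube N t \<longleftrightarrow> connected_subtree N t {e\<in>N. Some e \<in> t \<and> upper_end N e \<in> t}"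

definition tubing :: "'a::order set \<Rightarrow> 'a option set set \<Rightarrow> bool" where
  "tubing N T \<longleftrightarrow> (\<forall>t\<in>T. tube N t) \<and> (\<forall>s\<in>T. \<forall>t\<in>T. s \<inter> t = {} \<or> s \<subseteq> t \<or> t \<subseteq> s)"

definition crosses :: "'a::order set \<Rightarrow> 'a option set set \<Rightarrow> 'a \<Rightarrow> bool" where
  "crosses N T e \<longleftrightarrow> (\<exists>t\<in>T. (Some e \<in> t) \<noteq> (upper_end N e \<in> t))"

definition entering :: "'a::order set \<Rightarrow> 'a option set \<Rightarrow> 'a set" where
  "entering N t = {e\<in>N. Some e \<in> t \<and> upper_end N e \<notin> t}"

definition leaving :: "'a::order set \<Rightarrow> 'a option set \<Rightarrow> 'a set" where
  "leaving N t = {e\<in>N. upper_end N e \<in> t \<and> Some e \<notin> t}"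

definition tube_vec :: "'a::{finite,order} set \<Rightarrow> 'a option set \<Rightarrow> real ^ ('a + 'a)" where
  "tube_vec N t = (\<Sum>e\<in>entering N t. plus_vec e) + (\<Sum>e\<in>leaving N t. minus_vec e)"

definition tubing_cone :: "'a::{finite,order} set \<Rightarrow> 'a option set set \<Rightarrow> (real ^ ('a + 'a)) set" where
  "tubing_cone N T = convex_cone hull (tube_vec N ` T)"

definition crossing_tubings ::
    "'a::{finite,bounded_lattice} set \<Rightarrow> ('a set \<times> 'a option set set) set" where
  "crossing_tubings G = {(N, T). N \<in> nested_complex G \<and> tubing N T \<and>
     tree_vertices N \<notin> T \<and> (\<forall>e\<in>N. crosses N T e)}"

section \<open>Lightcone subdivisions\<close>

text \<open>
  The space with basis \<open>N\<close> is the coordinate subspace \<open>node_space N\<close> of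
  \<^typ>\<open>real ^ ('a::finite)\<close>; elements of its quotient by the line of \<open>total_vec N\<close> are cosets.
\<close>

definition node_space :: "'a::finite set \<Rightarrow> (real ^ 'a) set" where
  "node_space N = span ((\<lambda>g. axis g 1) ` N)"

definition total_vec :: "'a::finite set \<Rightarrow> real ^ 'a" where
  "total_vec N = (\<Sum>g\<in>N. axis g 1)"

definition total_coset :: "'a::finite set \<Rightarrow> real ^ 'a \<Rightarrow> (real ^ 'a) set" where
  "total_coset N y = range (\<lambda>c. y + c *\<^sub>R total_vec N)"

definition lightcone_map ::
    "'a::{finite,bounded_lattice} set \<Rightarrow> real ^ ('a + 'a) \<Rightarrow> (real, 'a) vec set" where
  "lightcone_map N x = total_coset N (\<Sum>f\<in>N.
       x $ Inl f *\<^sub>R (\<Sum>g | g \<in> N \<and> g < f. axis g 1)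
     + x $ Inr f *\<^sub>R (\<Sum>g | g \<in> N \<and> (g > f \<or> inf g f = bot). axis g 1))"

definition linear_on_convex :: "('v::real_vector \<Rightarrow> real) \<Rightarrow> 'v set \<Rightarrow> bool" where
  "linear_on_convex F D \<longleftrightarrow> convex D \<and> (\<exists>l. linear l \<and> (\<forall>x\<in>D. F x = l x))"

text \<open>
  The domains of linearity of \<open>F\<close> on \<open>V\<close> are the inclusion-maximal convex subsets on which \<open>F\<close>
  agrees with a linear form. For \<open>F\<close> a sum of minima of coordinates, as below, these are the
  full-dimensional cones of the associated fan.
\<close>

definition linearity_domains :: "'v::real_vector set \<Rightarrow> ('v \<Rightarrow> real) \<Rightarrow> 'v set set" where
  "linearity_domains V F = {D. D \<subseteq> V \<and> linear_on_convex F D \<and>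
     (\<forall>D'. D' \<subseteq> V \<and> linear_on_convex F D' \<and> D \<subseteq> D' \<longrightarrow> D' = D)}"

definition building_fan :: "'a::finite set \<Rightarrow> 'a set set \<Rightarrow> (real ^ 'a) set set set" where
  "building_fan N B = (\<Union>D\<in>linearity_domains (node_space N) (\<lambda>x. \<Sum>t\<in>B. Min ((\<lambda>g. x $ g) ` t)).
     (\<lambda>C. total_coset N ` C) ` cone_faces D)"

definition lightcone_subdivision ::
    "'a::{finite,bounded_lattice} set \<Rightarrow> 'a set set \<Rightarrow> (real ^ ('a + 'a)) set set" where
  "lightcone_subdivision N B =
     (\<Union>C\<in>building_fan N B. cone_faces ({x \<in> double_space N. lightcone_map N x \<in> C} \<inter> double_cone N))"

definition graphical_building_set :: "'a::order set \<Rightarrow> 'a set set" where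
  "graphical_building_set N = {S. S \<noteq> {} \<and> S \<subseteq> N \<and> (\<exists>W. connected_subtree N W S)}"

definition maximal_lightcone_refinement ::
    "'a::{finite,bounded_lattice} set \<Rightarrow> (real ^ ('a + 'a)) set set" where
  "maximal_lightcone_refinement G =
     (\<Union>N\<in>nested_complex G. lightcone_subdivision N (graphical_building_set N))"

definition induced_triangulation ::
    "'a::{finite,bounded_lattice} set \<Rightarrow> (real ^ ('a + 'a)) set set" where
  "induced_triangulation G = {\<sigma> \<in> maximal_lightcone_refinement G. \<sigma> \<subseteq> \<Union> (universe_fan G)}"

end

theory Submission
  imports Defs
begin

text \<open>
  A point \<open>x\<close> of the cone of a nested set \<open>N\<close> is a height function on the vertices and the edges
  of the rooted tree of \<open>N\<close>, up to adding a constant: the coordinates of \<open>x\<close> at \<open>e\<^sup>+\<close> and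
  \<open>e\<^sup>-\<close> are the drops in height from the lower and from the upper end point of \<open>e\<close> down to \<open>e\<close>.
  A tree has no cycles, so arbitrary drops come from a height function, and \<open>x\<close> lies in the cone
  precisely when no edge is higher than one of its end points. In this picture the map
  \<open>\<phi>\<close> records the heights of the edges, and the vector of a tube \<open>t\<close> is the indicator function of
  the subtree induced by \<open>t\<close> (\<open>vertex_height_tube_vec\<close>, \<open>edge_height_tube_vec\<close>).

  The connected components of the superlevel sets of a height function are tubes, and they form
  a laminar family. Thus every point is a combination with positive coefficients of the vectors
  of a tubing without the full vertex set (\<open>double_cone_decomposition\<close>). The lightcone
  subdivision records, for every connected set of edges, where the minimal height is attained,
  together with the vanishing coordinates. These data determine the tubing: if \<open>x\<close> is a positive
  combination of the tubes in \<open>T\<close>, then a point \<open>z\<close> degenerating at least where \<open>x\<close> does is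
  constant on the part of each tube outside the smaller tubes, so it is a nonnegative
  combination of the same tubes (\<open>refined_cone_eq_tubing_cone\<close>). Since the cones of the
  subdivision are exactly the closures of the sets of points with the same data
  (\<open>lightcone_subdivision_eq\<close>), they are the cones of tubings.

  An edge \<open>e\<close> that no tube crosses carries zero coordinates and can be contracted, which passes
  to the nested set \<open>N - {e}\<close> (\<open>contract_edge\<close>). After all contractions \<open>N\<close> is the
  set of edges carrying a nonzero coordinate, so a point determines first \<open>N\<close> and then the
  generators of the cone having it in its relative interior. This makes the cones a fan.
  The fan is simplicial and unimodular because every tube \<open>t\<close> has a coordinate with value 1 in
  its own vector that occurs otherwise only in the vectors of smaller tubes: leave \<open>t\<close> along an edge
  inside the next larger tube (\<open>exit_pivot\<close>). Such unitriangular families extend to lattice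
  bases by unit vectors.

  Finally, the causal form at \<open>g\<close> compares the height of the vertex just above \<open>g\<close> with the height
  of the root. A proper tube containing the root violates one of the causal inequalities, and a tube
  avoiding the root satisfies all of them (\<open>tube_vec_causal_iff\<close>).
\<close>

section \<open>Faces of polyhedral and simplicial cones\<close>

text \<open>At a point \<open>y\<close> of a face where as few of the forms as possible vanish, the
  forms vanishing at \<open>y\<close> vanish on the whole face. Conversely a point of the cone at which these
  forms vanish lies on a segment of the cone through \<open>y\<close> that extends beyond \<open>y\<close>, so
  it belongs to the face.\<close>

lemma cone_faces_polyhedral:
  fixes V :: "'v::real_vector set" and L :: "('v \<Rightarrow> real) set"
  assumes V: "subspace V" and L: "finite L" "\<And>l. l \<in> L \<Longrightarrow> linear l"
  defines "C \<equiv> {z\<in>V. \<forall>l\<in>L. 0 \<le> l z}"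
  shows "cone_faces C = (\<lambda>y. {z\<in>C. \<forall>l\<in>L. l y = 0 \<longrightarrow> l z = 0}) ` C"
proof -
  define K where "K y = {z\<in>C. \<forall>l\<in>L. l y = 0 \<longrightarrow> l z = 0}" for y
  have lin: "l (a *\<^sub>R x + b *\<^sub>R y) = a * l x + b * l y" if "l \<in> L" for l a b x y
    using L(2)[OF that] by (simp add: linear_add linear_scale)
  have convC: "a *\<^sub>R x + b *\<^sub>R y \<in> C" if "x \<in> C" "y \<in> C" "0 \<le> a" "0 \<le> b" for x y a b
    using that V by (auto simp: C_def lin subspace_add subspace_scale)
  have "F \<in> {K y | y. y \<in> C}" if F: "F face_of C" "F \<noteq> {}" for F
  proof -
    have FC: "F \<subseteq> C" and cF: "convex F" using F face_of_imp_subset face_of_imp_convex by auto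
    define Z where "Z y = {l\<in>L. l y = 0}" for y
    obtain y where y: "y \<in> F" and ymin: "\<And>z. z \<in> F \<Longrightarrow> card (Z y) \<le> card (Z z)"
      using ex_has_least_nat[of "\<lambda>y. y \<in> F" _ "\<lambda>y. card (Z y)"] F(2) by blast
    have "F \<subseteq> K y"
    proof
      fix z assume z: "z \<in> F"
      define m where "m = (1/2) *\<^sub>R y + (1/2) *\<^sub>R z"
      have m: "m \<in> F" unfolding m_def using cF y z by (intro convexD) auto
      have sub: "Z m \<subseteq> Z y \<inter> Z z"
      proof
        fix l assume l: "l \<in> Z m"
        then have "l \<in> L" "l y + l z = 0" using lin[of l "1/2" y "1/2" z] by (auto simp: Z_def m_def)
        moreover have "0 \<le> l y" "0 \<le> l z" using FC y z \<open>l \<in> L\<close> by (auto simp: C_def)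
        ultimately show "l \<in> Z y \<inter> Z z" by (auto simp: Z_def)
      qed
      have "finite (Z y)" using L(1) by (auto simp: Z_def)
      then have "Z m = Z y" using sub ymin[OF m] by (intro card_seteq) auto
      then show "z \<in> K y" using sub z FC by (auto simp: K_def Z_def)
    qed
    moreover have "K y \<subseteq> F"
    proof
      fix z assume z: "z \<in> K y"
      have yC: "y \<in> C" and zC: "z \<in> C" using y FC z by (auto simp: K_def)
      show "z \<in> F"
      proof (cases "z = y")
        case False
        \<comment> \<open>Beyond \<open>y\<close>, the ray from \<open>z\<close> stays in the cone for a positive time: the forms
          vanishing at \<open>y\<close> vanish on the whole line.\<close>
        have "\<exists>d>0. \<forall>l\<in>M. 0 \<le> l y + d * (l y - l z)" if "M \<subseteq> L" for M
        proof -
          from that L(1) have "finite M" by (rule finite_subset)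
          then show ?thesis using that
          proof induction
            case empty show ?case by (intro exI[of _ 1]) simp
          next
            case (insert l M)
            then obtain d where d: "d > 0" "\<forall>l\<in>M. 0 \<le> l y + d * (l y - l z)" by auto
            have lL: "l \<in> L" using insert by auto
            have ly: "0 \<le> l y" using lL yC by (auto simp: C_def)
            have lz: "0 \<le> l z" using lL zC by (auto simp: C_def)
            have van: "l y = 0 \<Longrightarrow> l z = 0" using lL z by (auto simp: K_def)
            define d' where "d' = (if l y = 0 then d else min d (l y / (l z + 1)))"
            have d': "0 < d'" "d' \<le> d" using d ly lz by (auto simp: d'_def)
            have "0 \<le> l y + d' * (l y - l z)"
            proof (cases "l y = 0")
              case True then show ?thesis using van by simp
            next
              case False
              have "d' \<le> l y / (l z + 1)" using False by (simp add: d'_def)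
              then have "d' * (l z + 1) \<le> l y" using lz by (simp add: pos_le_divide_eq)
              then have "d' * l z \<le> l y" using d' by (simp add: algebra_simps)
              moreover have "0 \<le> d' * l y" using d' ly by simp
              ultimately show ?thesis by (simp add: algebra_simps)
            qed
            moreover have "0 \<le> k y + d' * (k y - k z)" if "k \<in> M" for k
            proof (cases "k y - k z \<ge> 0")
              case True
              have "k \<in> L" using that insert by auto
              then have "0 \<le> k y" using yC by (auto simp: C_def)
              then show ?thesis using True d' by auto
            next
              case False
              then have "d' * (k y - k z) \<ge> d * (k y - k z)" using d' by (intro mult_right_mono_neg) auto
              then show ?thesis using d(2) that by force
            qed
            ultimately show ?case using d' by (intro exI[of _ d']) auto
          qed
        qed
        then obtain d where d: "d > 0" "\<forall>l\<in>L. 0 \<le> l y + d * (l y - l z)" by blast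
        define y' where "y' = (1 + d) *\<^sub>R y + (-d) *\<^sub>R z"
        have "y' \<in> V" unfolding y'_def
          by (intro subspace_add[OF V] subspace_scale[OF V]) (use yC zC in \<open>auto simp: C_def\<close>)
        moreover have "0 \<le> l y'" if "l \<in> L" for l
          using bspec[OF d(2) that] unfolding y'_def lin[OF that] by (simp add: algebra_simps)
        ultimately have y'C: "y' \<in> C" by (auto simp: C_def)
        have ne: "z \<noteq> y'"
        proof
          assume "z = y'"
          then have "(1 + d) *\<^sub>R (z - y) = 0" by (simp add: y'_def algebra_simps)
          then show False using False d by auto
        qed
        have yeq: "y = (1 - 1/(1+d)) *\<^sub>R z + (1/(1+d)) *\<^sub>R y'"
        proof -
          have "(1/(1+d)) *\<^sub>R y' = y - (d/(1+d)) *\<^sub>R z" using d(1)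
            by (simp add: y'_def scaleR_right_diff_distrib)
          moreover have "1 - 1/(1+d) = d/(1+d)" using d(1) by (simp add: field_simps)
          ultimately show ?thesis by simp
        qed
        have "y \<in> open_segment z y'" unfolding in_segment
          using d(1) ne by (intro conjI exI[of _ "1/(1+d)"] yeq) auto
        then show ?thesis using F(1) y y'C zC unfolding face_of_def by blast
      qed (use y in simp)
    qed
    ultimately show ?thesis using y FC by auto
  qed
  moreover have "K y face_of C \<and> K y \<noteq> {}" if "y \<in> C" for y
  proof -
    have "convex (K y)" unfolding convex_def K_def using convC by (auto simp: lin)
    moreover have "a \<in> K y \<and> b \<in> K y" if ab: "a \<in> C" "b \<in> C" and x: "x \<in> K y" "x \<in> open_segment a b" for a b x
    proof -
      obtain u where u: "0 < u" "u < 1" "x = (1 - u) *\<^sub>R a + u *\<^sub>R b"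
        using x(2) by (auto simp: in_segment)
      have "l a = 0 \<and> l b = 0" if l: "l \<in> L" "l y = 0" for l
      proof -
        have "(1 - u) * l a + u * l b = 0" using x(1) l lin[OF l(1), of "1-u" a u b] u(3) by (auto simp: K_def)
        moreover have "0 \<le> (1 - u) * l a" "0 \<le> u * l b" using ab l u by (auto simp: C_def)
        ultimately have "(1 - u) * l a = 0" "u * l b = 0" by linarith+
        then show ?thesis using u by auto
      qed
      then show ?thesis using ab by (auto simp: K_def)
    qed
    ultimately show ?thesis using that unfolding face_of_def K_def by blast
  qed
  ultimately show ?thesis unfolding cone_faces_def K_def setcompr_eq_image[symmetric] by blast
qed

text \<open>For linearly independent \<open>W\<close> these are the points in the relative interior of the cone
  spanned by \<open>W\<close>.\<close>

definition pos_comb :: "'v::real_vector set \<Rightarrow> 'v \<Rightarrow> bool" where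
  "pos_comb W x \<longleftrightarrow> (\<exists>c. (\<forall>w\<in>W. 0 < c w) \<and> x = (\<Sum>w\<in>W. c w *\<^sub>R w))"

lemma convex_cone_hull_finite:
  assumes "finite W"
  shows "convex_cone hull W = {\<Sum>w\<in>W. c w *\<^sub>R w | c. \<forall>w\<in>W. (0::real) \<le> c w}" (is "_ = ?R")
proof (rule hull_unique)
  show "W \<subseteq> ?R"
  proof
    fix w assume "w \<in> W"
    then have "w = (\<Sum>v\<in>W. (if v = w then 1 else 0) *\<^sub>R v)"
      using assms by (simp add: if_distrib[of "\<lambda>c. c *\<^sub>R _"] cong: if_cong)
    then show "w \<in> ?R" by (intro CollectI exI[of _ "\<lambda>v. if v = w then 1 else 0"]) auto
  qed
  show "convex_cone ?R" unfolding convex_cone_iff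
  proof (intro conjI ballI allI impI)
    show "0 \<in> ?R" by (intro CollectI exI[of _ "\<lambda>v. 0"]) auto
  next
    fix x y assume "x \<in> ?R" "y \<in> ?R"
    then obtain c d where "\<forall>w\<in>W. 0 \<le> c w" "x = (\<Sum>w\<in>W. c w *\<^sub>R w)"
      "\<forall>w\<in>W. 0 \<le> d w" "y = (\<Sum>w\<in>W. d w *\<^sub>R w)" by auto
    then show "x + y \<in> ?R"
      by (intro CollectI exI[of _ "\<lambda>v. c v + d v"]) (auto simp: scaleR_left_distrib sum.distrib)
  next
    fix x and k :: real assume "x \<in> ?R" "0 \<le> k"
    then obtain c where "\<forall>w\<in>W. 0 \<le> c w" "x = (\<Sum>w\<in>W. c w *\<^sub>R w)" by auto
    then show "k *\<^sub>R x \<in> ?R" using \<open>0 \<le> k\<close>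
      by (intro CollectI exI[of _ "\<lambda>v. k * c v"]) (auto simp: scaleR_sum_right)
  qed
next
  fix T assume T: "W \<subseteq> T" "convex_cone T"
  show "?R \<subseteq> T"
  proof clarify
    fix c :: "'a \<Rightarrow> real" assume c: "\<forall>w\<in>W. 0 \<le> c w"
    have "(\<Sum>w\<in>A. c w *\<^sub>R w) \<in> T" if "A \<subseteq> W" for A
      using finite_subset[OF that assms] that
    proof induction
      case empty show ?case using convex_cone_contains_0[OF T(2)] by simp
    next
      case (insert w A)
      then have "c w *\<^sub>R w \<in> T" using T c by (intro convex_cone_scaleR) auto
      then show ?case using insert convex_cone_add[OF T(2)] by simp
    qed
    then show "(\<Sum>w\<in>W. c w *\<^sub>R w) \<in> T" by blast
  qed
qed

lemma pos_comb_in_cone: "finite W \<Longrightarrow> pos_comb W x \<Longrightarrow> x \<in> convex_cone hull W"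
  unfolding pos_comb_def by (auto simp: convex_cone_hull_finite less_imp_le)

lemma in_cone_imp_pos_comb:
  assumes "finite W" "x \<in> convex_cone hull W"
  obtains A where "A \<subseteq> W" "pos_comb A x"
proof -
  obtain c where c: "\<forall>w\<in>W. 0 \<le> c w" "x = (\<Sum>w\<in>W. c w *\<^sub>R w)"
    using assms by (auto simp: convex_cone_hull_finite)
  let ?A = "{w\<in>W. c w \<noteq> 0}"
  have "x = (\<Sum>w\<in>?A. c w *\<^sub>R w)" unfolding c(2) using assms(1) by (intro sum.mono_neutral_right) auto
  moreover have "\<forall>w\<in>?A. 0 < c w" using c(1) by (auto simp: order_less_le)
  ultimately have "pos_comb ?A x" unfolding pos_comb_def by blast
  then show thesis using that[of ?A] by auto
qed

lemma face_of_convex_cone_sumD: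
  assumes C: "convex_cone C" and F: "F face_of C" and ab: "a \<in> C" "b \<in> C" "a + b \<in> F"
  shows "a \<in> F"
proof -
  have "conic F" using face_of_conic[of C F] C F by (simp add: convex_cone_def)
  then have m: "(1/2) *\<^sub>R (a + b) \<in> F" using ab(3) unfolding conic_def by auto
  show ?thesis
  proof (cases "a = b")
    case True
    then show ?thesis using m by (simp add: scaleR_2[symmetric])
  next
    case False
    have "(1/2) *\<^sub>R (a + b) \<in> open_segment a b"
      unfolding in_segment using False by (intro conjI exI[of _ "1/2"]) (auto simp: scaleR_right_distrib)
    then show ?thesis using F ab m unfolding face_of_def by blast
  qed
qed

lemma independent_sum_unique:
  assumes "independent W" "finite W" "(\<Sum>w\<in>W. c w *\<^sub>R w) = (\<Sum>w\<in>W. d w *\<^sub>R w)" "w \<in> W"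
  shows "c w = (d w :: real)"
proof -
  have "(\<Sum>w\<in>W. (c w - d w) *\<^sub>R w) = 0"
    using assms(3) by (simp add: scaleR_left_diff_distrib sum_subtractf)
  then have "c w - d w = 0" using independentD[of W W "\<lambda>w. c w - d w" w] assms by simp
  then show ?thesis by simp
qed

lemma in_subcone_iff:
  assumes W: "independent W" "finite W" and A: "A \<subseteq> W"
  shows "(\<Sum>w\<in>W. c w *\<^sub>R w) \<in> convex_cone hull A \<longleftrightarrow>
    (\<forall>w\<in>A. 0 \<le> c w) \<and> (\<forall>w\<in>W - A. c w = (0::real))"
proof
  have fA: "finite A" using A W(2) finite_subset by blast
  assume "(\<Sum>w\<in>W. c w *\<^sub>R w) \<in> convex_cone hull A"
  then obtain d where d: "\<forall>w\<in>A. 0 \<le> d w" "(\<Sum>w\<in>W. c w *\<^sub>R w) = (\<Sum>w\<in>A. d w *\<^sub>R w)"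
    using convex_cone_hull_finite[OF fA] by auto
  have e: "(\<Sum>w\<in>A. d w *\<^sub>R w) = (\<Sum>w\<in>W. (if w \<in> A then d w else 0) *\<^sub>R w)"
    using A W(2) by (intro sum.mono_neutral_cong_left) auto
  have "\<And>w. w \<in> W \<Longrightarrow> c w = (if w \<in> A then d w else 0)"
    by (rule independent_sum_unique[OF W trans[OF d(2) e]])
  then show "(\<forall>w\<in>A. 0 \<le> c w) \<and> (\<forall>w\<in>W - A. c w = 0)" using d(1) A by auto
next
  have fA: "finite A" using A W(2) finite_subset by blast
  assume c: "(\<forall>w\<in>A. 0 \<le> c w) \<and> (\<forall>w\<in>W - A. c w = 0)"
  then have "(\<Sum>w\<in>W. c w *\<^sub>R w) = (\<Sum>w\<in>A. c w *\<^sub>R w)"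
    using A W(2) by (intro sum.mono_neutral_right) auto
  then show "(\<Sum>w\<in>W. c w *\<^sub>R w) \<in> convex_cone hull A"
    using c convex_cone_hull_finite[OF fA] by auto
qed

text \<open>A face of a cone contains the summands of each sum of cone elements that it contains, so
  it is spanned by the generators lying in it. Conversely, the coordinates outside \<open>A\<close> are
  nonnegative on the whole cone; where they vanish at an inner point of a segment, they vanish
  at both ends.\<close>

lemma cone_faces_simplicial:
  assumes W: "independent W" "finite W"
  shows "cone_faces (convex_cone hull W) = {convex_cone hull A | A. A \<subseteq> W}"
proof -
  let ?C = "convex_cone hull W"
  have cc: "convex_cone ?C" by (rule convex_cone_convex_cone_hull)
  have "\<exists>A\<subseteq>W. F = convex_cone hull A" if F: "F face_of ?C" "F \<noteq> {}" for F
  proof (intro exI[of _ "W \<inter> F"] conjI antisym)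
    show "F \<subseteq> convex_cone hull (W \<inter> F)"
    proof
      fix x assume x: "x \<in> F"
      then have "x \<in> ?C" using F face_of_imp_subset by blast
      then obtain A where A: "A \<subseteq> W" "pos_comb A x" using in_cone_imp_pos_comb[OF W(2)] by metis
      have fA: "finite A" using A W(2) finite_subset by blast
      obtain c where c: "\<forall>w\<in>A. 0 < c w" "x = (\<Sum>w\<in>A. c w *\<^sub>R w)" using A(2) unfolding pos_comb_def by auto
      have con: "conic F" using face_of_conic[of ?C F] cc F by (simp add: convex_cone_def)
      have "w \<in> F" if w: "w \<in> A" for w
      proof -
        have xe: "x = c w *\<^sub>R w + (\<Sum>w\<in>A - {w}. c w *\<^sub>R w)" unfolding c(2) using fA w by (simp add: sum.remove)
        have inC: "v \<in> W \<Longrightarrow> v \<in> ?C" for v using hull_inc[of v W] by simp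
        have sC: "(\<Sum>w\<in>B. c w *\<^sub>R w) \<in> ?C" if "B \<subseteq> A" for B
          using finite_subset[OF that fA] that
        proof induction
          case empty show ?case using convex_cone_hull_contains_0 by simp
        next
          case (insert w B)
          then have "c w *\<^sub>R w \<in> ?C" using c A by (intro convex_cone_hull_mul inC) (auto intro: less_imp_le)
          then show ?case using insert convex_cone_hull_add by simp
        qed
        have "c w *\<^sub>R w \<in> F"
        proof (rule face_of_convex_cone_sumD[OF cc F(1) _ sC[of "A - {w}"]])
          show "c w *\<^sub>R w \<in> ?C" using c A w by (intro convex_cone_hull_mul inC) (auto intro: less_imp_le)
        qed (use x xe in auto)
        then have "(1 / c w) *\<^sub>R c w *\<^sub>R w \<in> F" using con c(1) w unfolding conic_def
          by (metis divide_nonneg_pos zero_le_one)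
        then show ?thesis using c(1) w by (simp add: order_less_le)
      qed
      then have "A \<subseteq> W \<inter> F" using A by blast
      then show "x \<in> convex_cone hull (W \<inter> F)"
        using pos_comb_in_cone[OF fA A(2)] hull_mono by blast
    qed
    have "convex F" "conic F" using F cc face_of_conic[of ?C F] face_of_imp_convex by (auto simp: convex_cone_def)
    then have "convex_cone F" using F(2) by (simp add: convex_cone_def)
    then show "convex_cone hull (W \<inter> F) \<subseteq> F" by (intro hull_minimal) auto
  qed auto
  moreover have "convex_cone hull A face_of ?C" if A: "A \<subseteq> W" for A
    unfolding face_of_def
  proof (intro conjI ballI impI)
    show "convex_cone hull A \<subseteq> ?C" using A by (rule hull_mono)
    show "convex (convex_cone hull A)" by (rule convex_convex_cone_hull)
    fix a b x assume a: "a \<in> ?C" and b: "b \<in> ?C" and x: "x \<in> convex_cone hull A" "x \<in> open_segment a b"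
    obtain c where c: "\<forall>w\<in>W. 0 \<le> c w" "a = (\<Sum>w\<in>W. c w *\<^sub>R w)" using a convex_cone_hull_finite[OF W(2)] by auto
    obtain d where d: "\<forall>w\<in>W. 0 \<le> d w" "b = (\<Sum>w\<in>W. d w *\<^sub>R w)" using b convex_cone_hull_finite[OF W(2)] by auto
    obtain u where u: "0 < u" "u < 1" "x = (1 - u) *\<^sub>R a + u *\<^sub>R b"
      using x(2) by (auto simp: in_segment)
    have "x = (\<Sum>w\<in>W. ((1 - u) * c w + u * d w) *\<^sub>R w)"
      unfolding u(3) c(2) d(2) by (simp add: scaleR_sum_right scaleR_left_distrib sum.distrib)
    then have z: "\<forall>w\<in>W - A. (1 - u) * c w + u * d w = 0"
      using in_subcone_iff[OF W A] x(1) by auto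
    have "c w = 0 \<and> d w = 0" if "w \<in> W - A" for w
    proof -
      have "0 \<le> (1 - u) * c w" "0 \<le> u * d w" using c d u that by auto
      then have "(1 - u) * c w = 0" "u * d w = 0" using bspec[OF z that] by linarith+
      then show ?thesis using u by auto
    qed
    then show "a \<in> convex_cone hull A" "b \<in> convex_cone hull A"
      using c d A in_subcone_iff[OF W A] by auto
  qed
  ultimately have "F \<in> cone_faces ?C \<longleftrightarrow> (\<exists>A\<subseteq>W. F = convex_cone hull A)" for F
    unfolding cone_faces_def using convex_cone_hull_nonempty by (smt (verit) mem_Collect_eq)
  then show ?thesis by auto
qed

section \<open>Unitriangular families of lattice vectors\<close>

lemma axis_expansion:
  fixes x :: "real ^ 'n::finite"
  assumes "\<And>i. i \<notin> I \<Longrightarrow> x $ i = 0"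
  shows "x = (\<Sum>i\<in>I. x $ i *\<^sub>R axis i 1)"
proof (rule vec_eq_iff[THEN iffD2], rule allI)
  fix i
  have "(\<Sum>j\<in>I. x $ j *\<^sub>R axis j 1) $ i = (\<Sum>j\<in>I. if j = i then x $ j else 0)"
    by (intro trans[OF sum_component] sum.cong) (auto simp: axis_def)
  also have "\<dots> = x $ i" using assms[of i] by (simp add: sum.delta)
  finally show "x $ i = (\<Sum>j\<in>I. x $ j *\<^sub>R axis j 1) $ i" ..
qed

definition coord_lattice :: "'n set \<Rightarrow> (real ^ 'n::finite) set" where
  "coord_lattice I = {x. (\<forall>i. x $ i \<in> \<int>) \<and> (\<forall>i. i \<notin> I \<longrightarrow> x $ i = 0)}"

definition int_combs :: "'v::real_vector set \<Rightarrow> 'v set" where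
  "int_combs B = {\<Sum>b\<in>B. of_int (c b) *\<^sub>R b | c :: 'v \<Rightarrow> int. True}"

lemma int_combsI: "x = (\<Sum>b\<in>B. of_int (c b) *\<^sub>R b) \<Longrightarrow> x \<in> int_combs B"
  by (auto simp: int_combs_def)

lemma int_combs_add: "x \<in> int_combs B \<Longrightarrow> y \<in> int_combs B \<Longrightarrow> x + y \<in> int_combs B"
proof -
  assume "x \<in> int_combs B" "y \<in> int_combs B"
  then obtain c d where "x = (\<Sum>b\<in>B. of_int (c b) *\<^sub>R b)" "y = (\<Sum>b\<in>B. of_int (d b) *\<^sub>R b)"
    by (auto simp: int_combs_def)
  then have "x + y = (\<Sum>b\<in>B. of_int (c b + d b) *\<^sub>R b)"
    by (simp add: scaleR_left_distrib sum.distrib)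
  then show ?thesis by (rule int_combsI)
qed

lemma int_combs_scale: "x \<in> int_combs B \<Longrightarrow> k \<in> \<int> \<Longrightarrow> k *\<^sub>R x \<in> int_combs B"
proof -
  assume "x \<in> int_combs B" "k \<in> \<int>"
  then obtain c d where "x = (\<Sum>b\<in>B. of_int (c b) *\<^sub>R b)" "k = of_int d"
    by (auto simp: int_combs_def elim: Ints_cases)
  then have "k *\<^sub>R x = (\<Sum>b\<in>B. of_int (d * c b) *\<^sub>R b)"
    by (simp add: scaleR_sum_right)
  then show ?thesis by (rule int_combsI)
qed

lemma int_combs_0: "0 \<in> int_combs B"
  unfolding int_combs_def by (intro CollectI exI[of _ "\<lambda>_. 0"]) auto

lemma int_combs_base: "finite B \<Longrightarrow> b \<in> B \<Longrightarrow> b \<in> int_combs B"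
proof -
  assume "finite B" "b \<in> B"
  then have "b = (\<Sum>v\<in>B. of_int (if v = b then 1 else 0) *\<^sub>R v)"
    by (simp add: if_distrib[of "\<lambda>c. of_int c *\<^sub>R _"] cong: if_cong)
  then show ?thesis by (rule int_combsI)
qed

lemma int_combs_sum: "finite A \<Longrightarrow> (\<And>a. a \<in> A \<Longrightarrow> f a \<in> int_combs B) \<Longrightarrow> sum f A \<in> int_combs B"
  by (induction rule: finite_induct) (auto intro: int_combs_0 int_combs_add)

lemma int_basisI:
  assumes "independent B" "finite B" "B \<subseteq> \<Lambda>" "\<Lambda> \<subseteq> int_combs B"
  shows "int_basis \<Lambda> B"
  unfolding int_basis_def
proof (intro conjI ballI assms)
  fix x assume "x \<in> \<Lambda>"
  then obtain c :: "'a \<Rightarrow> int" where c: "x = (\<Sum>b\<in>B. of_int (c b) *\<^sub>R b)"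
    using assms(4) by (auto simp: int_combs_def)
  show "\<exists>!c::'a \<Rightarrow> int. (\<forall>b. b \<notin> B \<longrightarrow> c b = 0) \<and> x = (\<Sum>b\<in>B. of_int (c b) *\<^sub>R b)"
  proof (rule ex1I[of _ "\<lambda>b. if b \<in> B then c b else 0"])
    show "(\<forall>b. b \<notin> B \<longrightarrow> (if b \<in> B then c b else 0) = 0) \<and>
        x = (\<Sum>b\<in>B. of_int (if b \<in> B then c b else 0) *\<^sub>R b)"
      unfolding c by (auto intro: sum.cong)
    fix d :: "'a \<Rightarrow> int" assume d: "(\<forall>b. b \<notin> B \<longrightarrow> d b = 0) \<and> x = (\<Sum>b\<in>B. of_int (d b) *\<^sub>R b)"
    show "d = (\<lambda>b. if b \<in> B then c b else 0)"
    proof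
      fix b
      have "real_of_int (d b) = of_int (c b)" if "b \<in> B"
        by (rule independent_sum_unique[OF assms(1,2) _ that]) (use c d in simp)
      then show "d b = (if b \<in> B then c b else 0)" using d by auto
    qed
  qed
qed

text \<open>Listing the sets in \<open>T\<close> by size, the matrix with entries \<open>w s $ pivot t\<close> is triangular
  with ones on the diagonal.\<close>

locale unitriangular =
  fixes T :: "'b set set" and w :: "'b set \<Rightarrow> real ^ 'n::finite" and pivot :: "'b set \<Rightarrow> 'n" and I :: "'n set"
  assumes finite_T: "finite T"
    and pivot_one: "t \<in> T \<Longrightarrow> w t $ pivot t = 1"
    and pivot_zero: "s \<in> T \<Longrightarrow> t \<in> T \<Longrightarrow> w s $ pivot t \<noteq> 0 \<Longrightarrow> s \<subseteq> t"
    and lattice: "t \<in> T \<Longrightarrow> w t \<in> coord_lattice I"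
begin

lemma inj_on_w: "inj_on w T"
proof (rule inj_onI)
  fix s t assume "s \<in> T" "t \<in> T" "w s = w t"
  then show "s = t" using pivot_one[of s] pivot_one[of t] pivot_zero[of s t] pivot_zero[of t s] by auto
qed

definition completed_basis :: "(real ^ 'n) set" where
  "completed_basis = w ` T \<union> (\<lambda>j. axis j 1) ` (I - pivot ` T)"

lemma finite_basis: "finite completed_basis"
  using finite_T by (simp add: completed_basis_def)

text \<open>In a vanishing combination, a smallest set with nonzero coefficient is the only one to
  contribute at its pivot coordinate.\<close>

lemma independent_basis: "independent completed_basis"
proof (rule real_vector.independent_if_scalars_zero[OF finite_basis])
  fix f :: "real ^ 'n \<Rightarrow> real" and x
  assume sum0: "(\<Sum>x\<in>completed_basis. f x *\<^sub>R x) = 0" and x: "x \<in> completed_basis"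
  have coord: "(\<Sum>x\<in>completed_basis. f x * x $ i) = 0" for i
    using arg_cong[OF sum0, of "\<lambda>v. v $ i"] by (simp add: sum_component)
  have fw: "f (w t) = 0" if "t \<in> T" for t
  proof (rule ccontr)
    assume "f (w t) \<noteq> 0"
    then have "{t\<in>T. f (w t) \<noteq> 0} \<noteq> {}" using that by auto
    then obtain t where t: "t \<in> T" "f (w t) \<noteq> 0" and
      tmin: "\<And>s. s \<in> T \<Longrightarrow> f (w s) \<noteq> 0 \<Longrightarrow> s \<subseteq> t \<Longrightarrow> s = t"
      using finite_has_minimal[of "{t\<in>T. f (w t) \<noteq> 0}"] finite_T by auto
    have "f b * b $ pivot t = 0" if b: "b \<in> completed_basis" "b \<noteq> w t" for b
    proof (cases "b \<in> w ` T")
      case True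
      then show ?thesis using b t tmin pivot_zero by auto
    next
      case False
      then obtain j where "b = axis j 1" "j \<notin> pivot ` T" using b by (auto simp: completed_basis_def)
      moreover from this have "pivot t \<noteq> j" using t by auto
      ultimately show ?thesis by (simp add: axis_def)
    qed
    then have "(\<Sum>b\<in>completed_basis - {w t}. f b * b $ pivot t) = 0"
      by (intro sum.neutral) blast
    moreover have "w t \<in> completed_basis" using t by (simp add: completed_basis_def)
    ultimately have "(\<Sum>b\<in>completed_basis. f b * b $ pivot t) = f (w t) * w t $ pivot t"
      using finite_basis by (simp add: sum.remove[of _ "w t"])
    then show False using coord[of "pivot t"] t pivot_one by auto
  qed
  show "f x = 0"
  proof (cases "x \<in> w ` T")
    case True then show ?thesis using fw by auto
  next
    case False
    then obtain j where j: "x = axis j 1" using x by (auto simp: completed_basis_def)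
    have "f b * b $ j = 0" if b: "b \<in> completed_basis" "b \<noteq> x" for b
    proof (cases "b \<in> w ` T")
      case True then show ?thesis using fw by auto
    next
      case False
      then obtain k where "b = axis k 1" using b by (auto simp: completed_basis_def)
      moreover from this have "j \<noteq> k" using b j by auto
      ultimately show ?thesis by (simp add: axis_def)
    qed
    then have "(\<Sum>b\<in>completed_basis - {x}. f b * b $ j) = 0"
      by (intro sum.neutral) blast
    then have "(\<Sum>b\<in>completed_basis. f b * b $ j) = f x * x $ j"
      using x finite_basis by (simp add: sum.remove[of _ x])
    then show ?thesis using coord[of j] j by (simp add: axis_def)
  qed
qed

lemma independent_w: "independent (w ` T)"
  using independent_basis by (rule independent_mono) (auto simp: completed_basis_def)

text \<open>Clearing the pivot coordinates of an integer vector from the smallest sets upwards never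
  spoils a coordinate that has been cleared before, and leaves a combination of unit vectors.\<close>

lemma lattice_subset_int_combs: "coord_lattice I \<subseteq> int_combs completed_basis"
proof
  fix x assume x: "x \<in> coord_lattice I"
  have "x \<in> int_combs completed_basis"
    if "finite U" "U \<subseteq> T" "\<And>s t. s \<in> U \<Longrightarrow> t \<in> T \<Longrightarrow> s \<subseteq> t \<Longrightarrow> t \<in> U"
      "x \<in> coord_lattice I" "\<And>t. t \<in> T - U \<Longrightarrow> x $ pivot t = 0" for U
    using that
  proof (induction "card U" arbitrary: U x)
    case 0
    then have z: "x $ j = 0" if "j \<notin> I - pivot ` T" for j
      using that by (auto simp: coord_lattice_def)
    have "x = (\<Sum>j\<in>I - pivot ` T. x $ j *\<^sub>R axis j 1)" by (rule axis_expansion) (rule z)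
    also have "\<dots> \<in> int_combs completed_basis"
      by (intro int_combs_sum int_combs_scale int_combs_base finite_basis)
        (use 0 in \<open>auto simp: completed_basis_def coord_lattice_def\<close>)
    finally show ?case .
  next
    case (Suc n)
    then have "U \<noteq> {}" by auto
    then obtain t where t: "t \<in> U" and tmin: "\<And>s. s \<in> U \<Longrightarrow> s \<subseteq> t \<Longrightarrow> s = t"
      using finite_has_minimal[of U] Suc.prems(1) by auto
    define y where "y = x - x $ pivot t *\<^sub>R w t"
    have tT: "t \<in> T" using t Suc.prems(2) by auto
    have yL: "y \<in> coord_lattice I"
      using lattice[OF tT] Suc.prems(4) by (auto simp: coord_lattice_def y_def)
    have "y \<in> int_combs completed_basis"
    proof (rule Suc.hyps(1)[of "U - {t}"])
      show "n = card (U - {t})" using Suc.hyps(2) t Suc.prems(1) by simp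
      show "s \<in> U - {t} \<Longrightarrow> r \<in> T \<Longrightarrow> s \<subseteq> r \<Longrightarrow> r \<in> U - {t}" for s r
        using Suc.prems(3) tmin by blast
      fix r assume r: "r \<in> T - (U - {t})"
      show "y $ pivot r = 0"
      proof (cases "r = t")
        case True then show ?thesis using pivot_one[OF tT] by (simp add: y_def)
      next
        case False
        then have "x $ pivot r = 0" "w t $ pivot r = 0"
          using r Suc.prems(3,5) t tT pivot_zero[of t r] by auto
        then show ?thesis by (simp add: y_def)
      qed
    qed (use Suc.prems yL in auto)
    moreover have "x $ pivot t *\<^sub>R w t \<in> int_combs completed_basis"
      by (intro int_combs_scale int_combs_base finite_basis)
        (use Suc.prems tT in \<open>auto simp: completed_basis_def coord_lattice_def\<close>)
    ultimately have "y + x $ pivot t *\<^sub>R w t \<in> int_combs completed_basis" by (rule int_combs_add)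
    then show ?case by (simp add: y_def)
  qed
  from this[of T] show "x \<in> int_combs completed_basis" using finite_T x by auto
qed

lemma int_basis_completed: "int_basis (coord_lattice I) completed_basis"
proof (rule int_basisI[OF independent_basis finite_basis])
  show "completed_basis \<subseteq> coord_lattice I"
    using lattice by (auto simp: completed_basis_def) (auto simp: coord_lattice_def axis_def)
qed (rule lattice_subset_int_combs)

text \<open>The vector \<open>w t\<close> has an entry 1, so it is no proper integer multiple of a lattice vector. For
  the same reason a lattice vector \<open>v\<close> on the ray of \<open>w t\<close> is an integer multiple of
  \<open>w t\<close>, namely by the entry of \<open>v\<close> at the pivot of \<open>t\<close>.\<close>

lemma primitive_generators_cone:
  "primitive_generators (coord_lattice I) (convex_cone hull (w ` T)) = w ` T"
proof -
  let ?C = "convex_cone hull (w ` T)"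
  have fin: "finite (w ` T)" using finite_T by simp
  note faces = cone_faces_simplicial[OF independent_w fin]
  have "v \<in> w ` T" if v: "v \<in> primitive_generators (coord_lattice I) ?C" for v
  proof -
    have vL: "v \<in> coord_lattice I" and v0: "v \<noteq> 0" and prim: "\<And>u k. u \<in> coord_lattice I \<Longrightarrow> v = real k *\<^sub>R u \<Longrightarrow> k = 1"
      using v unfolding primitive_generators_def by auto
    have "convex_cone hull {v} \<in> cone_faces ?C" using v unfolding primitive_generators_def by auto
    then obtain A where A: "A \<subseteq> w ` T" "convex_cone hull {v} = convex_cone hull A" unfolding faces by auto
    have "A \<noteq> {}"
    proof
      assume "A = {}"
      then have "v \<in> convex_cone hull {}" using A hull_inc[of v "{v}"] by auto
      then show False using v0 by (simp add: convex_cone_hull_finite)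
    qed
    then obtain u where u: "u \<in> A" by blast
    then have "u \<in> convex_cone hull {v}" using A hull_inc[of u A] by simp
    then obtain c where c: "0 \<le> c" "u = c *\<^sub>R v" by (auto simp: convex_cone_hull_finite)
    obtain t where t: "t \<in> T" "u = w t" using u A by auto
    have c1: "c * v $ pivot t = 1" using c(2) t pivot_one by (metis real_scaleR_def vector_scaleR_component)
    then have cn: "c \<noteq> 0" by auto
    have "v $ pivot t \<in> \<int>" using vL by (simp add: coord_lattice_def)
    then obtain k where k: "v $ pivot t = of_int k" by (rule Ints_cases)
    have "v $ pivot t > 0" using c1 c(1) by (metis less_numeral_extra(1) order_le_less zero_less_mult_pos mult_zero_left)
    then have kpos: "k > 0" using k by simp
    have "v = (1/c) *\<^sub>R u" using c cn by simp
    moreover have "1/c = v $ pivot t" using c1 cn by (simp add: field_simps)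
    ultimately have "v = real (nat k) *\<^sub>R u" using k kpos by simp
    moreover have "u \<in> coord_lattice I" using lattice t by auto
    ultimately have "nat k = 1" using prim by blast
    then show ?thesis using \<open>v = real (nat k) *\<^sub>R u\<close> t by auto
  qed
  moreover have "w t \<in> primitive_generators (coord_lattice I) ?C" if t: "t \<in> T" for t
    unfolding primitive_generators_def
  proof (intro CollectI conjI ballI allI impI)
    show "w t \<in> coord_lattice I" using lattice t by auto
    show "w t \<noteq> 0" using pivot_one[OF t] by auto
    show "convex_cone hull {w t} \<in> cone_faces ?C" unfolding faces using t by auto
    fix u and k :: nat assume u: "u \<in> coord_lattice I" "w t = real k *\<^sub>R u"
    have "u $ pivot t \<in> \<int>" using u by (simp add: coord_lattice_def)
    then obtain j where "u $ pivot t = of_int j" by (rule Ints_cases)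
    then have "real_of_int (int k * j) = 1" using arg_cong[OF u(2), of "\<lambda>v. v $ pivot t"] pivot_one[OF t] by simp
    then have "int k * j = 1" by linarith
    then show "k = 1" by (simp add: zmult_eq_1_iff)
  qed
  ultimately show ?thesis by blast
qed

end

section \<open>Heights on the tree of a nested set\<close>

definition inner_edges :: "'a::order set \<Rightarrow> 'a option set \<Rightarrow> 'a set" where
  "inner_edges N t = {e\<in>N. Some e \<in> t \<and> upper_end N e \<in> t}"

text \<open>The heights are normalised by their construction from the edge coordinates: an edge \<open>f\<close>
  contributes its coordinate \<open>f\<^sup>+\<close> to everything below it and \<open>f\<^sup>-\<close> to everything
  on the side of the root. Thus the heights of the edges are the coordinates of a representative of
  \<open>\<phi> x\<close>.\<close>

definition edge_height :: "'a::{finite,order} set \<Rightarrow> real ^ ('a + 'a) \<Rightarrow> 'a \<Rightarrow> real" where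
  "edge_height N x g = (\<Sum>f | f \<in> N \<and> g < f. x $ Inl f) + (\<Sum>f | f \<in> N \<and> \<not> g \<le> f. x $ Inr f)"

definition vertex_height :: "'a::{finite,order} set \<Rightarrow> real ^ ('a + 'a) \<Rightarrow> 'a option \<Rightarrow> real" where
  "vertex_height N x v = (case v of None \<Rightarrow> \<Sum>f\<in>N. x $ Inr f | Some g \<Rightarrow> edge_height N x g + x $ Inl g)"

lemma vertex_height_Some: "vertex_height N x (Some g) = edge_height N x g + x $ Inl g"
  by (simp add: vertex_height_def)

lemma linear_edge_height: "linear (\<lambda>x. edge_height N x g)"
  by (rule linearI) (simp_all add: edge_height_def sum.distrib sum_distrib_left algebra_simps)

lemma linear_vertex_height: "linear (\<lambda>x. vertex_height N x v)"
proof (cases v)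
  case None
  then show ?thesis by (intro linearI) (simp_all add: vertex_height_def sum.distrib sum_distrib_left)
next
  case (Some g)
  then show ?thesis
    by (intro linearI) (simp_all add: vertex_height_def linear_add[OF linear_edge_height]
      linear_scale[OF linear_edge_height] algebra_simps)
qed

lemma edge_rel_sym: "sym (edge_rel N S)"
  by (auto simp: sym_def edge_rel_def insert_commute)

lemma edge_relI: "e \<in> S \<Longrightarrow> (Some e, upper_end N e) \<in> edge_rel N S"
  by (auto simp: edge_rel_def)

lemma edge_rel_cases:
  assumes "(u, v) \<in> edge_rel N S"
  obtains e where "e \<in> S" "u = Some e" "v = upper_end N e" | e where "e \<in> S" "v = Some e" "u = upper_end N e"
  using assms by (auto simp: edge_rel_def doubleton_eq_iff)

lemma edge_leaving_set:
  assumes "(u, v) \<in> (edge_rel N S)\<^sup>*" "u \<in> A" "v \<notin> A"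
  obtains e where "e \<in> S" "(Some e \<in> A) \<noteq> (upper_end N e \<in> A)"
proof -
  have "u \<in> A \<Longrightarrow> v \<notin> A \<Longrightarrow> \<exists>e\<in>S. (Some e \<in> A) \<noteq> (upper_end N e \<in> A)"
    using assms(1)
  proof (induction rule: rtrancl_induct)
    case (step y z)
    show ?case
    proof (cases "y \<in> A")
      case True
      then show ?thesis using step.hyps(2) step.prems by (elim edge_rel_cases) auto
    qed (use step in auto)
  qed auto
  then show thesis using assms that by blast
qed

lemma tube_iff: "tube N t \<longleftrightarrow> t \<noteq> {} \<and> t \<subseteq> tree_vertices N \<and>
    (\<forall>u\<in>t. \<forall>v\<in>t. (u, v) \<in> (edge_rel N (inner_edges N t))\<^sup>*)"
  unfolding tube_def connected_subtree_def inner_edges_def by auto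

lemma edge_leaving_in_tube:
  assumes "tube N t" "u \<in> t" "u \<in> A" "v \<in> t" "v \<notin> A"
  obtains e where "e \<in> inner_edges N t" "(Some e \<in> A) \<noteq> (upper_end N e \<in> A)"
  using edge_leaving_set[of u v N "inner_edges N t" A] assms by (auto simp: tube_iff)

locale forest =
  fixes N :: "'a::{finite,bounded_lattice} set"
  assumes bot_notin: "bot \<notin> N"
    and inf_bot: "f \<in> N \<Longrightarrow> g \<in> N \<Longrightarrow> incomparable f g \<Longrightarrow> inf f g = bot"
begin

abbreviation "V \<equiv> tree_vertices N"

lemma chain_above:
  assumes "f \<in> N" "g \<in> N" "h \<le> f" "h \<le> g" "h \<noteq> bot"
  shows "f \<le> g \<or> g \<le> f"
proof (rule ccontr)
  assume "\<not> ?thesis"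
  then have "inf f g = bot" using inf_bot assms by (auto simp: incomparable_def)
  moreover have "h \<le> inf f g" using assms by simp
  ultimately show False using assms(5) by (simp add: bot_unique)
qed

lemma least_above:
  assumes "h \<noteq> bot" "f \<in> N" "h < f"
  obtains g where "g \<in> N" "h < g" "\<And>k. k \<in> N \<Longrightarrow> h < k \<Longrightarrow> g \<le> k"
proof -
  have "{k\<in>N. h < k} \<noteq> {}" using assms by auto
  then obtain g where g: "g \<in> N" "h < g" "\<And>k. k \<in> N \<Longrightarrow> h < k \<Longrightarrow> k \<le> g \<Longrightarrow> k = g"
    using finite_has_minimal[of "{k\<in>N. h < k}"] by auto
  have "g \<le> k" if "k \<in> N" "h < k" for k
    using chain_above[of g k h] g that assms(1) by (metis order_less_imp_le order_refl)
  then show thesis using that g by blast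
qed

lemma upper_end_eqI:
  assumes "e \<in> N" "g \<in> N" "e < g" "\<And>k. k \<in> N \<Longrightarrow> e < k \<Longrightarrow> g \<le> k"
  shows "upper_end N e = Some g"
proof -
  have "hasse_covers N e h \<longleftrightarrow> h = g" for h
    unfolding hasse_covers_def using assms by (metis leD order_le_less)
  then show ?thesis using assms by (auto simp: upper_end_def)
qed

lemma upper_end_cases:
  assumes "e \<in> N"
  obtains "upper_end N e = None" "\<And>g. g \<in> N \<Longrightarrow> \<not> e < g"
  | g where "upper_end N e = Some g" "g \<in> N" "e < g" "\<And>k. k \<in> N \<Longrightarrow> e < k \<Longrightarrow> g \<le> k"
proof (cases "\<exists>g\<in>N. e < g")
  case True
  moreover have "e \<noteq> bot" using assms bot_notin by auto
  ultimately obtain g where "g \<in> N" "e < g" "\<And>k. k \<in> N \<Longrightarrow> e < k \<Longrightarrow> g \<le> k"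
    using least_above by metis
  then show ?thesis using that(2) upper_end_eqI[OF assms] by blast
next
  case False
  then show ?thesis using that(1) by (auto simp: upper_end_def)
qed

lemma upper_end_in: "e \<in> N \<Longrightarrow> upper_end N e \<in> V"
  by (rule upper_end_cases[of e]) (auto simp: tree_vertices_def)

lemma upper_end_neq: "e \<in> N \<Longrightarrow> upper_end N e \<noteq> Some e"
  by (rule upper_end_cases[of e]) auto

lemma path_to_root: "v \<in> V \<Longrightarrow> (v, None) \<in> (edge_rel N N)\<^sup>*"
proof -
  have "(Some g, None) \<in> (edge_rel N N)\<^sup>*" if "g \<in> N" for g
    using that
  proof (induction "card {k\<in>N. g < k}" arbitrary: g rule: less_induct)
    case less
    have e: "(Some g, upper_end N g) \<in> edge_rel N N" using edge_relI less.prems by blast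
    show ?case
    proof (rule upper_end_cases[OF less.prems])
      assume "upper_end N g = None" then show ?thesis using e by auto
    next
      fix h assume h: "upper_end N g = Some h" "h \<in> N" "g < h"
      have "{k\<in>N. h < k} \<subset> {k\<in>N. g < k}" using h less.prems by auto
      then have "(Some h, None) \<in> (edge_rel N N)\<^sup>*" using less.hyps h by (simp add: psubset_card_mono)
      then show ?thesis using e h(1) by (auto intro: converse_rtrancl_into_rtrancl)
    qed
  qed
  then show "v \<in> V \<Longrightarrow> ?thesis" by (auto simp: tree_vertices_def)
qed

lemma path_in_tree: "u \<in> V \<Longrightarrow> v \<in> V \<Longrightarrow> (u, v) \<in> (edge_rel N N)\<^sup>*"
  using path_to_root[of u] path_to_root[of v] sym_rtrancl[OF edge_rel_sym, of N N]
  by (meson rtrancl_trans symD)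

lemma inner_edges_V: "inner_edges N V = N"
  using upper_end_in by (auto simp: inner_edges_def tree_vertices_def)

lemma tube_V: "tube N V"
  unfolding tube_iff inner_edges_V using path_in_tree by (auto simp: tree_vertices_def)

lemma constant_along_edges:
  assumes "\<And>e. e \<in> S \<Longrightarrow> h (Some e) = h (upper_end N e)" "(u, v) \<in> (edge_rel N S)\<^sup>*"
  shows "h u = h v"
  using assms(2) by induction (auto elim!: edge_rel_cases simp: assms(1))

text \<open>Every edge other than \<open>e\<close> has \<open>e\<close> and the upper end of \<open>e\<close> on the same side, so only
  the contribution of \<open>e\<close> itself makes a difference.\<close>

lemma vertex_height_upper_end:
  assumes e: "e \<in> N"
  shows "vertex_height N x (upper_end N e) = edge_height N x e + x $ Inr e"
proof (rule upper_end_cases[OF e])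
  assume u: "upper_end N e = None" "\<And>g. g \<in> N \<Longrightarrow> \<not> e < g"
  have e1: "{f \<in> N. e < f} = {}" using u by auto
  have e2: "{f \<in> N. \<not> e \<le> f} = N - {e}" using u(2) by (auto simp: order_less_le)
  show ?thesis using e unfolding vertex_height_def edge_height_def u e1 e2
    by (simp add: sum.remove[of N e])
next
  fix h assume h: "upper_end N e = Some h" "h \<in> N" "e < h" "\<And>k. k \<in> N \<Longrightarrow> e < k \<Longrightarrow> h \<le> k"
  have ekh: "e < k \<longleftrightarrow> h \<le> k" if "k \<in> N" for k using h that by auto
  have e1: "{f \<in> N. e < f} = insert h {f \<in> N. h < f}" using h(2) ekh by (auto simp: order_less_le)
  have e2: "{f \<in> N. \<not> h \<le> f} = insert e {f \<in> N. \<not> e \<le> f}" using e ekh h(3)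
    by (auto simp: order_le_less)
  show ?thesis unfolding h(1) vertex_height_Some edge_height_def e1 e2 by simp
qed

lemma tube_vec_Inl: "tube_vec N t $ Inl e = (if e \<in> entering N t then 1 else 0)"
proof -
  have "tube_vec N t $ Inl e = (\<Sum>f\<in>entering N t. if f = e then 1 else 0)"
    by (simp add: tube_vec_def plus_vec_def minus_vec_def axis_def sum_component eq_commute[of "Inl e"] cong: if_cong)
  then show ?thesis by (simp add: sum.delta)
qed

lemma tube_vec_Inr: "tube_vec N t $ Inr e = (if e \<in> leaving N t then 1 else 0)"
proof -
  have "tube_vec N t $ Inr e = (\<Sum>f\<in>leaving N t. if f = e then 1 else 0)"
    by (simp add: tube_vec_def plus_vec_def minus_vec_def axis_def sum_component eq_commute[of "Inr e"] cong: if_cong)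
  then show ?thesis by (simp add: sum.delta)
qed

text \<open>The constant by which the heights of the vector of \<open>t\<close> differ from the indicator function of
  the subtree on \<open>t\<close>; it can be computed at any vertex.\<close>

definition base_height :: "'a option set \<Rightarrow> real" where
  "base_height t = vertex_height N (tube_vec N t) None - (if None \<in> t then 1 else 0)"

text \<open>Along every edge the heights change in the same way as the indicator function of \<open>t\<close>.\<close>

lemma vertex_height_tube_vec:
  assumes "v \<in> V"
  shows "vertex_height N (tube_vec N t) v = (if v \<in> t then 1 else 0) + base_height t"
proof -
  let ?h = "\<lambda>v. vertex_height N (tube_vec N t) v - (if v \<in> t then 1 else 0)"
  have "?h v = ?h None"
  proof (rule constant_along_edges[of N ?h])
    fix e assume e: "e \<in> N"
    show "?h (Some e) = ?h (upper_end N e)"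
      unfolding vertex_height_Some vertex_height_upper_end[OF e] tube_vec_Inl tube_vec_Inr
      using e by (auto simp: entering_def leaving_def)
  qed (rule path_to_root[OF assms])
  then show ?thesis by (simp add: base_height_def)
qed

lemma edge_height_tube_vec:
  assumes e: "e \<in> N"
  shows "edge_height N (tube_vec N t) e = (if e \<in> inner_edges N t then 1 else 0) + base_height t"
  using vertex_height_tube_vec[of "Some e" t] e
  unfolding vertex_height_Some tube_vec_Inl tree_vertices_def
  by (auto simp: entering_def inner_edges_def split: if_splits)

text \<open>If the vectors agree, the indicator functions of \<open>s\<close> and \<open>t\<close> differ by a constant, and
  a nonzero constant would force one of the two sets to be empty.\<close>

lemma tube_vec_inj:
  assumes st: "tube N s" "tube N t" "s \<noteq> V" "t \<noteq> V" and eq: "tube_vec N s = tube_vec N t"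
  shows "s = t"
proof -
  define k where "k = base_height t - base_height s"
  have *: "(if v \<in> s then 1 else 0) - (if v \<in> t then 1 else 0) = k" if "v \<in> V" for v
    using vertex_height_tube_vec[OF that, of s] vertex_height_tube_vec[OF that, of t] eq
    by (simp add: k_def)
  have sub: "s \<subseteq> V" "t \<subseteq> V" "s \<noteq> {}" "t \<noteq> {}" using st by (auto simp: tube_iff)
  obtain a b where ab: "a \<in> V - s" "b \<in> V - t" using sub st(3,4) by blast
  have "k \<le> 0" using *[of a] ab by (auto split: if_splits)
  moreover have "k \<ge> 0" using *[of b] ab by (auto split: if_splits)
  ultimately have "k = 0" by simp
  then have "v \<in> s \<longleftrightarrow> v \<in> t" if "v \<in> V" for v using *[OF that] by (auto split: if_splits)
  then show ?thesis using sub by blast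
qed

end

section \<open>Coordinate cones\<close>

lemma span_axis:
  "span ((\<lambda>i. axis i 1) ` I) = {x :: real ^ 'n::finite. \<forall>i. i \<notin> I \<longrightarrow> x $ i = 0}" (is "_ = ?S")
proof (rule antisym)
  show "span ((\<lambda>i. axis i 1) ` I) \<subseteq> ?S"
    by (rule span_minimal) (auto simp: subspace_def axis_def)
  show "?S \<subseteq> span ((\<lambda>i. axis i 1) ` I)"
  proof
    fix x assume "x \<in> ?S"
    then have "x = (\<Sum>i\<in>I. x $ i *\<^sub>R axis i 1)" by (intro axis_expansion) auto
    also have "\<dots> \<in> span ((\<lambda>i. axis i 1) ` I)" by (intro span_sum span_scale span_base) auto
    finally show "x \<in> span ((\<lambda>i. axis i 1) ` I)" .
  qed
qed

lemma convex_cone_hull_sum: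
  "(\<And>i. i \<in> I \<Longrightarrow> f i \<in> convex_cone hull S) \<Longrightarrow> sum f I \<in> convex_cone hull S"
  by (induction I rule: infinite_finite_induct) (auto intro: convex_cone_hull_contains_0 convex_cone_hull_add)

lemma cone_axis:
  "convex_cone hull ((\<lambda>i. axis i 1) ` I) =
    {x :: real ^ 'n::finite. (\<forall>i. 0 \<le> x $ i) \<and> (\<forall>i. i \<notin> I \<longrightarrow> x $ i = 0)}" (is "_ = ?S")
proof (rule antisym)
  show "convex_cone hull ((\<lambda>i. axis i 1) ` I) \<subseteq> ?S"
    by (rule hull_minimal) (auto simp: convex_cone_iff axis_def)
  show "?S \<subseteq> convex_cone hull ((\<lambda>i. axis i 1) ` I)"
  proof
    fix x assume x: "x \<in> ?S"
    then have "x = (\<Sum>i\<in>I. x $ i *\<^sub>R axis i 1)" by (intro axis_expansion) auto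
    also have "\<dots> \<in> convex_cone hull ((\<lambda>i. axis i 1) ` I)"
      using x by (intro convex_cone_hull_sum convex_cone_hull_mul hull_inc) auto
    finally show "x \<in> convex_cone hull ((\<lambda>i. axis i 1) ` I)" .
  qed
qed

definition half_edges :: "'a set \<Rightarrow> ('a + 'a) set" where
  "half_edges N = Inl ` N \<union> Inr ` N"

lemma half_edges_basis: "plus_vec ` N \<union> minus_vec ` N = (\<lambda>i. axis i 1) ` half_edges N"
  by (auto simp: half_edges_def plus_vec_def minus_vec_def)

lemma double_space_iff: "x \<in> double_space N \<longleftrightarrow> (\<forall>i. i \<notin> half_edges N \<longrightarrow> x $ i = 0)"
  unfolding double_space_def half_edges_basis span_axis by simp

lemma double_cone_iff:
  "x \<in> double_cone N \<longleftrightarrow> (\<forall>i. 0 \<le> x $ i) \<and> (\<forall>i. i \<notin> half_edges N \<longrightarrow> x $ i = 0)"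
  unfolding double_cone_def half_edges_basis cone_axis by simp

lemma double_lattice_eq: "double_lattice N = coord_lattice (half_edges N)"
  by (auto simp: double_lattice_def coord_lattice_def double_space_iff)

section \<open>Laminar families\<close>

lemma laminar_least:
  assumes "finite F" "\<And>s t. s \<in> F \<Longrightarrow> t \<in> F \<Longrightarrow> s \<inter> t = {} \<or> s \<subseteq> t \<or> t \<subseteq> s"
    "X \<noteq> {}" "v \<in> F" "X \<subseteq> v"
  obtains p where "p \<in> F" "X \<subseteq> p" "\<And>s. s \<in> F \<Longrightarrow> X \<subseteq> s \<Longrightarrow> p \<subseteq> s"
proof -
  define A where "A = {s\<in>F. X \<subseteq> s}"
  have "finite A" "A \<noteq> {}" using assms(1,4,5) by (auto simp: A_def)
  from finite_has_minimal[OF this] obtain p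
    where "p \<in> A" "\<forall>s\<in>A. s \<subseteq> p \<longrightarrow> p = s" ..
  then have p: "p \<in> F" "X \<subseteq> p" "\<And>s. s \<in> F \<Longrightarrow> X \<subseteq> s \<Longrightarrow> s \<subseteq> p \<Longrightarrow> s = p"
    by (auto simp: A_def)
  have "p \<subseteq> s" if s: "s \<in> F" "X \<subseteq> s" for s
  proof -
    have "s \<inter> p \<noteq> {}" using s p assms(3) by blast
    then show ?thesis using assms(2)[OF s(1) p(1)] p(3)[OF s] by blast
  qed
  then show thesis using that p by blast
qed

text \<open>An antitone function on a laminar family is a sum of nonnegative weights of the members
  above: the weight of a set is its increment over the next larger set.\<close>

lemma laminar_weights:
  fixes \<mu> :: "'b set \<Rightarrow> real"
  assumes "finite T" "\<And>s t. s \<in> T \<Longrightarrow> t \<in> T \<Longrightarrow> s \<inter> t = {} \<or> s \<subseteq> t \<or> t \<subseteq> s"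
    "\<And>t. t \<in> T \<Longrightarrow> t \<noteq> {} \<and> t \<subset> v"
    "\<And>s t. s \<in> insert v T \<Longrightarrow> t \<in> insert v T \<Longrightarrow> s \<subseteq> t \<Longrightarrow> \<mu> t \<le> \<mu> s"
  shows "\<exists>b. (\<forall>t\<in>T. 0 \<le> b t) \<and> (\<forall>t\<in>insert v T. \<mu> t = \<mu> v + (\<Sum>s | s \<in> T \<and> t \<subseteq> s. b s))"
  using assms
proof (induction "card T" arbitrary: T)
  case 0
  then show ?case by auto
next
  case (Suc n)
  then have "T \<noteq> {}" by auto
  then obtain t where t: "t \<in> T" and tmin: "\<And>s. s \<in> T \<Longrightarrow> s \<subseteq> t \<Longrightarrow> s = t"
    using finite_has_minimal[of T] Suc.prems(1) by auto
  define T' where "T' = T - {t}"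
  have T': "T = insert t T'" "t \<notin> T'" "finite T'" using t Suc.prems(1) by (auto simp: T'_def)
  have "\<exists>b. (\<forall>t\<in>T'. 0 \<le> b t) \<and> (\<forall>t\<in>insert v T'. \<mu> t = \<mu> v + (\<Sum>s | s \<in> T' \<and> t \<subseteq> s. b s))"
  proof (rule Suc.hyps(1))
    show "n = card T'" using Suc.hyps(2) T' by simp
    show "s \<inter> r = {} \<or> s \<subseteq> r \<or> r \<subseteq> s" if "s \<in> T'" "r \<in> T'" for s r
      using Suc.prems(2)[of s r] that by (auto simp: T'_def)
    show "r \<noteq> {} \<and> r \<subset> v" if "r \<in> T'" for r using Suc.prems(3)[of r] that by (auto simp: T'_def)
    show "\<mu> r \<le> \<mu> s" if "s \<in> insert v T'" "r \<in> insert v T'" "s \<subseteq> r" for s r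
      using Suc.prems(4)[of s r] that by (auto simp: T'_def)
  qed (rule T')
  then obtain b where b: "\<And>t. t \<in> T' \<Longrightarrow> 0 \<le> b t"
    "\<And>t. t \<in> insert v T' \<Longrightarrow> \<mu> t = \<mu> v + (\<Sum>s | s \<in> T' \<and> t \<subseteq> s. b s)" by blast
  define r where "r = \<mu> t - \<mu> v - (\<Sum>s | s \<in> T' \<and> t \<subseteq> s. b s)"
  define b' where "b' = b(t := r)"
  have lam: "s \<inter> u = {} \<or> s \<subseteq> u \<or> u \<subseteq> s" if "s \<in> insert v T'" "u \<in> insert v T'" for s u
    using Suc.prems(2)[of s u] Suc.prems(3)[of s] Suc.prems(3)[of u] that by (auto simp: T'_def)
  obtain p where p: "p \<in> insert v T'" "t \<subseteq> p" "\<And>s. s \<in> insert v T' \<Longrightarrow> t \<subseteq> s \<Longrightarrow> p \<subseteq> s"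
    using laminar_least[of "insert v T'" t v] T'(3) lam Suc.prems(3)[OF t] by (metis finite_insert insertI1 psubset_imp_subset)
  have "{s. s \<in> T' \<and> t \<subseteq> s} = {s. s \<in> T' \<and> p \<subseteq> s}" using p by blast
  then have "r = \<mu> t - \<mu> p" using b(2)[OF p(1)] by (simp add: r_def)
  moreover have "\<mu> p \<le> \<mu> t" using p by (intro Suc.prems(4)) (auto simp: T' t)
  ultimately have r0: "0 \<le> r" by simp
  have "\<forall>s\<in>T. 0 \<le> b' s" using b(1) r0 by (auto simp: T' b'_def)
  moreover have "\<mu> u = \<mu> v + (\<Sum>s | s \<in> T \<and> u \<subseteq> s. b' s)" if u: "u \<in> insert v T" for u
  proof (cases "u = t")
    case True
    have "{s. s \<in> T \<and> t \<subseteq> s} = insert t {s. s \<in> T' \<and> t \<subseteq> s}" using T' by auto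
    then have "(\<Sum>s | s \<in> T \<and> t \<subseteq> s. b' s) = r + (\<Sum>s | s \<in> T' \<and> t \<subseteq> s. b' s)"
      using T' by (simp add: b'_def)
    also have "(\<Sum>s | s \<in> T' \<and> t \<subseteq> s. b' s) = (\<Sum>s | s \<in> T' \<and> t \<subseteq> s. b s)"
      using T' by (intro sum.cong) (auto simp: b'_def)
    finally show ?thesis using True by (simp add: r_def)
  next
    case False
    then have u': "u \<in> insert v T'" using u T' by auto
    have "\<not> u \<subseteq> t" using False u tmin Suc.prems(3)[OF t] by blast
    then have "{s. s \<in> T \<and> u \<subseteq> s} = {s. s \<in> T' \<and> u \<subseteq> s}" using T' by auto
    then have "(\<Sum>s | s \<in> T \<and> u \<subseteq> s. b' s) = (\<Sum>s | s \<in> T' \<and> u \<subseteq> s. b s)"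
      using T' by (intro sum.cong) (auto simp: b'_def)
    then show ?thesis using b(2)[OF u'] by simp
  qed
  ultimately show ?case by blast
qed

section \<open>The cone of a tubing\<close>

definition argmin_on :: "('b \<Rightarrow> real) \<Rightarrow> 'b set \<Rightarrow> 'b set" where
  "argmin_on f S = {g\<in>S. \<forall>h\<in>S. f g \<le> f h}"

text \<open>The points whose vanishing coordinates and minimal edges include those of \<open>x\<close>. For
  \<open>x\<close> in the cone of \<open>N\<close> this is the smallest cone of the lightcone subdivision that contains \<open>x\<close>.\<close>

definition refined_cone :: "'a::{finite,bounded_lattice} set \<Rightarrow> real ^ ('a + 'a) \<Rightarrow> (real ^ ('a + 'a)) set" where
  "refined_cone N x = {z\<in>double_cone N. (\<forall>i. x $ i = 0 \<longrightarrow> z $ i = 0) \<and>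
     (\<forall>S\<in>graphical_building_set N. argmin_on (edge_height N x) S \<subseteq> argmin_on (edge_height N z) S)}"

lemma convex_cone_refined_cone: "convex_cone (refined_cone N x)"
  unfolding convex_cone_iff
proof (intro conjI ballI allI impI)
  show "0 \<in> refined_cone N x"
    using linear_0[OF linear_edge_height[of N]] by (auto simp: refined_cone_def double_cone_iff argmin_on_def)
next
  fix y z assume y: "y \<in> refined_cone N x" and z: "z \<in> refined_cone N x"
  have "argmin_on (edge_height N x) S \<subseteq> argmin_on (edge_height N (y + z)) S"
    if "S \<in> graphical_building_set N" for S
  proof
    fix g assume "g \<in> argmin_on (edge_height N x) S"
    then have "g \<in> argmin_on (edge_height N y) S" "g \<in> argmin_on (edge_height N z) S"
      using y z that unfolding refined_cone_def by blast+
    then show "g \<in> argmin_on (edge_height N (y + z)) S"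
      by (simp add: argmin_on_def linear_add[OF linear_edge_height] add_mono)
  qed
  then show "y + z \<in> refined_cone N x" using y z by (simp add: refined_cone_def double_cone_iff)
next
  fix y and c :: real assume y: "y \<in> refined_cone N x" and c: "0 \<le> c"
  have "argmin_on (edge_height N x) S \<subseteq> argmin_on (edge_height N (c *\<^sub>R y)) S"
    if "S \<in> graphical_building_set N" for S
  proof
    fix g assume "g \<in> argmin_on (edge_height N x) S"
    then have "g \<in> argmin_on (edge_height N y) S"
      using y that unfolding refined_cone_def by blast
    then show "g \<in> argmin_on (edge_height N (c *\<^sub>R y)) S"
      using c by (simp add: argmin_on_def linear_scale[OF linear_edge_height] mult_left_mono)
  qed
  then show "c *\<^sub>R y \<in> refined_cone N x" using y c by (simp add: refined_cone_def double_cone_iff)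
qed

context forest
begin

lemma tube_vec_nonneg: "0 \<le> tube_vec N t $ i"
  by (cases i) (auto simp: tube_vec_Inl tube_vec_Inr)

lemma tube_vec_int: "tube_vec N t $ i \<in> \<int>"
  by (cases i) (auto simp: tube_vec_Inl tube_vec_Inr)

lemma tube_vec_support: "i \<notin> half_edges N \<Longrightarrow> tube_vec N t $ i = 0"
  by (cases i) (auto simp: tube_vec_Inl tube_vec_Inr half_edges_def entering_def leaving_def)

lemma tube_vec_in_double_cone: "tube_vec N t \<in> double_cone N"
  using tube_vec_nonneg tube_vec_support by (simp add: double_cone_iff)

lemma comb_component: "(\<Sum>t\<in>T. a t *\<^sub>R tube_vec N t) $ i = (\<Sum>t\<in>T. a t * tube_vec N t $ i)"
  by (simp add: sum_component)

lemma comb_component_zero: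
  assumes "\<And>t. t \<in> T \<Longrightarrow> 0 < a t" "(\<Sum>t\<in>T. a t *\<^sub>R tube_vec N t) $ i = 0" "t \<in> T"
  shows "tube_vec N t $ i = 0"
proof -
  have "a t * tube_vec N t $ i = 0"
    using assms sum_nonneg_eq_0_iff[of T "\<lambda>t. a t * tube_vec N t $ i"] tube_vec_nonneg
    by (simp add: comb_component less_imp_le)
  then show ?thesis using assms(1)[OF assms(3)] by simp
qed

lemma vertex_height_comb:
  assumes "v \<in> V"
  shows "vertex_height N (\<Sum>t\<in>T. a t *\<^sub>R tube_vec N t) v =
    (\<Sum>t\<in>T. a t * base_height t) + (\<Sum>t | t \<in> T \<and> v \<in> t. a t)"
proof -
  have "vertex_height N (\<Sum>t\<in>T. a t *\<^sub>R tube_vec N t) v =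
      (\<Sum>t\<in>T. a t * base_height t + (if v \<in> t then a t else 0))"
    by (auto simp: linear_sum[OF linear_vertex_height] linear_scale[OF linear_vertex_height]
      vertex_height_tube_vec[OF assms] algebra_simps intro!: sum.cong)
  then show ?thesis by (simp add: sum.distrib sum.inter_filter)
qed

lemma edge_height_comb:
  assumes "e \<in> N"
  shows "edge_height N (\<Sum>t\<in>T. a t *\<^sub>R tube_vec N t) e =
    (\<Sum>t\<in>T. a t * base_height t) + (\<Sum>t | t \<in> T \<and> e \<in> inner_edges N t. a t)"
proof -
  have "edge_height N (\<Sum>t\<in>T. a t *\<^sub>R tube_vec N t) e =
      (\<Sum>t\<in>T. a t * base_height t + (if e \<in> inner_edges N t then a t else 0))"
    by (auto simp: linear_sum[OF linear_edge_height] linear_scale[OF linear_edge_height]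
      edge_height_tube_vec[OF assms] algebra_simps intro!: sum.cong)
  then show ?thesis by (simp add: sum.distrib sum.inter_filter)
qed

lemma component_Inl: "x $ Inl e = vertex_height N x (Some e) - edge_height N x e"
  by (simp add: vertex_height_Some)

lemma component_Inr: "e \<in> N \<Longrightarrow> x $ Inr e = vertex_height N x (upper_end N e) - edge_height N x e"
  by (simp add: vertex_height_upper_end)

lemma inner_edges_in_building_set:
  assumes "tube N t" "inner_edges N t \<noteq> {}"
  shows "inner_edges N t \<in> graphical_building_set N"
  using assms unfolding graphical_building_set_def tube_def inner_edges_def by auto

lemma tube_edge_at_vertex:
  assumes t: "tube N t" "v \<in> t" "t \<noteq> {v}"
  obtains f where "f \<in> inner_edges N t" "v = Some f \<or> v = upper_end N f"
proof -
  obtain u where "u \<in> t" "u \<noteq> v" using t by blast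
  then show thesis using edge_leaving_in_tube[OF t(1,2), of "{v}" u] that by auto
qed

text \<open>A building set member that has an edge inside \<open>t\<close> and another one outside contains an
  edge crossing \<open>t\<close>, which at \<open>x\<close> lies strictly lower than any edge inside \<open>t\<close>. Hence
  the minimum over the member is not attained inside \<open>t\<close>.\<close>

lemma tube_vec_in_refined_cone:
  assumes T: "tubing N T" and a: "\<And>t. t \<in> T \<Longrightarrow> 0 < a t"
    and x: "x = (\<Sum>t\<in>T. a t *\<^sub>R tube_vec N t)" and t: "t \<in> T"
  shows "tube_vec N t \<in> refined_cone N x"
  unfolding refined_cone_def
proof (intro CollectI conjI allI impI ballI)
  show "tube_vec N t \<in> double_cone N" by (rule tube_vec_in_double_cone)
  show "tube_vec N t $ i = 0" if "x $ i = 0" for i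
    using comb_component_zero[of T a i t] a that x t by auto
  fix S assume S: "S \<in> graphical_building_set N"
  show "argmin_on (edge_height N x) S \<subseteq> argmin_on (edge_height N (tube_vec N t)) S"
  proof
    fix g assume g: "g \<in> argmin_on (edge_height N x) S"
    have SN: "S \<subseteq> N" and gS: "g \<in> S" using S g by (auto simp: graphical_building_set_def argmin_on_def)
    have "h \<in> inner_edges N t" if gt: "g \<in> inner_edges N t" and h: "h \<in> S" for h
    proof (rule ccontr)
      assume hn: "h \<notin> inner_edges N t"
      obtain W where W: "connected_subtree N W S" using S by (auto simp: graphical_building_set_def)
      obtain v where v: "v \<in> W" "v \<notin> t" using hn h W SN
        by (auto simp: connected_subtree_def inner_edges_def)
      have "Some g \<in> W" "Some g \<in> t" using W gS gt by (auto simp: connected_subtree_def inner_edges_def)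
      then obtain e where e: "e \<in> S" "(Some e \<in> t) \<noteq> (upper_end N e \<in> t)"
        using edge_leaving_set[of "Some g" v N S t] W v by (auto simp: connected_subtree_def)
      have "{s. s \<in> T \<and> e \<in> inner_edges N s} \<subset> {s. s \<in> T \<and> g \<in> inner_edges N s}"
      proof
        show "{s. s \<in> T \<and> e \<in> inner_edges N s} \<subseteq> {s. s \<in> T \<and> g \<in> inner_edges N s}"
        proof clarify
          fix s assume s: "s \<in> T" "e \<in> inner_edges N s"
          then have "s \<inter> t \<noteq> {}" "\<not> s \<subseteq> t" using e by (auto simp: inner_edges_def)
          then have "t \<subseteq> s" using T s t unfolding tubing_def by metis
          then show "g \<in> inner_edges N s" using gt by (auto simp: inner_edges_def)
        qed
        have "t \<in> {s. s \<in> T \<and> g \<in> inner_edges N s}" "t \<notin> {s. s \<in> T \<and> e \<in> inner_edges N s}"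
          using t gt e by (auto simp: inner_edges_def)
        then show "{s. s \<in> T \<and> e \<in> inner_edges N s} \<noteq> {s. s \<in> T \<and> g \<in> inner_edges N s}" by blast
      qed
      then have "(\<Sum>s | s \<in> T \<and> e \<in> inner_edges N s. a s) < (\<Sum>s | s \<in> T \<and> g \<in> inner_edges N s. a s)"
      proof -
        assume sub: "{s. s \<in> T \<and> e \<in> inner_edges N s} \<subset> {s. s \<in> T \<and> g \<in> inner_edges N s}"
        then obtain r where r: "r \<in> {s. s \<in> T \<and> g \<in> inner_edges N s} - {s. s \<in> T \<and> e \<in> inner_edges N s}" by blast
        show ?thesis using sub r a by (intro sum_strict_mono2[of _ _ r]) (auto intro: less_imp_le)
      qed
      then have "edge_height N x e < edge_height N x g"
        unfolding x edge_height_comb[OF subsetD[OF SN e(1)]] edge_height_comb[OF subsetD[OF SN gS]] by simp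
      then show False using g e(1) by (auto simp: argmin_on_def)
    qed
    then show "g \<in> argmin_on (edge_height N (tube_vec N t)) S"
      using gS SN by (auto simp: argmin_on_def edge_height_tube_vec subset_iff)
  qed
qed

lemma tubing_V: "tubing N T \<Longrightarrow> tubing N (insert V T)"
  using tube_V by (auto simp: tubing_def tube_iff)

text \<open>On the part of a tube outside the smaller tubes, a point of the refined cone has constant
  height, namely the minimum over the whole tube. Hence its heights depend only on the smallest
  tube around a vertex or an edge.\<close>

lemma refined_cone_subset_tubing_cone:
  assumes T: "tubing N T" "V \<notin> T" and a: "\<And>t. t \<in> T \<Longrightarrow> 0 < a t"
    and x: "x = (\<Sum>t\<in>T. a t *\<^sub>R tube_vec N t)" and z: "z \<in> refined_cone N x"
  shows "z \<in> tubing_cone N T"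
proof -
  let ?T = "insert V T"
  have lam: "s \<inter> t = {} \<or> s \<subseteq> t \<or> t \<subseteq> s" if "s \<in> ?T" "t \<in> ?T" for s t
    using tubing_V[OF T(1)] that unfolding tubing_def by blast
  have tube: "tube N t" if "t \<in> ?T" for t using tubing_V[OF T(1)] that unfolding tubing_def by blast
  have sub: "t \<subseteq> V" "t \<noteq> {}" if "t \<in> ?T" for t using tube[OF that] by (auto simp: tube_iff)
  have inner_N: "inner_edges N t \<subseteq> N" for t by (auto simp: inner_edges_def)
  have z0: "0 \<le> z $ i" "x $ i = 0 \<Longrightarrow> z $ i = 0" for i
    using z by (auto simp: refined_cone_def double_cone_iff)
  \<comment> \<open>Vertices are included because a tube that consists of a single vertex has no inner edge.\<close>
  define \<mu> where "\<mu> t = Min (vertex_height N z ` t \<union> edge_height N z ` inner_edges N t)" for t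
  have fin: "finite (vertex_height N z ` t \<union> edge_height N z ` inner_edges N t)" for t by simp
  have \<mu>_edge: "\<mu> t = edge_height N z e"
    if t: "t \<in> ?T" and e: "e \<in> inner_edges N t"
      and least: "\<And>s. s \<in> T \<Longrightarrow> e \<in> inner_edges N s \<Longrightarrow> t \<subseteq> s" for t e
  proof -
    have le: "edge_height N x e \<le> edge_height N x f" if f: "f \<in> inner_edges N t" for f
    proof -
      have "{s. s \<in> T \<and> e \<in> inner_edges N s} \<subseteq> {s. s \<in> T \<and> f \<in> inner_edges N s}"
        using least f by (auto simp: inner_edges_def)
      then have "(\<Sum>s | s \<in> T \<and> e \<in> inner_edges N s. a s) \<le> (\<Sum>s | s \<in> T \<and> f \<in> inner_edges N s. a s)"
        using a by (intro sum_mono2) (auto intro: less_imp_le)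
      then show ?thesis
        unfolding x edge_height_comb[OF subsetD[OF inner_N e]] edge_height_comb[OF subsetD[OF inner_N f]] by simp
    qed
    have "inner_edges N t \<in> graphical_building_set N"
      using inner_edges_in_building_set[OF tube[OF t]] e by auto
    then have "argmin_on (edge_height N x) (inner_edges N t) \<subseteq> argmin_on (edge_height N z) (inner_edges N t)"
      using z by (auto simp: refined_cone_def)
    moreover have "e \<in> argmin_on (edge_height N x) (inner_edges N t)" using e le by (auto simp: argmin_on_def)
    ultimately have le': "edge_height N z e \<le> edge_height N z f" if "f \<in> inner_edges N t" for f
      using that by (auto simp: argmin_on_def)
    have "edge_height N z e \<le> vertex_height N z v" if v: "v \<in> t" for v
    proof -
      have "t \<noteq> {v}" using e upper_end_neq by (auto simp: inner_edges_def)
      then obtain f where f: "f \<in> inner_edges N t" "v = Some f \<or> v = upper_end N f"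
        using tube_edge_at_vertex[OF tube[OF t] v] by blast
      have "edge_height N z f \<le> vertex_height N z v"
        using f(2) z0(1)[of "Inl f"] z0(1)[of "Inr f"] vertex_height_upper_end[OF subsetD[OF inner_N f(1)], of z]
        by (auto simp: vertex_height_Some)
      then show ?thesis using le'[OF f(1)] by linarith
    qed
    then show ?thesis unfolding \<mu>_def using le' e by (intro Min_eqI[OF fin]) auto
  qed
  have \<mu>_vertex: "\<mu> t = vertex_height N z v"
    if t: "t \<in> ?T" and v: "v \<in> t" and least: "\<And>s. s \<in> T \<Longrightarrow> v \<in> s \<Longrightarrow> t \<subseteq> s" for t v
  proof (cases "t = {v}")
    case True
    then have "inner_edges N t = {}" using upper_end_neq by (auto simp: inner_edges_def)
    then show ?thesis by (simp add: \<mu>_def True)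
  next
    case False
    then obtain f where f: "f \<in> inner_edges N t" "v = Some f \<or> v = upper_end N f"
      using tube_edge_at_vertex[OF tube[OF t] v] by blast
    have fN: "f \<in> N" using f inner_N by blast
    have "v \<in> V" using v sub[OF t] by blast
    have fl: "t \<subseteq> s" if "s \<in> T" "f \<in> inner_edges N s" for s
      using least[OF that(1)] that(2) f(2) by (auto simp: inner_edges_def)
    have "{s. s \<in> T \<and> v \<in> s} = {s. s \<in> T \<and> f \<in> inner_edges N s}"
      using least f by (auto simp: inner_edges_def)
    then have "vertex_height N x v = edge_height N x f"
      unfolding x vertex_height_comb[OF \<open>v \<in> V\<close>] edge_height_comb[OF fN] by simp
    then have "vertex_height N z v = edge_height N z f"
      using f(2) z0(2)[of "Inl f"] z0(2)[of "Inr f"] fN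
      by (auto simp: vertex_height_Some vertex_height_upper_end)
    then show ?thesis using \<mu>_edge[OF t f(1) fl] by simp
  qed
  have "\<exists>b. (\<forall>t\<in>T. 0 \<le> b t) \<and> (\<forall>t\<in>?T. \<mu> t = \<mu> V + (\<Sum>s | s \<in> T \<and> t \<subseteq> s. b s))"
  proof (rule laminar_weights)
    show "t \<noteq> {} \<and> t \<subset> V" if "t \<in> T" for t using sub[of t] that T(2) by auto
    show "\<mu> t \<le> \<mu> s" if "s \<in> ?T" "t \<in> ?T" "s \<subseteq> t" for s t
    proof -
      have "inner_edges N s \<subseteq> inner_edges N t" using that by (auto simp: inner_edges_def)
      then show ?thesis unfolding \<mu>_def using that sub by (intro Min_antimono fin) auto
    qed
  qed (use lam in auto)
  then obtain b where b: "\<And>t. t \<in> T \<Longrightarrow> 0 \<le> b t"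
    "\<And>t. t \<in> ?T \<Longrightarrow> \<mu> t = \<mu> V + (\<Sum>s | s \<in> T \<and> t \<subseteq> s. b s)" by blast
  define y where "y = (\<Sum>t\<in>T. b t *\<^sub>R tube_vec N t)"
  define C where "C = \<mu> V - (\<Sum>t\<in>T. b t * base_height t)"
  have vy: "vertex_height N z v = vertex_height N y v + C" if v: "v \<in> V" for v
  proof -
    obtain p where p: "p \<in> ?T" "{v} \<subseteq> p" "\<And>s. s \<in> ?T \<Longrightarrow> {v} \<subseteq> s \<Longrightarrow> p \<subseteq> s"
      using laminar_least[of ?T "{v}" V] lam v by auto
    then have "{s. s \<in> T \<and> v \<in> s} = {s. s \<in> T \<and> p \<subseteq> s}" by auto
    moreover have "\<mu> p = vertex_height N z v" using p by (intro \<mu>_vertex) auto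
    ultimately show ?thesis using b(2)[OF p(1)] unfolding y_def vertex_height_comb[OF v] C_def by simp
  qed
  have ey: "edge_height N z e = edge_height N y e + C" if e: "e \<in> N" for e
  proof -
    have "{Some e, upper_end N e} \<subseteq> V" using e upper_end_in by (auto simp: tree_vertices_def)
    then obtain p where p: "p \<in> ?T" "{Some e, upper_end N e} \<subseteq> p"
        "\<And>s. s \<in> ?T \<Longrightarrow> {Some e, upper_end N e} \<subseteq> s \<Longrightarrow> p \<subseteq> s"
      using laminar_least[of ?T "{Some e, upper_end N e}" V] lam by auto
    then have "{s. s \<in> T \<and> e \<in> inner_edges N s} = {s. s \<in> T \<and> p \<subseteq> s}" using e by (auto simp: inner_edges_def)
    moreover have "\<mu> p = edge_height N z e" using p e by (intro \<mu>_edge) (auto simp: inner_edges_def)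
    ultimately show ?thesis using b(2)[OF p(1)] unfolding y_def edge_height_comb[OF e] C_def by simp
  qed
  have "z = y"
  proof (rule vec_eq_iff[THEN iffD2], rule allI)
    fix i
    show "z $ i = y $ i"
    proof (cases "i \<in> half_edges N")
      case True
      then consider e where "e \<in> N" "i = Inl e" | e where "e \<in> N" "i = Inr e" by (auto simp: half_edges_def)
      then show ?thesis
      proof cases
        case (1 e)
        then have "Some e \<in> V" by (auto simp: tree_vertices_def)
        then show ?thesis using 1 by (simp add: component_Inl vy ey)
      next
        case (2 e)
        then show ?thesis using upper_end_in by (simp add: component_Inr vy ey)
      qed
    next
      case False
      then show ?thesis using z tube_vec_support unfolding y_def comb_component
        by (simp add: refined_cone_def double_cone_iff)
    qed
  qed
  also have "y \<in> tubing_cone N T" unfolding y_def tubing_cone_def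
    using b(1) by (intro convex_cone_hull_sum convex_cone_hull_mul hull_inc) auto
  finally show ?thesis .
qed

lemma refined_cone_eq_tubing_cone:
  assumes "tubing N T" "V \<notin> T" "\<And>t. t \<in> T \<Longrightarrow> 0 < a t" "x = (\<Sum>t\<in>T. a t *\<^sub>R tube_vec N t)"
  shows "refined_cone N x = tubing_cone N T"
proof
  show "refined_cone N x \<subseteq> tubing_cone N T" using refined_cone_subset_tubing_cone[OF assms] by blast
  show "tubing_cone N T \<subseteq> refined_cone N x" unfolding tubing_cone_def
    by (rule hull_minimal) (use tube_vec_in_refined_cone[OF assms(1,3,4)] convex_cone_refined_cone in auto)
qed

end

section \<open>Every point lies inside the cone of a tubing\<close>

context forest
begin

lemma path_stays_in_V: "(u, v) \<in> (edge_rel N S)\<^sup>* \<Longrightarrow> S \<subseteq> N \<Longrightarrow> u \<in> V \<Longrightarrow> v \<in> V"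
proof (induction rule: rtrancl_induct)
  case (step y z)
  have "Some e \<in> V \<and> upper_end N e \<in> V" if "e \<in> S" for e
    using that step.prems(1) upper_end_in by (auto simp: tree_vertices_def)
  then show ?case using step.hyps(2) by (elim edge_rel_cases) auto
qed auto

text \<open>The descendants of \<open>e\<close> form a vertex set that no other edge leaves.\<close>

lemma edge_separates:
  assumes e: "e \<in> N" and Z: "Z \<subseteq> N" and p: "(Some e, upper_end N e) \<in> (edge_rel N Z)\<^sup>*"
  shows "e \<in> Z"
proof (rule ccontr)
  assume "e \<notin> Z"
  let ?D = "{Some g | g. g \<le> e}"
  have "upper_end N e \<notin> ?D" by (rule upper_end_cases[OF e]) auto
  then obtain f where f: "f \<in> Z" "(Some f \<in> ?D) \<noteq> (upper_end N f \<in> ?D)"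
    using edge_leaving_set[OF p, of ?D] by auto
  have "f \<noteq> e" "f \<in> N" using f \<open>e \<notin> Z\<close> Z by auto
  show False
  proof (rule upper_end_cases[OF \<open>f \<in> N\<close>])
    assume "upper_end N f = None" "\<And>g. g \<in> N \<Longrightarrow> \<not> f < g"
    then show False using f(2) \<open>f \<noteq> e\<close> e by (auto simp: order_le_less)
  next
    fix g assume g: "upper_end N f = Some g" "f < g" "\<And>k. k \<in> N \<Longrightarrow> f < k \<Longrightarrow> g \<le> k"
    have "f \<le> e \<longleftrightarrow> g \<le> e" using g(2,3) e \<open>f \<noteq> e\<close> by (metis order_le_less order_less_le_trans)
    then show False using f(2) g(1) by auto
  qed
qed

definition zero_edges :: "real ^ ('a + 'a) \<Rightarrow> 'a set" where
  "zero_edges x = {e\<in>N. x $ Inl e = 0 \<and> x $ Inr e = 0}"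

text \<open>Start from a vertex of maximal height and collect the vertices joined to it by edges on
  which \<open>x\<close> vanishes. Maximality makes \<open>x\<close> positive on every half-edge at which this
  component is left, so a positive multiple of the vector of the component can be split off.\<close>

lemma exists_top_tube:
  assumes x: "x \<in> double_cone N" "x \<noteq> 0"
  shows "\<exists>t. tube N t \<and> t \<noteq> V \<and> inner_edges N t \<subseteq> zero_edges x \<and>
    (\<forall>i. tube_vec N t $ i \<noteq> 0 \<longrightarrow> 0 < x $ i)"
proof -
  let ?Z = "zero_edges x"
  have ZN: "?Z \<subseteq> N" by (auto simp: zero_edges_def)
  have x0: "0 \<le> x $ i" for i using x by (simp add: double_cone_iff)
  have "V \<noteq> {}" by (auto simp: tree_vertices_def)
  define M where "M = Max (vertex_height N x ` V)"
  have "M \<in> vertex_height N x ` V" unfolding M_def using \<open>V \<noteq> {}\<close> by (intro Max_in) auto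
  then obtain v where v: "v \<in> V" "vertex_height N x v = M" by auto
  have hM: "vertex_height N x u \<le> M" if "u \<in> V" for u unfolding M_def using that by (intro Max_ge) auto
  define t where "t = {u. (v, u) \<in> (edge_rel N ?Z)\<^sup>*}"
  have tV: "t \<subseteq> V" using path_stays_in_V[OF _ ZN v(1)] by (auto simp: t_def)
  have vt: "v \<in> t" by (auto simp: t_def)
  have height: "vertex_height N x u = M" if "u \<in> t" for u
  proof -
    have "vertex_height N x v = vertex_height N x u"
    proof (rule constant_along_edges)
      show "(v, u) \<in> (edge_rel N ?Z)\<^sup>*" using that by (simp add: t_def)
      fix e assume "e \<in> ?Z"
      then show "vertex_height N x (Some e) = vertex_height N x (upper_end N e)"
        by (simp add: zero_edges_def vertex_height_Some vertex_height_upper_end)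
    qed
    then show ?thesis using v by simp
  qed
  have closed: "(Some e \<in> t) = (upper_end N e \<in> t)" if e: "e \<in> ?Z" for e
  proof -
    have "(Some e, upper_end N e) \<in> edge_rel N ?Z" "(upper_end N e, Some e) \<in> edge_rel N ?Z"
      using edge_relI[OF e] symD[OF edge_rel_sym edge_relI[OF e]] by auto
    then show ?thesis unfolding t_def by (auto intro: rtrancl_into_rtrancl)
  qed
  have conn: "(u, w) \<in> (edge_rel N ?Z)\<^sup>*" if "u \<in> t" "w \<in> t" for u w
    using that symD[OF sym_rtrancl[OF edge_rel_sym, of N ?Z], of v u] by (auto simp: t_def)
  have inner: "inner_edges N t \<subseteq> ?Z"
    using edge_separates[OF _ ZN] conn by (auto simp: inner_edges_def)
  have "(v, u) \<in> (edge_rel N (inner_edges N t))\<^sup>*" if "u \<in> t" for u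
  proof -
    have "(v, u) \<in> (edge_rel N ?Z)\<^sup>*" using that by (simp add: t_def)
    then show ?thesis
    proof (induction rule: rtrancl_induct)
      case (step y z)
      have "y \<in> t" "z \<in> t" using step.hyps by (auto simp: t_def)
      then have "(y, z) \<in> edge_rel N (inner_edges N t)"
        using step.hyps(2) ZN by (auto elim!: edge_rel_cases simp: inner_edges_def edge_rel_def insert_commute)
      then show ?case using step.IH by auto
    qed auto
  qed
  then have "(u, w) \<in> (edge_rel N (inner_edges N t))\<^sup>*" if "u \<in> t" "w \<in> t" for u w
    using that symD[OF sym_rtrancl[OF edge_rel_sym, of N "inner_edges N t"], of v u]
    by (meson rtrancl_trans)
  then have tube: "tube N t" using tV vt by (auto simp: tube_iff)
  have proper: "t \<noteq> V"
  proof
    assume "t = V"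
    then have "N \<subseteq> ?Z" using inner by (simp add: inner_edges_V)
    have "x $ i = 0" for i
    proof (cases "i \<in> half_edges N")
      case True then show ?thesis using \<open>N \<subseteq> ?Z\<close> by (auto simp: half_edges_def zero_edges_def)
    next
      case False then show ?thesis using x by (simp add: double_cone_iff)
    qed
    then show False using x(2) by (simp add: vec_eq_iff)
  qed
  have pos: "0 < x $ i" if "tube_vec N t $ i \<noteq> 0" for i
  proof (cases i)
    case (Inl e)
    then have e: "e \<in> N" "Some e \<in> t" "upper_end N e \<notin> t"
      using that by (auto simp: tube_vec_Inl entering_def split: if_splits)
    have "x $ Inr e \<le> x $ Inl e"
      using hM[OF upper_end_in[OF e(1)]] height[OF e(2)] e(1) by (simp add: vertex_height_Some vertex_height_upper_end)
    moreover have "e \<notin> ?Z" using closed e by blast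
    ultimately have "x $ Inl e \<noteq> 0" using e(1) x0[of "Inr e"] by (auto simp: zero_edges_def)
    then show ?thesis using x0[of i] Inl by simp
  next
    case (Inr e)
    then have e: "e \<in> N" "Some e \<notin> t" "upper_end N e \<in> t"
      using that by (auto simp: tube_vec_Inr leaving_def split: if_splits)
    have "Some e \<in> V" using e(1) by (simp add: tree_vertices_def)
    then have "x $ Inl e \<le> x $ Inr e"
      using hM[of "Some e"] height[OF e(3)] e(1) by (simp add: vertex_height_Some vertex_height_upper_end)
    moreover have "e \<notin> ?Z" using closed e by blast
    ultimately have "x $ Inr e \<noteq> 0" using e(1) x0[of "Inl e"] by (auto simp: zero_edges_def)
    then show ?thesis using x0[of i] Inr by simp
  qed
  show ?thesis using tube proper inner pos by blast
qed

lemma tube_vec_nonzero: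
  assumes "tube N t" "t \<noteq> V"
  obtains i where "tube_vec N t $ i = 1"
proof -
  have "t \<subset> V" "t \<noteq> {}" using assms by (auto simp: tube_iff)
  then obtain u w where "u \<in> t" "w \<in> V" "w \<notin> t" "u \<in> V" by blast
  then obtain e where "e \<in> N" "(Some e \<in> t) \<noteq> (upper_end N e \<in> t)"
    using edge_leaving_set[OF path_in_tree[of u w], of t] by blast
  then have "tube_vec N t $ Inl e = 1 \<or> tube_vec N t $ Inr e = 1"
    by (auto simp: tube_vec_Inl tube_vec_Inr entering_def leaving_def)
  then show thesis using that by blast
qed

lemma tube_vec_values: "tube_vec N t $ i \<noteq> 0 \<Longrightarrow> tube_vec N t $ i = 1"
  by (cases i) (auto simp: tube_vec_Inl tube_vec_Inr split: if_splits)

lemma not_crossing_if_zero: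
  assumes "e \<in> N" "tube_vec N t $ Inl e = 0" "tube_vec N t $ Inr e = 0"
  shows "(Some e \<in> t) = (upper_end N e \<in> t)"
  using assms by (auto simp: tube_vec_Inl tube_vec_Inr entering_def leaving_def split: if_splits)

text \<open>Subtracting the largest possible multiple of the vector of a top tube makes a further coordinate
  vanish. The tubes used for the remaining point do not cut the top tube, since the remaining
  point still vanishes on its inner edges.\<close>

lemma double_cone_decomposition:
  assumes "x \<in> double_cone N"
  shows "\<exists>T a. tubing N T \<and> V \<notin> T \<and> (\<forall>t\<in>T. 0 < a t) \<and> x = (\<Sum>t\<in>T. a t *\<^sub>R tube_vec N t)"
  using assms
proof (induction "card {i. x $ i \<noteq> 0}" arbitrary: x rule: less_induct)
  case less
  show ?case
  proof (cases "x = 0")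
    case True
    then show ?thesis by (intro exI[of _ "{}"]) (auto simp: tubing_def)
  next
    case False
    obtain t where t: "tube N t" "t \<noteq> V" "inner_edges N t \<subseteq> zero_edges x"
      "\<And>i. tube_vec N t $ i \<noteq> 0 \<Longrightarrow> 0 < x $ i"
      using exists_top_tube[OF less.prems False] by blast
    let ?w = "tube_vec N t"
    define D where "D = {i. ?w $ i \<noteq> 0}"
    obtain k where "?w $ k = 1" by (rule tube_vec_nonzero[OF t(1,2)])
    then have "k \<in> D" by (simp add: D_def)
    then have "D \<noteq> {}" by blast
    define \<epsilon> where "\<epsilon> = Min ((\<lambda>i. x $ i) ` D)"
    have "\<epsilon> \<in> (\<lambda>i. x $ i) ` D" unfolding \<epsilon>_def using \<open>D \<noteq> {}\<close> by (intro Min_in) auto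
    then obtain j where j: "j \<in> D" "x $ j = \<epsilon>" by auto
    have \<epsilon>: "0 < \<epsilon>" using t(4)[of j] j by (auto simp: D_def)
    have le: "\<epsilon> \<le> x $ i" if "i \<in> D" for i unfolding \<epsilon>_def using that by (intro Min_le) auto
    define y where "y = x - \<epsilon> *\<^sub>R ?w"
    have yi: "y $ i = (if i \<in> D then x $ i - \<epsilon> else x $ i)" for i
      using tube_vec_values[of t i] by (auto simp: y_def D_def)
    have supp: "x $ i = 0 \<Longrightarrow> y $ i = 0" for i using t(4)[of i] by (auto simp: yi D_def)
    have "y \<in> double_cone N" using less.prems le supp by (auto simp: double_cone_iff yi)
    moreover have "card {i. y $ i \<noteq> 0} < card {i. x $ i \<noteq> 0}"
    proof (rule psubset_card_mono)
      have "j \<in> {i. x $ i \<noteq> 0} - {i. y $ i \<noteq> 0}" using j \<epsilon> by (auto simp: yi)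
      then show "{i. y $ i \<noteq> 0} \<subset> {i. x $ i \<noteq> 0}" using supp by blast
    qed simp
    ultimately obtain T a where T: "tubing N T" "V \<notin> T" "\<And>t. t \<in> T \<Longrightarrow> 0 < a t"
      "y = (\<Sum>t\<in>T. a t *\<^sub>R tube_vec N t)" using less.hyps by blast
    have compat: "s \<inter> t = {} \<or> t \<subseteq> s" if s: "s \<in> T" for s
    proof (rule ccontr)
      assume "\<not> ?thesis"
      then obtain u w where "u \<in> t" "u \<in> s" "w \<in> t" "w \<notin> s" by blast
      then obtain e where e: "e \<in> inner_edges N t" "(Some e \<in> s) \<noteq> (upper_end N e \<in> s)"
        using edge_leaving_in_tube[OF t(1)] by blast
      then have "e \<in> N" "y $ Inl e = 0" "y $ Inr e = 0" using t(3) supp by (auto simp: zero_edges_def)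
      then show False
        using comb_component_zero[of T a _ s] T(3,4) s e(2) not_crossing_if_zero[of e s] by auto
    qed
    have "tubing N (insert t T)" unfolding tubing_def
    proof (intro conjI ballI)
      show "tube N s" if "s \<in> insert t T" for s using that t(1) T(1) by (auto simp: tubing_def)
      show "s \<inter> r = {} \<or> s \<subseteq> r \<or> r \<subseteq> s" if "s \<in> insert t T" "r \<in> insert t T" for s r
      proof -
        have "s \<in> T \<Longrightarrow> r \<in> T \<Longrightarrow> ?thesis" using T(1) unfolding tubing_def by blast
        then show ?thesis using that compat[of s] compat[of r] by (elim insertE) auto
      qed
    qed
    moreover have "V \<notin> insert t T" using T(2) t(2) by auto
    moreover define b where "b = (\<lambda>s. (if s \<in> T then a s else 0) + (if s = t then \<epsilon> else 0))"
    moreover have "\<forall>s\<in>insert t T. 0 < b s" using T(3) \<epsilon> by (auto simp: b_def intro: add_pos_pos)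
    moreover have "x = (\<Sum>s\<in>insert t T. b s *\<^sub>R tube_vec N s)"
    proof -
      have "(\<Sum>s\<in>insert t T. b s *\<^sub>R tube_vec N s) =
          (\<Sum>s\<in>insert t T. if s \<in> T then a s *\<^sub>R tube_vec N s else 0)
        + (\<Sum>s\<in>insert t T. if s = t then \<epsilon> *\<^sub>R tube_vec N s else 0)"
        by (subst sum.distrib[symmetric]) (auto simp: b_def scaleR_left_distrib intro!: sum.cong)
      also have "(\<Sum>s\<in>insert t T. if s \<in> T then a s *\<^sub>R tube_vec N s else 0) = y"
        unfolding T(4) by (intro sum.mono_neutral_cong_right) auto
      finally show ?thesis by (simp add: y_def)
    qed
    ultimately show ?thesis by (intro exI[of _ "insert t T"] exI[of _ b]) simp
  qed
qed

section \<open>Pivot coordinates of tubes\<close>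

text \<open>An edge that leaves \<open>t\<close> inside the next larger tube (or inside the whole tree) is an inner
  edge of every larger tube, so its half-edge at \<open>t\<close> occurs only in vectors of tubes
  contained in \<open>t\<close>.\<close>

lemma exit_pivot:
  assumes T: "tubing N T" "V \<notin> T" and t: "t \<in> T"
  obtains i where "tube_vec N t $ i = 1" "\<And>s. s \<in> T \<Longrightarrow> tube_vec N s $ i \<noteq> 0 \<Longrightarrow> s \<subseteq> t"
proof -
  have lam: "s \<inter> r = {} \<or> s \<subseteq> r \<or> r \<subseteq> s" if "s \<in> insert V T" "r \<in> insert V T" for s r
    using tubing_V[OF T(1)] that unfolding tubing_def by blast
  have tubes: "tube N s" if "s \<in> insert V T" for s using tubing_V[OF T(1)] that unfolding tubing_def by blast
  have tV: "t \<subset> V" using tubes[of t] t T(2) by (auto simp: tube_iff)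
  define A where "A = {s\<in>insert V T. t \<subset> s}"
  have "finite A" "A \<noteq> {}" using tV by (auto simp: A_def)
  from finite_has_minimal[OF this] obtain p where p: "p \<in> A" "\<forall>s\<in>A. s \<subseteq> p \<longrightarrow> p = s" ..
  have pT: "p \<in> insert V T" "t \<subset> p" using p by (auto simp: A_def)
  obtain u w where "u \<in> t" "w \<in> p" "w \<notin> t" using pT tubes[of t] t by (auto simp: tube_iff)
  then obtain e where e: "e \<in> inner_edges N p" "(Some e \<in> t) \<noteq> (upper_end N e \<in> t)"
    using edge_leaving_in_tube[OF tubes[OF pT(1)], of u t w] pT(2) by blast
  have eN: "e \<in> N" and ep: "Some e \<in> p" "upper_end N e \<in> p" using e by (auto simp: inner_edges_def)
  have key: "s \<subseteq> t" if s: "s \<in> T" and c: "c \<in> s" "c \<in> t" "d \<in> p" "d \<notin> s" for s c d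
  proof (rule ccontr)
    assume "\<not> s \<subseteq> t"
    then have "t \<subset> s" using lam[of s t] s t c by auto
    then have "s \<in> A" using s by (auto simp: A_def)
    moreover have "s \<subseteq> p" using lam[of s p] s pT c by auto
    ultimately show False using p(2) c by auto
  qed
  show thesis
  proof (cases "Some e \<in> t")
    case True
    then have up: "upper_end N e \<notin> t" using e by auto
    show thesis
    proof (rule that[of "Inl e"])
      show "tube_vec N t $ Inl e = 1" using True up eN by (simp add: tube_vec_Inl entering_def)
      fix s assume "s \<in> T" "tube_vec N s $ Inl e \<noteq> 0"
      then show "s \<subseteq> t" using key[of s "Some e" "upper_end N e"] True ep
        by (auto simp: tube_vec_Inl entering_def split: if_splits)
    qed
  next
    case False
    then have up: "upper_end N e \<in> t" using e by auto
    show thesis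
    proof (rule that[of "Inr e"])
      show "tube_vec N t $ Inr e = 1" using False up eN by (simp add: tube_vec_Inr leaving_def)
      fix s assume "s \<in> T" "tube_vec N s $ Inr e \<noteq> 0"
      then show "s \<subseteq> t" using key[of s "upper_end N e" "Some e"] up ep
        by (auto simp: tube_vec_Inr leaving_def split: if_splits)
    qed
  qed
qed

lemma tubing_unitriangular:
  assumes T: "tubing N T" "V \<notin> T" and G: "N \<subseteq> G"
  obtains pivot where "unitriangular T (tube_vec N) pivot (half_edges G)"
proof -
  have "\<forall>t\<in>T. \<exists>i. tube_vec N t $ i = 1 \<and> (\<forall>s\<in>T. tube_vec N s $ i \<noteq> 0 \<longrightarrow> s \<subseteq> t)"
    using exit_pivot[OF T] by metis
  then obtain pivot where pivot: "\<forall>t\<in>T. tube_vec N t $ pivot t = 1 \<and>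
      (\<forall>s\<in>T. tube_vec N s $ pivot t \<noteq> 0 \<longrightarrow> s \<subseteq> t)" by metis
  have "half_edges N \<subseteq> half_edges G" using G by (auto simp: half_edges_def)
  then have "tube_vec N t \<in> coord_lattice (half_edges G)" for t
    using tube_vec_int tube_vec_support by (simp add: coord_lattice_def subset_iff) blast
  then have "unitriangular T (tube_vec N) pivot (half_edges G)"
    by unfold_locales (use pivot in auto)
  then show thesis by (rule that)
qed

section \<open>Contraction of edges\<close>

lemma forest_remove: "forest (N - {e})"
  by unfold_locales (use bot_notin inf_bot in auto)

lemma upper_end_remove:
  assumes e: "e \<in> N" and f: "f \<in> N" "f \<noteq> e"
  shows "upper_end (N - {e}) f = (if upper_end N f = Some e then upper_end N e else upper_end N f)"
proof -
  interpret F: forest "N - {e}" by (rule forest_remove)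
  show ?thesis
  proof (rule upper_end_cases[OF f(1)])
    assume "upper_end N f = None" "\<And>g. g \<in> N \<Longrightarrow> \<not> f < g"
    then show ?thesis by (auto simp: upper_end_def)
  next
    fix g assume g: "upper_end N f = Some g" "g \<in> N" "f < g" "\<And>k. k \<in> N \<Longrightarrow> f < k \<Longrightarrow> g \<le> k"
    show ?thesis
    proof (cases "g = e")
      case False
      then have "upper_end (N - {e}) f = Some g" using g f by (intro F.upper_end_eqI) auto
      then show ?thesis using False g by simp
    next
      case True
      show ?thesis
      proof (rule upper_end_cases[OF e])
        assume ue: "upper_end N e = None" "\<And>h. h \<in> N \<Longrightarrow> \<not> e < h"
        have "\<not> (\<exists>h\<in>N - {e}. f < h)" using ue(2) g(4) True by (auto simp: order_le_less)
        then have "upper_end (N - {e}) f = None" unfolding upper_end_def by (rule if_not_P)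
        then show ?thesis using True g ue by simp
      next
        fix h assume h: "upper_end N e = Some h" "h \<in> N" "e < h" "\<And>k. k \<in> N \<Longrightarrow> e < k \<Longrightarrow> h \<le> k"
        have "upper_end (N - {e}) f = Some h"
          using h f g True by (intro F.upper_end_eqI) (auto simp: order_le_less)
        then show ?thesis using True g h by simp
      qed
    qed
  qed
qed

text \<open>An uncrossed edge \<open>e\<close> has both or none of its end points in every tube. Removing \<open>e\<close> from
  \<open>N\<close> identifies its lower end point with its upper one, so each tube just loses the lower end
  point, and the edges crossing it remain the same.\<close>

lemma contract_edge:
  assumes e: "e \<in> N" and T: "tubing N T" "V \<notin> T"
    and all_uncrossed: "\<forall>t\<in>T. (Some e \<in> t) = (upper_end N e \<in> t)"
  defines "T' \<equiv> (\<lambda>t. t - {Some e}) ` T"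
  shows "tubing (N - {e}) T'" "tree_vertices (N - {e}) \<notin> T'"
    "tube_vec (N - {e}) ` T' = tube_vec N ` T"
proof -
  interpret F: forest "N - {e}" by (rule forest_remove)
  let ?N = "N - {e}"
  have uncrossed: "(Some e \<in> t) = (upper_end N e \<in> t)" if "t \<in> T" for t
    using all_uncrossed that by blast
  have V': "tree_vertices ?N = V - {Some e}" by (auto simp: tree_vertices_def)
  have ue: "upper_end N e \<noteq> Some e" by (rule upper_end_neq[OF e])
  have up: "upper_end ?N f \<in> t - {Some e} \<longleftrightarrow> upper_end N f \<in> t" if "f \<in> ?N" "t \<in> T" for f t
    using upper_end_remove[OF e, of f] uncrossed[OF that(2)] that ue by auto
  have T_tube: "tube N t" if "t \<in> T" for t using T that by (auto simp: tubing_def)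
  have inner: "inner_edges ?N (t - {Some e}) = inner_edges N t - {e}" if t: "t \<in> T" for t
    using up[OF _ t] by (auto simp: inner_edges_def)
  have tube': "tube ?N (t - {Some e})" if t: "t \<in> T" for t
  proof -
    \<comment> \<open>The contraction maps paths in \<open>t\<close> to paths in its image.\<close>
    define \<pi> where "\<pi> u = (if u = Some e then upper_end N e else u)" for u
    have step: "(\<pi> u, \<pi> v) \<in> (edge_rel ?N (inner_edges N t - {e}))\<^sup>*"
      if "(u, v) \<in> edge_rel N (inner_edges N t)" for u v
    proof -
      have *: "(\<pi> (Some f), \<pi> (upper_end N f)) \<in> (edge_rel ?N (inner_edges N t - {e}))\<^sup>*"
        if f: "f \<in> inner_edges N t" for f
      proof (cases "f = e")
        case True then show ?thesis using ue by (simp add: \<pi>_def)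
      next
        case False
        have "f \<in> N" using f by (simp add: inner_edges_def)
        then have "upper_end ?N f = \<pi> (upper_end N f)" using upper_end_remove[OF e _ False] by (simp add: \<pi>_def)
        moreover have "(Some f, upper_end ?N f) \<in> edge_rel ?N (inner_edges N t - {e})"
          using f False by (intro edge_relI) auto
        ultimately show ?thesis using False by (simp add: \<pi>_def)
      qed
      have sy: "sym ((edge_rel ?N (inner_edges N t - {e}))\<^sup>*)" by (rule sym_rtrancl[OF edge_rel_sym])
      show ?thesis using that
      proof (cases rule: edge_rel_cases)
        case (1 f) then show ?thesis using * by simp
      next
        case (2 f) then show ?thesis using symD[OF sy *] by simp
      qed
    qed
    have path: "(\<pi> u, \<pi> v) \<in> (edge_rel ?N (inner_edges N t - {e}))\<^sup>*"
      if "(u, v) \<in> (edge_rel N (inner_edges N t))\<^sup>*" for u v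
      using that by induction (use step in \<open>auto intro: rtrancl_trans\<close>)
    have "(u, v) \<in> (edge_rel ?N (inner_edges ?N (t - {Some e})))\<^sup>*"
      if "u \<in> t - {Some e}" "v \<in> t - {Some e}" for u v
      using path[of u v] that T_tube[OF t] by (auto simp: inner[OF t] \<pi>_def tube_iff)
    moreover have "t - {Some e} \<noteq> {}"
      using T_tube[OF t] uncrossed[OF t] ue by (auto simp: tube_iff)
    moreover have "t - {Some e} \<subseteq> tree_vertices ?N" using T_tube[OF t] by (auto simp: V' tube_iff)
    ultimately show ?thesis by (auto simp: tube_iff)
  qed
  show "tubing ?N T'" unfolding tubing_def T'_def
  proof (intro conjI ballI)
    show "tube ?N s" if "s \<in> (\<lambda>t. t - {Some e}) ` T" for s using that tube' by auto
    show "s \<inter> r = {} \<or> s \<subseteq> r \<or> r \<subseteq> s"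
      if "s \<in> (\<lambda>t. t - {Some e}) ` T" "r \<in> (\<lambda>t. t - {Some e}) ` T" for s r
    proof -
      obtain s' r' where "s' \<in> T" "r' \<in> T" "s = s' - {Some e}" "r = r' - {Some e}" using \<open>s \<in> _\<close> \<open>r \<in> _\<close> by blast
      moreover from this have "s' \<inter> r' = {} \<or> s' \<subseteq> r' \<or> r' \<subseteq> s'" using T(1) unfolding tubing_def by blast
      ultimately show ?thesis by auto
    qed
  qed
  show "tree_vertices ?N \<notin> T'"
  proof
    assume "tree_vertices ?N \<in> T'"
    then obtain t where t: "t \<in> T" "t - {Some e} = V - {Some e}" by (auto simp: V' T'_def)
    have "upper_end N e \<in> t" using upper_end_in[OF e] ue t(2) by blast
    then have "Some e \<in> t" using uncrossed[OF t(1)] by simp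
    then have "t = V" using t(2) e by (auto simp: tree_vertices_def)
    then show False using t T by simp
  qed
  have "tube_vec ?N (t - {Some e}) = tube_vec N t" if t: "t \<in> T" for t
  proof -
    have "entering ?N (t - {Some e}) = entering N t" "leaving ?N (t - {Some e}) = leaving N t"
      using up[OF _ t] uncrossed[OF t] by (auto simp: entering_def leaving_def)
    then show ?thesis by (simp add: tube_vec_def)
  qed
  then show "tube_vec ?N ` T' = tube_vec N ` T" unfolding T'_def image_image by (intro image_cong) auto
qed

end

lemma contract_uncrossed_edges:
  assumes "forest N" "tubing N T" "tree_vertices N \<notin> T"
  obtains N' T' where "N' \<subseteq> N" "tubing N' T'" "tree_vertices N' \<notin> T'" "\<forall>e\<in>N'. crosses N' T' e"
    "tube_vec N' ` T' = tube_vec N ` T"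
proof -
  have "\<exists>N' T'. N' \<subseteq> N \<and> tubing N' T' \<and> tree_vertices N' \<notin> T' \<and> (\<forall>e\<in>N'. crosses N' T' e) \<and>
    tube_vec N' ` T' = tube_vec N ` T"
    using assms
  proof (induction "card N" arbitrary: N T rule: less_induct)
    case less
    interpret forest N by (rule less.prems)
    show ?case
    proof (cases "\<forall>e\<in>N. crosses N T e")
      case True
      then show ?thesis using less.prems by blast
    next
      case False
      then obtain e where e: "e \<in> N" "\<forall>t\<in>T. (Some e \<in> t) = (upper_end N e \<in> t)"
        by (auto simp: crosses_def)
      note c = contract_edge[OF e(1) less.prems(2,3) e(2)]
      have "card (N - {e}) < card N" using e(1) by (intro psubset_card_mono) auto
      from less.hyps[OF this forest_remove c(1,2)] obtain N' T' where
        "N' \<subseteq> N - {e}" "tubing N' T'" "tree_vertices N' \<notin> T'" "\<forall>e\<in>N'. crosses N' T' e"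
        "tube_vec N' ` T' = tube_vec N ` T" unfolding c(3) by (elim exE conjE)
      then show ?thesis by (intro exI[of _ N'] exI[of _ T']) auto
    qed
  qed
  then show thesis using that by blast
qed

section \<open>Domains of linearity of sums of minima\<close>

text \<open>The points at which every minimum over a member of \<open>B\<close> is attained wherever it is attained
  at \<open>y\<close>. For \<open>y\<close> in \<open>U\<close> this is the cone of the fan of the sum of minima that has \<open>y\<close> in its
  relative interior.\<close>

definition argmin_cone :: "(real ^ 'a::finite) set \<Rightarrow> 'a set set \<Rightarrow> real ^ 'a \<Rightarrow> (real ^ 'a) set" where
  "argmin_cone U B y = {z\<in>U. \<forall>S\<in>B. argmin_on (($) y) S \<subseteq> argmin_on (($) z) S}"

abbreviation min_sum :: "'a::finite set set \<Rightarrow> real ^ 'a \<Rightarrow> real" where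
  "min_sum B x \<equiv> (\<Sum>t\<in>B. Min ((\<lambda>g. x $ g) ` t))"

lemma Min_argmin: "g \<in> argmin_on (($) x) S \<Longrightarrow> Min ((\<lambda>g. x $ g) ` S) = x $ (g :: 'a::finite)"
  by (intro Min_eqI) (auto simp: argmin_on_def)

lemma argmin_on_nonempty:
  assumes "S \<noteq> {}" shows "argmin_on f (S :: 'a::finite set) \<noteq> {}"
proof -
  have "Min (f ` S) \<in> f ` S" using assms by (intro Min_in) auto
  then obtain g where "g \<in> S" "Min (f ` S) = f g" by auto
  moreover have "\<forall>h\<in>S. Min (f ` S) \<le> f h" by auto
  ultimately show ?thesis by (auto simp: argmin_on_def)
qed

lemma argmin_cone_self: "y \<in> U \<Longrightarrow> y \<in> argmin_cone U B y"
  by (simp add: argmin_cone_def)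

lemma linear_on_argmin_cone:
  fixes B :: "'a::finite set set"
  assumes U: "subspace U" and B: "{} \<notin> B"
  shows "linear_on_convex (min_sum B) (argmin_cone U B y)"
proof -
  have "convex (argmin_cone U B y)" unfolding convex_def
  proof (intro ballI allI impI)
    fix a b and u v :: real
    assume a: "a \<in> argmin_cone U B y" and b: "b \<in> argmin_cone U B y" and uv: "0 \<le> u" "0 \<le> v" "u + v = 1"
    have "argmin_on (($) y) S \<subseteq> argmin_on (($) (u *\<^sub>R a + v *\<^sub>R b)) S" if "S \<in> B" for S
    proof
      fix g assume "g \<in> argmin_on (($) y) S"
      then have "g \<in> argmin_on (($) a) S" "g \<in> argmin_on (($) b) S"
        using a b that unfolding argmin_cone_def by blast+
      then show "g \<in> argmin_on (($) (u *\<^sub>R a + v *\<^sub>R b)) S"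
        using uv by (simp add: argmin_on_def add_mono mult_left_mono)
    qed
    moreover have "u *\<^sub>R a + v *\<^sub>R b \<in> U"
      using a b U by (simp add: argmin_cone_def subspace_add subspace_scale)
    ultimately show "u *\<^sub>R a + v *\<^sub>R b \<in> argmin_cone U B y" by (simp add: argmin_cone_def)
  qed
  moreover define \<sigma> where "\<sigma> S = (SOME g. g \<in> argmin_on (($) y) S)" for S
  have \<sigma>: "\<sigma> S \<in> argmin_on (($) y) S" if "S \<in> B" for S
  proof -
    have "S \<noteq> {}" using that B by auto
    then show ?thesis unfolding \<sigma>_def some_in_eq by (rule argmin_on_nonempty)
  qed
  have "linear (\<lambda>z::real^'a. \<Sum>S\<in>B. z $ \<sigma> S)"
    by (rule linearI) (simp_all add: sum.distrib sum_distrib_left)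
  moreover have "min_sum B z = (\<Sum>S\<in>B. z $ \<sigma> S)" if "z \<in> argmin_cone U B y" for z
    by (intro sum.cong refl Min_argmin) (use that \<sigma> in \<open>auto simp: argmin_cone_def\<close>)
  ultimately show ?thesis unfolding linear_on_convex_def by blast
qed

text \<open>A sum of concave functions is affine on a segment only if every summand is. A point whose
  minima are attained as rarely as possible then determines which coordinates attain the minima
  on the whole convex set.\<close>

lemma linear_on_convex_subset_argmin_cone:
  fixes B :: "'a::finite set set"
  assumes B: "{} \<notin> B" and D: "D \<subseteq> U" "linear_on_convex (min_sum B) D" "D \<noteq> {}"
  obtains y where "y \<in> D" "D \<subseteq> argmin_cone U B y"
proof -
  obtain l where cD: "convex D" and l: "linear l" "\<And>x. x \<in> D \<Longrightarrow> min_sum B x = l x"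
    using D(2) by (auto simp: linear_on_convex_def)
  define A where "A y = (SIGMA S:B. argmin_on (($) y) S)" for y :: "real ^ 'a"
  obtain y where y: "y \<in> D" and ymin: "\<And>z. z \<in> D \<Longrightarrow> card (A y) \<le> card (A z)"
    using ex_has_least_nat[of "\<lambda>y. y \<in> D" _ "\<lambda>y. card (A y)"] D(3) by blast
  have "z \<in> argmin_cone U B y" if z: "z \<in> D" for z
  proof -
    define m where "m = (1/2) *\<^sub>R y + (1/2) *\<^sub>R z"
    have m: "m \<in> D" unfolding m_def using cD y z by (intro convexD) auto
    let ?M = "\<lambda>x S. Min ((\<lambda>g. x $ g) ` S)"
    have le: "(?M y S + ?M z S) / 2 \<le> ?M m S" if S: "S \<in> B" for S
    proof -
      have "S \<noteq> {}" using S B by auto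
      then obtain g where g: "g \<in> argmin_on (($) m) S" using argmin_on_nonempty by blast
      have "?M y S \<le> y $ g" "?M z S \<le> z $ g" using g by (auto simp: argmin_on_def intro!: Min_le)
      then show ?thesis unfolding Min_argmin[OF g] by (simp add: m_def)
    qed
    have "l m = (l y + l z) / 2" by (simp add: m_def linear_add[OF l(1)] linear_scale[OF l(1)])
    then have "min_sum B m = (min_sum B y + min_sum B z) / 2" using l(2) m y z by simp
    then have "(\<Sum>S\<in>B. ?M m S) = (\<Sum>S\<in>B. (?M y S + ?M z S) / 2)"
      by (simp add: sum.distrib add_divide_distrib sum_divide_distrib)
    then have eq: "?M m S = (?M y S + ?M z S) / 2" if "S \<in> B" for S
      using sum_mono_inv[of "\<lambda>S. (?M y S + ?M z S) / 2" B "?M m" S] le that by simp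
    have sub: "argmin_on (($) m) S \<subseteq> argmin_on (($) y) S \<inter> argmin_on (($) z) S" if S: "S \<in> B" for S
    proof
      fix g assume g: "g \<in> argmin_on (($) m) S"
      then have gS: "g \<in> S" by (simp add: argmin_on_def)
      have M: "?M y S \<le> y $ h" "?M z S \<le> z $ h" if "h \<in> S" for h using that by (auto intro!: Min_le)
      have "y $ g + z $ g = ?M y S + ?M z S" using eq[OF S] Min_argmin[OF g] by (simp add: m_def)
      then have "y $ g = ?M y S" "z $ g = ?M z S" using M[OF gS] by linarith+
      then show "g \<in> argmin_on (($) y) S \<inter> argmin_on (($) z) S" using M gS by (simp add: argmin_on_def)
    qed
    have "A m \<subseteq> A y" using sub by (auto simp: A_def)
    then have "A m = A y" using ymin[OF m] by (intro card_seteq) auto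
    then have "argmin_on (($) y) S \<subseteq> argmin_on (($) z) S" if "S \<in> B" for S
      using sub[OF that] that unfolding A_def by blast
    then show ?thesis using z D(1) by (auto simp: argmin_cone_def)
  qed
  then show thesis using that y by blast
qed

text \<open>The cone is cut out by the inequalities saying that the minima are attained where they are
  attained at \<open>x\<close>, and at a point \<open>y\<close> of it an inequality is tight for each further place where
  the minimum is attained.\<close>

lemma cone_faces_argmin_cone:
  fixes B :: "'a::finite set set"
  assumes U: "subspace U" and B: "{} \<notin> B" and x: "x \<in> U"
  shows "cone_faces (argmin_cone U B x) = {argmin_cone U B y | y. y \<in> argmin_cone U B x}"
proof -
  define I where "I = {(S, g, h). S \<in> B \<and> g \<in> argmin_on (($) x) S \<and> h \<in> S}"
  define d :: "'a set \<times> 'a \<times> 'a \<Rightarrow> real ^ 'a \<Rightarrow> real" where "d = (\<lambda>(S, g, h) z. z $ h - z $ g)"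
  have lin: "linear f" if "f \<in> d ` I" for f
    using that by (auto simp: d_def intro!: linearI) (simp_all add: algebra_simps)
  have eq: "argmin_cone U B x = {z\<in>U. \<forall>f\<in>d ` I. 0 \<le> f z}"
    by (auto simp: argmin_cone_def argmin_on_def d_def I_def)
  have face: "{z\<in>argmin_cone U B x. \<forall>f\<in>d ` I. f y = 0 \<longrightarrow> f z = 0} = argmin_cone U B y"
    if y: "y \<in> argmin_cone U B x" for y
  proof (intro set_eqI iffI)
    fix z assume z: "z \<in> {z\<in>argmin_cone U B x. \<forall>f\<in>d ` I. f y = 0 \<longrightarrow> f z = 0}"
    have "h \<in> argmin_on (($) z) S" if S: "S \<in> B" and h: "h \<in> argmin_on (($) y) S" for S h
    proof -
      have "S \<noteq> {}" using S B by auto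
      then obtain g where g: "g \<in> argmin_on (($) x) S" using argmin_on_nonempty by blast
      have gy: "g \<in> argmin_on (($) y) S" and gz: "g \<in> argmin_on (($) z) S"
        using y z g S by (auto simp: argmin_cone_def)
      have "y $ h = y $ g" using h gy by (auto simp: argmin_on_def intro: antisym)
      moreover have "(S, g, h) \<in> I" using S g h by (auto simp: I_def argmin_on_def)
      ultimately have "z $ h = z $ g" using z by (force simp: d_def)
      then show ?thesis using gz h by (auto simp: argmin_on_def)
    qed
    then show "z \<in> argmin_cone U B y" using z by (auto simp: argmin_cone_def)
  next
    fix z assume z: "z \<in> argmin_cone U B y"
    have "z $ h = z $ g" if S: "S \<in> B" and g: "g \<in> argmin_on (($) x) S" "h \<in> S" "y $ h = y $ g" for S g h
    proof -
      have gy: "g \<in> argmin_on (($) y) S" using y S g by (auto simp: argmin_cone_def)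
      then have "h \<in> argmin_on (($) y) S" using g by (auto simp: argmin_on_def)
      then have "h \<in> argmin_on (($) z) S" "g \<in> argmin_on (($) z) S"
        using z gy S by (auto simp: argmin_cone_def)
      then show ?thesis by (auto simp: argmin_on_def intro: antisym)
    qed
    moreover have "z \<in> argmin_cone U B x" using y z unfolding argmin_cone_def by fast
    ultimately show "z \<in> {z\<in>argmin_cone U B x. \<forall>f\<in>d ` I. f y = 0 \<longrightarrow> f z = 0}"
      by (auto simp: d_def I_def)
  qed
  have "finite (d ` I)" by simp
  then have "cone_faces (argmin_cone U B x) =
      (\<lambda>y. {z\<in>argmin_cone U B x. \<forall>f\<in>d ` I. f y = 0 \<longrightarrow> f z = 0}) ` argmin_cone U B x"
    unfolding eq by (rule cone_faces_polyhedral[OF U _ lin])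
  also have "\<dots> = argmin_cone U B ` argmin_cone U B x" using face by (rule image_cong[OF refl])
  finally show ?thesis by (simp only: setcompr_eq_image Collect_mem_eq)
qed

text \<open>A domain of linearity is the cone of one of its points by maximality. For the converse,
  take among the cones containing \<open>y\<close> one with as few minimal coordinates as possible: it is a
  domain of linearity, and the cone of \<open>y\<close> is one of its faces.\<close>

lemma faces_of_linearity_domains:
  fixes B :: "'a::finite set set"
  assumes U: "subspace U" and B: "{} \<notin> B"
  shows "(\<Union>D\<in>linearity_domains U (min_sum B). cone_faces D) = {argmin_cone U B y | y. y \<in> U}"
proof -
  have sub: "argmin_cone U B y \<subseteq> U" for y by (auto simp: argmin_cone_def)
  note lin = linear_on_argmin_cone[OF U B]
  have dom: "\<exists>x\<in>U. D = argmin_cone U B x" if D: "D \<in> linearity_domains U (min_sum B)" for D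
  proof -
    have D1: "D \<subseteq> U" "linear_on_convex (min_sum B) D"
      and max: "\<And>D'. D' \<subseteq> U \<Longrightarrow> linear_on_convex (min_sum B) D' \<Longrightarrow> D \<subseteq> D' \<Longrightarrow> D' = D"
      using D unfolding linearity_domains_def by blast+
    have "D \<noteq> {}" using max[OF sub lin, of 0] argmin_cone_self[of 0 U B] subspace_0[OF U] by auto
    then obtain x where "x \<in> D" "D \<subseteq> argmin_cone U B x"
      using linear_on_convex_subset_argmin_cone[OF B D1] by blast
    then show ?thesis using max[OF sub lin, of x] D1 by blast
  qed
  have ex: "\<exists>x\<in>U. y \<in> argmin_cone U B x \<and> argmin_cone U B x \<in> linearity_domains U (min_sum B)"
    if y: "y \<in> U" for y
  proof -
    define A where "A y = (SIGMA S:B. argmin_on (($) y) S)" for y :: "real ^ 'a"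
    let ?P = "\<lambda>x. x \<in> U \<and> y \<in> argmin_cone U B x"
    obtain x where x: "x \<in> U" "y \<in> argmin_cone U B x"
      and xmin: "\<And>z. z \<in> U \<Longrightarrow> y \<in> argmin_cone U B z \<Longrightarrow> card (A x) \<le> card (A z)"
      using ex_has_least_nat[of ?P y "\<lambda>y. card (A y)"] y argmin_cone_self[OF y] by blast
    have "D' = argmin_cone U B x"
      if D': "D' \<subseteq> U" "linear_on_convex (min_sum B) D'" "argmin_cone U B x \<subseteq> D'" for D'
    proof -
      have xD: "x \<in> D'" using D' argmin_cone_self[OF x(1)] by blast
      then obtain z where z: "z \<in> D'" "D' \<subseteq> argmin_cone U B z"
        using linear_on_convex_subset_argmin_cone[OF B D'(1,2)] by blast
      have yz: "y \<in> argmin_cone U B z" using x(2) D'(3) z by blast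
      have "A z \<subseteq> A x" using z xD by (auto simp: A_def argmin_cone_def)
      moreover have "card (A x) \<le> card (A z)" using xmin yz z D' by blast
      ultimately have "A z = A x" by (intro card_seteq) auto
      then have "argmin_on (($) z) S = argmin_on (($) x) S" if "S \<in> B" for S
        using that unfolding A_def by blast
      then have "argmin_cone U B z = argmin_cone U B x" by (simp add: argmin_cone_def)
      then show ?thesis using z D' by blast
    qed
    then have "argmin_cone U B x \<in> linearity_domains U (min_sum B)"
      using sub lin by (auto simp: linearity_domains_def)
    then show ?thesis using x by blast
  qed
  show ?thesis
  proof (intro antisym subsetI)
    fix C assume "C \<in> (\<Union>D\<in>linearity_domains U (min_sum B). cone_faces D)"
    then obtain x where x: "x \<in> U" "C \<in> cone_faces (argmin_cone U B x)" using dom by blast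
    then obtain y where "C = argmin_cone U B y" "y \<in> argmin_cone U B x"
      using cone_faces_argmin_cone[OF U B x(1)] by blast
    then show "C \<in> {argmin_cone U B y | y. y \<in> U}" using sub by blast
  next
    fix C assume "C \<in> {argmin_cone U B y | y. y \<in> U}"
    then obtain y where y: "y \<in> U" "C = argmin_cone U B y" by blast
    obtain x where x: "x \<in> U" "y \<in> argmin_cone U B x"
      "argmin_cone U B x \<in> linearity_domains U (min_sum B)" using ex[OF y(1)] by blast
    then have "C \<in> cone_faces (argmin_cone U B x)"
      unfolding cone_faces_argmin_cone[OF U B x(1)] y(2) by blast
    then show "C \<in> (\<Union>D\<in>linearity_domains U (min_sum B). cone_faces D)" using x by blast
  qed
qed

section \<open>Lightcone subdivisions\<close>

text \<open>The representative of \<open>\<phi> x\<close> in the space of the nodes, before passing to cosets.\<close>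

definition height_vec :: "'a::{finite,bounded_lattice} set \<Rightarrow> real ^ ('a + 'a) \<Rightarrow> (real, 'a) vec" where
  "height_vec N x = (\<Sum>f\<in>N.
       x $ Inl f *\<^sub>R (\<Sum>g | g \<in> N \<and> g < f. axis g 1)
     + x $ Inr f *\<^sub>R (\<Sum>g | g \<in> N \<and> (g > f \<or> inf g f = bot). axis g 1))"

lemma node_space_iff: "y \<in> node_space N \<longleftrightarrow> (\<forall>g. g \<notin> N \<longrightarrow> y $ g = 0)"
  unfolding node_space_def span_axis by simp

lemma sum_axis_component: "(\<Sum>g\<in>A. axis g 1 :: real ^ 'a::finite) $ h = (if h \<in> A then 1 else 0)"
proof -
  have "(\<Sum>g\<in>A. axis g 1 :: real ^ 'a) $ h = (\<Sum>g\<in>A. if g = h then 1 else 0)"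
    by (intro trans[OF sum_component] sum.cong) (auto simp: axis_def)
  then show ?thesis by (simp add: sum.delta)
qed

lemma building_fan_eq:
  assumes "{} \<notin> B"
  shows "building_fan N B = {total_coset N ` argmin_cone (node_space N) B y | y. y \<in> node_space N}"
proof -
  have "building_fan N B = (\<lambda>C. total_coset N ` C) `
      (\<Union>D\<in>linearity_domains (node_space N) (min_sum B). cone_faces D)"
    unfolding building_fan_def by blast
  also have "\<dots> = (\<lambda>C. total_coset N ` C) ` {argmin_cone (node_space N) B y | y. y \<in> node_space N}"
    by (subst faces_of_linearity_domains) (simp_all add: assms node_space_def)
  finally show ?thesis by blast
qed

text \<open>Adding a multiple of the total vector shifts all coordinates in \<open>N\<close> by the same amount and
  does not affect where minima are attained, so the preimage of a cone of cosets can be computed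
  on representatives.\<close>

lemma total_coset_in_image:
  assumes "\<Union>B \<subseteq> N"
  shows "total_coset N u \<in> total_coset N ` argmin_cone (node_space N) B y \<longleftrightarrow>
    u \<in> argmin_cone (node_space N) B y"
proof
  assume "total_coset N u \<in> total_coset N ` argmin_cone (node_space N) B y"
  then obtain z where z: "z \<in> argmin_cone (node_space N) B y" "total_coset N u = total_coset N z" by blast
  have "u \<in> total_coset N u" unfolding total_coset_def by (rule range_eqI[of _ _ 0]) simp
  then obtain c where u: "u = z + c *\<^sub>R total_vec N" using z(2) by (auto simp: total_coset_def)
  have shift: "u $ g = z $ g + (if g \<in> N then c else 0)" for g
    by (simp add: u total_vec_def sum_axis_component del: sum_component)
  have "argmin_on (($) u) S = argmin_on (($) z) S" if "S \<in> B" for S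
  proof -
    have "S \<subseteq> N" using assms that by blast
    then show ?thesis by (auto simp: argmin_on_def shift)
  qed
  then show "u \<in> argmin_cone (node_space N) B y" using z(1) by (auto simp: argmin_cone_def node_space_iff shift)
qed blast

context forest
begin

lemma height_vec_component: "height_vec N x $ g = (if g \<in> N then edge_height N x g else 0)"
proof -
  have "height_vec N x $ g = (\<Sum>f\<in>N. (if g \<in> N \<and> g < f then x $ Inl f else 0)
      + (if g \<in> N \<and> (g > f \<or> inf g f = bot) then x $ Inr f else 0))"
    unfolding height_vec_def by (intro trans[OF sum_component] sum.cong) (auto simp: sum_axis_component simp del: sum_component)
  also have "\<dots> = (if g \<in> N then edge_height N x g else 0)"
  proof (cases "g \<in> N")
    case True
    have "g > f \<or> inf g f = bot \<longleftrightarrow> \<not> g \<le> f" if f: "f \<in> N" for f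
    proof
      assume "g > f \<or> inf g f = bot"
      then show "\<not> g \<le> f" using bot_notin True by (auto simp: inf_absorb1)
    next
      assume "\<not> g \<le> f"
      then show "g > f \<or> inf g f = bot" using inf_bot[OF True f] by (auto simp: incomparable_def less_le_not_le)
    qed
    then have "(\<Sum>f\<in>N. (if g < f then x $ Inl f else 0) + (if g > f \<or> inf g f = bot then x $ Inr f else 0))
      = (\<Sum>f\<in>N. (if g < f then x $ Inl f else 0) + (if \<not> g \<le> f then x $ Inr f else 0))"
      by (intro sum.cong) auto
    also have "\<dots> = edge_height N x g" by (simp only: edge_height_def sum.distrib sum.inter_filter[symmetric] finite)
    finally show ?thesis using True by simp
  qed simp
  finally show ?thesis .
qed

lemma height_vec_in_node_space: "height_vec N x \<in> node_space N"
  by (simp add: node_space_iff height_vec_component)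

lemma argmin_on_height_vec: "S \<subseteq> N \<Longrightarrow> argmin_on (($) (height_vec N x)) S = argmin_on (edge_height N x) S"
  by (auto simp: argmin_on_def height_vec_component subset_iff)

text \<open>A pulled back cone consists of the points whose minimal edges include given ones, and on its
  faces further edges become minimal or coordinates vanish. Such a face is the refined cone of any
  of its points at which as few of the defining inequalities as possible are tight.\<close>

lemma lightcone_subdivision_eq:
  "lightcone_subdivision N (graphical_building_set N) = {refined_cone N x | x. x \<in> double_cone N}"
proof -
  let ?B = "graphical_building_set N"
  have B: "{} \<notin> ?B" "\<Union>?B \<subseteq> N" by (auto simp: graphical_building_set_def)
  have BN: "S \<subseteq> N" if "S \<in> ?B" for S using that B(2) by blast
  define P where "P y = {x\<in>double_cone N. \<forall>S\<in>?B. argmin_on (($) y) S \<subseteq> argmin_on (edge_height N x) S}"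
    for y :: "(real, 'a) vec"
  have PP: "{x\<in>double_space N. lightcone_map N x \<in> total_coset N ` argmin_cone (node_space N) ?B y} \<inter> double_cone N = P y" for y
  proof -
    have rep: "lightcone_map N x = total_coset N (height_vec N x)" for x
      by (simp add: lightcone_map_def height_vec_def)
    have "lightcone_map N x \<in> total_coset N ` argmin_cone (node_space N) ?B y \<longleftrightarrow>
        (\<forall>S\<in>?B. argmin_on (($) y) S \<subseteq> argmin_on (edge_height N x) S)" for x
      unfolding rep total_coset_in_image[OF B(2)] unfolding argmin_cone_def
      by (simp add: height_vec_in_node_space argmin_on_height_vec BN)
    moreover have "double_cone N \<subseteq> double_space N" by (auto simp: double_cone_iff double_space_iff)
    ultimately show ?thesis unfolding P_def by auto
  qed
  have faces: "cone_faces (P y) = {refined_cone N x | x. x \<in> P y}" for y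
  proof -
    define I where "I = {(S, g, h). S \<in> ?B \<and> g \<in> argmin_on (($) y) S \<and> h \<in> S}"
    define d :: "'a set \<times> 'a \<times> 'a \<Rightarrow> real ^ ('a + 'a) \<Rightarrow> real"
      where "d = (\<lambda>(S, g, h) z. edge_height N z h - edge_height N z g)"
    define L where "L = range (\<lambda>i z. z $ i) \<union> d ` I"
    have lin: "linear f" if "f \<in> L" for f
    proof -
      have "linear (d q)" for q by (cases q) (auto simp: d_def intro!: linear_compose_sub linear_edge_height)
      moreover have "linear (\<lambda>z. z $ i :: real)" for i :: "'a + 'a" by (rule linearI) simp_all
      ultimately show ?thesis using that by (auto simp: L_def)
    qed
    have eq: "P y = {z\<in>double_space N. \<forall>f\<in>L. 0 \<le> f z}"
    proof (rule set_eqI)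
      fix z
      have "(\<forall>f\<in>L. 0 \<le> f z) \<longleftrightarrow> (\<forall>i. 0 \<le> z $ i) \<and> (\<forall>q\<in>I. 0 \<le> d q z)"
        by (simp add: L_def ball_Un)
      also have "(\<forall>q\<in>I. 0 \<le> d q z) \<longleftrightarrow>
          (\<forall>S\<in>?B. \<forall>g\<in>argmin_on (($) y) S. \<forall>h\<in>S. edge_height N z g \<le> edge_height N z h)"
        by (fastforce simp: I_def d_def)
      also have "\<dots> \<longleftrightarrow> (\<forall>S\<in>?B. argmin_on (($) y) S \<subseteq> argmin_on (edge_height N z) S)"
        by (intro ball_cong refl) (auto simp: argmin_on_def)
      finally show "z \<in> P y \<longleftrightarrow> z \<in> {z\<in>double_space N. \<forall>f\<in>L. 0 \<le> f z}"
        by (auto simp: P_def double_cone_iff double_space_iff)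
    qed
    have face: "{z\<in>P y. \<forall>f\<in>L. f x = 0 \<longrightarrow> f z = 0} = refined_cone N x" if x: "x \<in> P y" for x
    proof (intro set_eqI iffI)
      fix z assume z: "z \<in> {z\<in>P y. \<forall>f\<in>L. f x = 0 \<longrightarrow> f z = 0}"
      have "h \<in> argmin_on (edge_height N z) S" if S: "S \<in> ?B" and h: "h \<in> argmin_on (edge_height N x) S" for S h
      proof -
        have "S \<noteq> {}" using S B(1) by auto
        then obtain g where g: "g \<in> argmin_on (($) y) S" using argmin_on_nonempty by blast
        have gx: "g \<in> argmin_on (edge_height N x) S" and gz: "g \<in> argmin_on (edge_height N z) S"
          using x z g S by (auto simp: P_def)
        have "edge_height N x h = edge_height N x g" using h gx by (auto simp: argmin_on_def intro: antisym)
        then have dx: "d (S, g, h) x = 0" by (simp add: d_def)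
        have "(S, g, h) \<in> I" using S g h by (auto simp: I_def argmin_on_def)
        then have "d (S, g, h) \<in> L" by (auto simp: L_def)
        then have "d (S, g, h) z = 0" using z dx by blast
        then have "edge_height N z h = edge_height N z g" by (simp add: d_def)
        then show ?thesis using gz h by (auto simp: argmin_on_def)
      qed
      moreover have "z $ i = 0" if "x $ i = 0" for i
      proof -
        have "\<forall>f\<in>L. f x = 0 \<longrightarrow> f z = 0" using z by simp
        moreover have "(\<lambda>z. z $ i) \<in> L" by (auto simp: L_def)
        ultimately have "x $ i = 0 \<longrightarrow> z $ i = 0" by (rule bspec)
        then show ?thesis using that by simp
      qed
      ultimately show "z \<in> refined_cone N x" using z by (auto simp: refined_cone_def P_def)
    next
      fix z assume z: "z \<in> refined_cone N x"
      have "edge_height N z h = edge_height N z g"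
        if S: "S \<in> ?B" and g: "g \<in> argmin_on (($) y) S" "h \<in> S" "edge_height N x h = edge_height N x g" for S g h
      proof -
        have gx: "g \<in> argmin_on (edge_height N x) S" using x S g by (auto simp: P_def)
        then have "h \<in> argmin_on (edge_height N x) S" using g by (auto simp: argmin_on_def)
        then have "h \<in> argmin_on (edge_height N z) S" "g \<in> argmin_on (edge_height N z) S"
          using z gx S by (auto simp: refined_cone_def)
        then show ?thesis by (auto simp: argmin_on_def intro: antisym)
      qed
      moreover have "z \<in> P y" using x z unfolding P_def refined_cone_def by fast
      ultimately show "z \<in> {z\<in>P y. \<forall>f\<in>L. f x = 0 \<longrightarrow> f z = 0}"
        using z by (auto simp: L_def d_def I_def refined_cone_def)
    qed
    have fin: "finite L" by (simp add: L_def)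
    have sub: "subspace (double_space N)" unfolding double_space_def by simp
    have "cone_faces (P y) = (\<lambda>x. {z\<in>P y. \<forall>f\<in>L. f x = 0 \<longrightarrow> f z = 0}) ` P y"
      unfolding eq by (rule cone_faces_polyhedral[OF sub fin lin])
    also have "\<dots> = refined_cone N ` P y" using face by (rule image_cong[OF refl])
    finally show ?thesis by (simp only: setcompr_eq_image Collect_mem_eq)
  qed
  have "lightcone_subdivision N ?B = (\<Union>y\<in>node_space N. cone_faces (P y))"
    unfolding lightcone_subdivision_def building_fan_eq[OF B(1)] PP[symmetric] by blast
  also have "\<dots> = (\<Union>y\<in>node_space N. {refined_cone N x | x. x \<in> P y})" by (simp only: faces)
  also have "\<dots> = {refined_cone N x | x. x \<in> double_cone N}"
  proof (intro antisym subsetI)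
    fix C assume "C \<in> {refined_cone N x | x. x \<in> double_cone N}"
    then obtain x where x: "x \<in> double_cone N" "C = refined_cone N x" by blast
    then have "x \<in> P (height_vec N x)" using BN by (auto simp: P_def argmin_on_height_vec)
    then show "C \<in> (\<Union>y\<in>node_space N. {refined_cone N x | x. x \<in> P y})"
      using x height_vec_in_node_space by blast
  qed (auto simp: P_def)
  finally show ?thesis .
qed

end

section \<open>The maximal lightcone refinement\<close>

lemma nested_complex_forest:
  assumes "nestable G" "N \<in> nested_complex G"
  shows "forest N"
proof
  have NG: "N \<subseteq> G" using assms(2) by (simp add: nested_complex_def)
  then show "bot \<notin> N" using assms(1) by (auto simp: nestable_def)
  fix f g assume fg: "f \<in> N" "g \<in> N" "incomparable f g"
  have "pairwise incomparable {f, g}" using fg(3) by (auto simp: pairwise_def incomparable_def)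
  moreover have "card {f, g} = 2" using fg(3) by (auto simp: incomparable_def card_2_iff)
  moreover have all: "\<forall>S\<subseteq>N. card S \<ge> 2 \<and> pairwise incomparable S \<longrightarrow> Sup_fin S \<notin> G"
    using assms(2) by (simp add: nested_complex_def)
  ultimately have "Sup_fin {f, g} \<notin> G" using fg(1,2) spec[OF all, of "{f, g}"] by simp
  then have "sup f g \<notin> G" by simp
  then show "inf f g = bot" using assms(1) fg NG unfolding nestable_def by blast
qed

lemma nested_complex_subset: "N \<in> nested_complex G \<Longrightarrow> N' \<subseteq> N \<Longrightarrow> N' \<in> nested_complex G"
  unfolding nested_complex_def by blast

lemma tubing_subset:
  assumes "tubing N T" "S \<subseteq> T"
  shows "tubing N S"
  unfolding tubing_def
proof (intro conjI ballI)
  fix s assume "s \<in> S"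
  then show "tube N s" using assms by (auto simp: tubing_def)
next
  fix s t assume "s \<in> S" "t \<in> S"
  then have "s \<in> T" "t \<in> T" using assms(2) by auto
  then show "s \<inter> t = {} \<or> s \<subseteq> t \<or> t \<subseteq> s" using assms(1) unfolding tubing_def by blast
qed

lemma nested_complex_imp_subset: "N \<in> nested_complex G \<Longrightarrow> N \<subseteq> G"
  by (simp add: nested_complex_def)

lemma convex_cone_double_cone: "convex_cone (double_cone N)"
  unfolding double_cone_def by (rule convex_cone_convex_cone_hull)

lemma (in forest) tubing_cone_subset_double_cone: "tubing_cone N T \<subseteq> double_cone N"
  unfolding tubing_cone_def
  by (rule hull_minimal) (use tube_vec_in_double_cone convex_cone_double_cone in auto)

lemma (in forest) refined_cone_of_pos_comb:
  assumes T: "tubing N T" "V \<notin> T" and x: "pos_comb (tube_vec N ` T) x"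
  shows "refined_cone N x = tubing_cone N T"
proof -
  obtain pivot where "unitriangular T (tube_vec N) pivot (half_edges N)"
    using tubing_unitriangular[OF T order_refl] .
  then interpret unitriangular T "tube_vec N" pivot "half_edges N" .
  obtain c where c: "\<forall>w\<in>tube_vec N ` T. 0 < c w" "x = (\<Sum>w\<in>tube_vec N ` T. c w *\<^sub>R w)"
    using x by (auto simp: pos_comb_def)
  have "x = (\<Sum>t\<in>T. c (tube_vec N t) *\<^sub>R tube_vec N t)"
    unfolding c(2) by (simp add: sum.reindex[OF inj_on_w])
  then show ?thesis using refined_cone_eq_tubing_cone[OF T, of "\<lambda>t. c (tube_vec N t)"] c(1) by auto
qed

lemma contract_to_crossing:
  assumes "nestable G" "N \<in> nested_complex G" "tubing N T" "tree_vertices N \<notin> T"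
  obtains N' T' where "(N', T') \<in> crossing_tubings G" "tube_vec N' ` T' = tube_vec N ` T"
proof -
  obtain N' T' where "N' \<subseteq> N" "tubing N' T'" "tree_vertices N' \<notin> T'" "\<forall>e\<in>N'. crosses N' T' e"
    "tube_vec N' ` T' = tube_vec N ` T"
    using contract_uncrossed_edges[OF nested_complex_forest[OF assms(1,2)] assms(3,4)] .
  then show thesis using that[of N' T'] nested_complex_subset[OF assms(2), of N']
    by (simp add: crossing_tubings_def)
qed

text \<open>Every point of the cone of a nested set is a positive combination of a tubing, and the cone of the
  subdivision belonging to the point is the cone of that tubing; contraction of the uncrossed
  edges leaves the cone unchanged.\<close>

lemma lightcone_refinement_eq:
  assumes G: "nestable G"
  shows "maximal_lightcone_refinement G = {tubing_cone N T | N T. (N, T) \<in> crossing_tubings G}"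
proof (intro antisym subsetI)
  fix C assume "C \<in> maximal_lightcone_refinement G"
  then obtain N where N: "N \<in> nested_complex G" "C \<in> lightcone_subdivision N (graphical_building_set N)"
    by (auto simp: maximal_lightcone_refinement_def)
  interpret forest N by (rule nested_complex_forest[OF G N(1)])
  obtain x where x: "x \<in> double_cone N" "C = refined_cone N x"
    using N(2) unfolding lightcone_subdivision_eq by blast
  obtain T a where T: "tubing N T" "V \<notin> T" "\<forall>t\<in>T. 0 < a t" "x = (\<Sum>t\<in>T. a t *\<^sub>R tube_vec N t)"
    using double_cone_decomposition[OF x(1)] by blast
  have C: "C = tubing_cone N T" unfolding x(2) by (rule refined_cone_eq_tubing_cone) (use T in auto)
  obtain N' T' where N': "(N', T') \<in> crossing_tubings G" "tube_vec N' ` T' = tube_vec N ` T"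
    using contract_to_crossing[OF G N(1) T(1,2)] .
  then have "C = tubing_cone N' T'" unfolding C tubing_cone_def by simp
  then show "C \<in> {tubing_cone N T | N T. (N, T) \<in> crossing_tubings G}" using N'(1) by blast
next
  fix C assume "C \<in> {tubing_cone N T | N T. (N, T) \<in> crossing_tubings G}"
  then obtain N T where C: "C = tubing_cone N T" "N \<in> nested_complex G" "tubing N T" "tree_vertices N \<notin> T"
    by (auto simp: crossing_tubings_def)
  interpret forest N by (rule nested_complex_forest[OF G C(2)])
  define x where "x = (\<Sum>t\<in>T. 1 *\<^sub>R tube_vec N t)"
  have "x \<in> tubing_cone N T" unfolding x_def tubing_cone_def
    by (intro convex_cone_hull_sum convex_cone_hull_mul hull_inc) auto
  then have "x \<in> double_cone N" using tubing_cone_subset_double_cone by blast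
  moreover have "C = refined_cone N x" unfolding C(1)
    by (rule refined_cone_eq_tubing_cone[symmetric, OF C(3,4) _ x_def]) simp
  ultimately show "C \<in> maximal_lightcone_refinement G"
    using C(2) unfolding maximal_lightcone_refinement_def
    by (intro UN_I[of N]) (auto simp: lightcone_subdivision_eq)
qed

lemma crossing_tubingsD:
  assumes "nestable G" "(N, T) \<in> crossing_tubings G"
  shows "forest N" "N \<in> nested_complex G" "N \<subseteq> G" "tubing N T" "tree_vertices N \<notin> T"
    "\<forall>e\<in>N. crosses N T e"
proof -
  show N: "N \<in> nested_complex G" and "tubing N T" "tree_vertices N \<notin> T" "\<forall>e\<in>N. crosses N T e"
    using assms(2) by (auto simp: crossing_tubings_def)
  show "forest N" by (rule nested_complex_forest[OF assms(1) N])
  show "N \<subseteq> G" by (rule nested_complex_imp_subset[OF N])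
qed

lemma crossing_unitriangular:
  assumes "nestable G" "(N, T) \<in> crossing_tubings G"
  obtains pivot where "unitriangular T (tube_vec N) pivot (half_edges G)"
proof -
  note * = crossing_tubingsD[OF assms]
  show thesis using forest.tubing_unitriangular[OF *(1,4,5,3)] that by blast
qed

lemma primitive_generators_tubing_cone:
  assumes "nestable G" "(N, T) \<in> crossing_tubings G"
  shows "primitive_generators (double_lattice G) (tubing_cone N T) = tube_vec N ` T"
proof -
  obtain pivot where "unitriangular T (tube_vec N) pivot (half_edges G)"
    using crossing_unitriangular[OF assms] .
  then show ?thesis unfolding double_lattice_eq tubing_cone_def
    by (rule unitriangular.primitive_generators_cone)
qed

lemma crossing_edges_eq:
  assumes "nestable G" "(N, T) \<in> crossing_tubings G"
  shows "N = {e. (\<exists>w\<in>tube_vec N ` T. w $ Inl e \<noteq> 0) \<or> (\<exists>w\<in>tube_vec N ` T. w $ Inr e \<noteq> 0)}"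
proof -
  note * = crossing_tubingsD[OF assms]
  interpret forest N by (rule *)
  show ?thesis
  proof (intro set_eqI iffI)
    fix e assume e: "e \<in> N"
    then obtain t where "t \<in> T" "(Some e \<in> t) \<noteq> (upper_end N e \<in> t)"
      using *(6) by (auto simp: crosses_def)
    then show "e \<in> {e. (\<exists>w\<in>tube_vec N ` T. w $ Inl e \<noteq> 0) \<or> (\<exists>w\<in>tube_vec N ` T. w $ Inr e \<noteq> 0)}"
      using not_crossing_if_zero[OF e, of t] by blast
  next
    fix e assume "e \<in> {e. (\<exists>w\<in>tube_vec N ` T. w $ Inl e \<noteq> 0) \<or> (\<exists>w\<in>tube_vec N ` T. w $ Inr e \<noteq> 0)}"
    then obtain t where "tube_vec N t $ Inl e \<noteq> 0 \<or> tube_vec N t $ Inr e \<noteq> 0" by blast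
    then show "e \<in> N" by (auto simp: tube_vec_Inl tube_vec_Inr entering_def leaving_def split: if_splits)
  qed
qed

text \<open>The primitive generators can be recovered from the cone, the nested set from the
  coordinates occurring in them, and the tubes from their vectors.\<close>

lemma crossing_tubing_unique:
  assumes G: "nestable G" and NT: "(N1, T1) \<in> crossing_tubings G" "(N2, T2) \<in> crossing_tubings G"
    and eq: "tubing_cone N1 T1 = tubing_cone N2 T2"
  shows "N1 = N2 \<and> T1 = T2"
proof -
  have W: "tube_vec N1 ` T1 = tube_vec N2 ` T2"
    using primitive_generators_tubing_cone[OF G NT(1)] primitive_generators_tubing_cone[OF G NT(2)] eq by simp
  then have N: "N1 = N2" using crossing_edges_eq[OF G NT(1)] crossing_edges_eq[OF G NT(2)] by simp
  note 1 = crossing_tubingsD[OF G NT(1)] and 2 = crossing_tubingsD[OF G NT(2)]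
  interpret forest N1 by (rule 1)
  have "inj_on (tube_vec N1) (T1 \<union> T2)"
    using 1 2 N by (intro inj_onI tube_vec_inj) (auto simp: tubing_def)
  then have "T1 = T2" using W N inj_on_image_eq_iff[of "tube_vec N1" "T1 \<union> T2" T1 T2] by auto
  then show ?thesis using N by simp
qed

lemma pos_comb_support:
  fixes x :: "real ^ 'n::finite"
  assumes "finite W" "\<And>w. w \<in> W \<Longrightarrow> 0 \<le> w $ i" "pos_comb W x"
  shows "x $ i \<noteq> 0 \<longleftrightarrow> (\<exists>w\<in>W. w $ i \<noteq> 0)"
proof -
  obtain c where c: "\<forall>w\<in>W. 0 < c w" "x = (\<Sum>w\<in>W. c w *\<^sub>R w)" using assms(3) by (auto simp: pos_comb_def)
  have "x $ i = (\<Sum>w\<in>W. c w * w $ i)" unfolding c(2) by simp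
  moreover have "(\<Sum>w\<in>W. c w * w $ i) = 0 \<longleftrightarrow> (\<forall>w\<in>W. c w * w $ i = 0)"
    using assms c(1) by (intro sum_nonneg_eq_0_iff) (auto simp: less_imp_le)
  ultimately show ?thesis using c(1) by force
qed

text \<open>A point determines the nested set whose edges carry one of its nonzero coordinates, and
  within that nested set the cone containing it in its relative interior.\<close>

lemma crossing_generators_unique:
  assumes G: "nestable G" and NT: "(N1, T1) \<in> crossing_tubings G" "(N2, T2) \<in> crossing_tubings G"
    and x: "pos_comb (tube_vec N1 ` T1) x" "pos_comb (tube_vec N2 ` T2) x"
  shows "tube_vec N1 ` T1 = tube_vec N2 ` T2"
proof -
  note 1 = crossing_tubingsD[OF G NT(1)] and 2 = crossing_tubingsD[OF G NT(2)]
  interpret F1: forest N1 by (rule 1)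
  interpret F2: forest N2 by (rule 2)
  have supp: "(\<exists>w\<in>tube_vec N1 ` T1. w $ i \<noteq> 0) \<longleftrightarrow> (\<exists>w\<in>tube_vec N2 ` T2. w $ i \<noteq> 0)" for i
  proof -
    have "x $ i \<noteq> 0 \<longleftrightarrow> (\<exists>w\<in>tube_vec N1 ` T1. w $ i \<noteq> 0)"
      by (rule pos_comb_support[OF _ _ x(1)]) (use F1.tube_vec_nonneg in auto)
    moreover have "x $ i \<noteq> 0 \<longleftrightarrow> (\<exists>w\<in>tube_vec N2 ` T2. w $ i \<noteq> 0)"
      by (rule pos_comb_support[OF _ _ x(2)]) (use F2.tube_vec_nonneg in auto)
    ultimately show ?thesis by simp
  qed
  have N: "N1 = N2"
    using crossing_edges_eq[OF G NT(1)] crossing_edges_eq[OF G NT(2)] unfolding supp by (rule trans[OF _ sym])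
  have "tubing_cone N1 T1 = refined_cone N1 x" using F1.refined_cone_of_pos_comb[OF 1(4,5) x(1)] by simp
  also have "\<dots> = tubing_cone N2 T2" using F2.refined_cone_of_pos_comb[OF 2(4,5) x(2)] N by simp
  finally show ?thesis
    using primitive_generators_tubing_cone[OF G NT(1)] primitive_generators_tubing_cone[OF G NT(2)] by simp
qed

text \<open>A common point is a positive combination of generators on either side. Both sets of
  generators come from crossing tubings after contraction, so they coincide.\<close>

lemma tubing_cone_Int:
  assumes G: "nestable G" and NT: "(N1, T1) \<in> crossing_tubings G" "(N2, T2) \<in> crossing_tubings G"
  shows "tubing_cone N1 T1 \<inter> tubing_cone N2 T2 = convex_cone hull (tube_vec N1 ` T1 \<inter> tube_vec N2 ` T2)"
proof (intro antisym subsetI)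
  fix x assume x: "x \<in> tubing_cone N1 T1 \<inter> tubing_cone N2 T2"
  have ex: "\<exists>N' T'. (N', T') \<in> crossing_tubings G \<and> tube_vec N' ` T' \<subseteq> tube_vec N ` T \<and> pos_comb (tube_vec N' ` T') x"
    if NT: "(N, T) \<in> crossing_tubings G" and x: "x \<in> tubing_cone N T" for N T
  proof -
    note * = crossing_tubingsD[OF G NT]
    obtain A where A: "A \<subseteq> tube_vec N ` T" "pos_comb A x"
      using in_cone_imp_pos_comb[of "tube_vec N ` T" x] x unfolding tubing_cone_def by auto
    obtain S where S: "S \<subseteq> T" "A = tube_vec N ` S" using A(1) by (rule subset_imageE)
    have "tubing N S" "tree_vertices N \<notin> S" using tubing_subset[OF *(4) S(1)] *(5) S(1) by auto
    then obtain N' T' where "(N', T') \<in> crossing_tubings G" "tube_vec N' ` T' = tube_vec N ` S"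
      using contract_to_crossing[OF G *(2)] by blast
    then show ?thesis using A S by (intro exI[of _ N'] exI[of _ T']) auto
  qed
  obtain N1' T1' where 1: "(N1', T1') \<in> crossing_tubings G" "tube_vec N1' ` T1' \<subseteq> tube_vec N1 ` T1"
    "pos_comb (tube_vec N1' ` T1') x" using ex[OF NT(1)] x by blast
  obtain N2' T2' where 2: "(N2', T2') \<in> crossing_tubings G" "tube_vec N2' ` T2' \<subseteq> tube_vec N2 ` T2"
    "pos_comb (tube_vec N2' ` T2') x" using ex[OF NT(2)] x by blast
  have "tube_vec N1' ` T1' \<subseteq> tube_vec N1 ` T1 \<inter> tube_vec N2 ` T2"
    using crossing_generators_unique[OF G 1(1) 2(1) 1(3) 2(3)] 1(2) 2(2) by simp
  then have "convex_cone hull (tube_vec N1' ` T1') \<subseteq> convex_cone hull (tube_vec N1 ` T1 \<inter> tube_vec N2 ` T2)"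
    by (rule hull_mono)
  moreover have "x \<in> convex_cone hull (tube_vec N1' ` T1')" using 1(3) by (intro pos_comb_in_cone) auto
  ultimately show "x \<in> convex_cone hull (tube_vec N1 ` T1 \<inter> tube_vec N2 ` T2)" by blast
next
  fix x assume "x \<in> convex_cone hull (tube_vec N1 ` T1 \<inter> tube_vec N2 ` T2)"
  then show "x \<in> tubing_cone N1 T1 \<inter> tubing_cone N2 T2" unfolding tubing_cone_def
    using hull_mono[of "tube_vec N1 ` T1 \<inter> tube_vec N2 ` T2"] by blast
qed

lemma unimodular_lightcone_refinement:
  assumes G: "nestable G"
  shows "unimodular_simplicial_fan (double_lattice G) (maximal_lightcone_refinement G)"
proof -
  let ?\<Lambda> = "double_lattice G"
  define \<Sigma> where "\<Sigma> = {tubing_cone N T | N T. (N, T) \<in> crossing_tubings G}"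
  have indep: "independent (tube_vec N ` T)" if "(N, T) \<in> crossing_tubings G" for N T
    using crossing_unitriangular[OF G that] unitriangular.independent_w by blast
  have faces: "cone_faces (tubing_cone N T) = {convex_cone hull A | A. A \<subseteq> tube_vec N ` T}"
    if "(N, T) \<in> crossing_tubings G" for N T
    unfolding tubing_cone_def using indep[OF that] by (intro cone_faces_simplicial) auto
  have gen: "tube_vec N ` T \<subseteq> ?\<Lambda>" if NT: "(N, T) \<in> crossing_tubings G" for N T
  proof -
    obtain pivot where "unitriangular T (tube_vec N) pivot (half_edges G)"
      using crossing_unitriangular[OF G NT] .
    then show ?thesis using unitriangular.lattice unfolding double_lattice_eq by blast
  qed
  have "finite \<Sigma>"
  proof -
    have "\<Sigma> = (\<lambda>(N, T). tubing_cone N T) ` crossing_tubings G" by (auto simp: \<Sigma>_def)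
    then show ?thesis by simp
  qed
  moreover have "\<exists>S. finite S \<and> S \<subseteq> ?\<Lambda> \<and> \<sigma> = convex_cone hull S" "\<sigma> \<inter> uminus ` \<sigma> = {0}" if \<sigma>: "\<sigma> \<in> \<Sigma>" for \<sigma>
  proof -
    obtain N T where NT: "(N, T) \<in> crossing_tubings G" "\<sigma> = tubing_cone N T" using \<sigma> unfolding \<Sigma>_def by blast
    then show "\<exists>S. finite S \<and> S \<subseteq> ?\<Lambda> \<and> \<sigma> = convex_cone hull S"
      using gen by (intro exI[of _ "tube_vec N ` T"]) (auto simp: tubing_cone_def)
    interpret forest N by (rule crossing_tubingsD[OF G NT(1)])
    have "x = 0" if "x \<in> \<sigma>" "- x \<in> \<sigma>" for x
    proof -
      have "x \<in> double_cone N" "- x \<in> double_cone N" using that tubing_cone_subset_double_cone NT(2) by auto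
      then show ?thesis by (auto simp: double_cone_iff vec_eq_iff intro: antisym)
    qed
    moreover have "0 \<in> \<sigma>" unfolding NT(2) tubing_cone_def by (rule convex_cone_hull_contains_0)
    ultimately show "\<sigma> \<inter> uminus ` \<sigma> = {0}" by force
  qed
  moreover have "cone_faces \<sigma> \<subseteq> \<Sigma>" if \<sigma>: "\<sigma> \<in> \<Sigma>" for \<sigma>
  proof
    obtain N T where NT: "(N, T) \<in> crossing_tubings G" "\<sigma> = tubing_cone N T" using \<sigma> unfolding \<Sigma>_def by blast
    note * = crossing_tubingsD[OF G NT(1)]
    fix F assume "F \<in> cone_faces \<sigma>"
    then obtain A where A: "A \<subseteq> tube_vec N ` T" "F = convex_cone hull A" using faces[OF NT(1)] NT(2) by auto
    obtain S where S: "S \<subseteq> T" "A = tube_vec N ` S" using A(1) by (rule subset_imageE)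
    have "tubing N S" "tree_vertices N \<notin> S" using tubing_subset[OF *(4) S(1)] *(5) S(1) by auto
    then obtain N' T' where "(N', T') \<in> crossing_tubings G" "tube_vec N' ` T' = tube_vec N ` S"
      using contract_to_crossing[OF G *(2)] by blast
    moreover from this have "F = tubing_cone N' T'" using A S by (simp add: tubing_cone_def)
    ultimately show "F \<in> \<Sigma>" unfolding \<Sigma>_def by blast
  qed
  moreover have "\<sigma> \<inter> \<tau> \<in> cone_faces \<sigma> \<and> \<sigma> \<inter> \<tau> \<in> cone_faces \<tau>" if "\<sigma> \<in> \<Sigma>" "\<tau> \<in> \<Sigma>" for \<sigma> \<tau>
  proof -
    obtain N1 T1 N2 T2 where NT: "(N1, T1) \<in> crossing_tubings G" "\<sigma> = tubing_cone N1 T1"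
      "(N2, T2) \<in> crossing_tubings G" "\<tau> = tubing_cone N2 T2"
      using \<open>\<sigma> \<in> \<Sigma>\<close> \<open>\<tau> \<in> \<Sigma>\<close> unfolding \<Sigma>_def by blast
    show ?thesis unfolding NT(2,4) tubing_cone_Int[OF G NT(1,3)] faces[OF NT(1)] faces[OF NT(3)] by blast
  qed
  ultimately have "is_fan ?\<Lambda> \<Sigma>" unfolding is_fan_def by blast
  moreover have "\<exists>S. finite S \<and> independent S \<and> \<sigma> = convex_cone hull S" if \<sigma>: "\<sigma> \<in> \<Sigma>" for \<sigma>
  proof -
    obtain N T where "(N, T) \<in> crossing_tubings G" "\<sigma> = tubing_cone N T" using \<sigma> unfolding \<Sigma>_def by blast
    then show ?thesis using indep by (intro exI[of _ "tube_vec N ` T"]) (simp add: tubing_cone_def)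
  qed
  moreover have "\<exists>B. int_basis ?\<Lambda> B \<and> primitive_generators ?\<Lambda> \<sigma> \<subseteq> B" if \<sigma>: "\<sigma> \<in> \<Sigma>" for \<sigma>
  proof -
    obtain N T where NT: "(N, T) \<in> crossing_tubings G" "\<sigma> = tubing_cone N T" using \<sigma> unfolding \<Sigma>_def by blast
    obtain pivot where "unitriangular T (tube_vec N) pivot (half_edges G)"
      using crossing_unitriangular[OF G NT(1)] .
    then interpret unitriangular T "tube_vec N" pivot "half_edges G" .
    show ?thesis unfolding NT(2) primitive_generators_tubing_cone[OF G NT(1)] unfolding double_lattice_eq
      by (intro exI[of _ completed_basis] conjI int_basis_completed) (auto simp: completed_basis_def)
  qed
  ultimately show ?thesis
    unfolding unimodular_simplicial_fan_def simplicial_fan_def lightcone_refinement_eq[OF G] \<Sigma>_def[symmetric]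
    by blast
qed

section \<open>The induced triangulation of the universe fan\<close>

lemma linear_causal_form: "linear (causal_form G g)"
  by (rule linearI)
    (simp_all add: causal_form_def sum.distrib sum_subtractf sum_distrib_left algebra_simps)

lemma convex_cone_causal_cone: "convex_cone (causal_cone G)"
  unfolding convex_cone_iff causal_cone_def
  by (auto simp: double_space_iff linear_0[OF linear_causal_form] linear_add[OF linear_causal_form]
      linear_scale[OF linear_causal_form])

lemma causal_form_top: "causal_form G top x = x $ Inl top - x $ Inr top"
proof -
  have "{f. f \<in> G \<and> top < f \<and> f < top} = {}" by auto
  then show ?thesis unfolding causal_form_def by simp
qed

text \<open>The element \<open>top\<close> enters the causal form by \<open>p\<close> alone, whereas the sum on the right treats
  it like any other element above \<open>g\<close>; the first summand compensates for the difference.\<close>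

lemma causal_form_nested:
  assumes N: "N \<subseteq> G" and x: "x \<in> double_space N" and g: "g \<noteq> top" and top: "top \<in> G"
  shows "causal_form G g x = x $ Inr top + (\<Sum>f | f \<in> N \<and> g < f. x $ Inl f - x $ Inr f) - x $ Inr g"
proof -
  have "{f. f \<in> G \<and> g < f} = insert top {f. f \<in> G \<and> g < f \<and> f < top}"
    using g top by (auto simp: less_top)
  then have "(\<Sum>f | f \<in> G \<and> g < f. x $ Inl f - x $ Inr f) =
      x $ Inl top - x $ Inr top + (\<Sum>f | f \<in> G \<and> g < f \<and> f < top. x $ Inl f - x $ Inr f)" by simp
  moreover have "(\<Sum>f | f \<in> G \<and> g < f. x $ Inl f - x $ Inr f) = (\<Sum>f | f \<in> N \<and> g < f. x $ Inl f - x $ Inr f)"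
  proof (rule sum.mono_neutral_right)
    show "\<forall>f\<in>{f. f \<in> G \<and> g < f} - {f. f \<in> N \<and> g < f}. x $ Inl f - x $ Inr f = 0"
    proof
      fix f assume "f \<in> {f. f \<in> G \<and> g < f} - {f. f \<in> N \<and> g < f}"
      then have "Inl f \<notin> half_edges N" "Inr f \<notin> half_edges N" by (auto simp: half_edges_def)
      then show "x $ Inl f - x $ Inr f = 0" using x by (simp add: double_space_iff)
    qed
  qed (use N in auto)
  ultimately show ?thesis by (simp add: causal_form_def)
qed

context forest
begin

lemma sum_above_eq_height:
  assumes h: "h \<in> N"
  shows "(\<Sum>f | f \<in> N \<and> h \<le> f. x $ Inl f - x $ Inr f) = vertex_height N x (Some h) - vertex_height N x None"
proof -
  have "{f. f \<in> N \<and> h \<le> f} = insert h {f. f \<in> N \<and> h < f}" using h by auto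
  then have "(\<Sum>f | f \<in> N \<and> h \<le> f. x $ Inl f) = x $ Inl h + (\<Sum>f | f \<in> N \<and> h < f. x $ Inl f)" by simp
  moreover have "(\<Sum>f\<in>N. x $ Inr f) = (\<Sum>f | f \<in> N \<and> h \<le> f. x $ Inr f) + (\<Sum>f | f \<in> N \<and> \<not> h \<le> f. x $ Inr f)"
    by (subst sum.union_disjoint[symmetric]) (auto intro!: sum.cong)
  ultimately show ?thesis
    by (simp add: vertex_height_def edge_height_def sum_subtractf)
qed

text \<open>The sum in the causal form telescopes to the height of the vertex just above \<open>g\<close> relative
  to the root; it is empty if that vertex is the root itself.\<close>

lemma causal_form_tube_vec:
  assumes NG: "N \<subseteq> G" and top: "top \<in> G" and g: "g \<noteq> top" "g \<noteq> bot"
  shows "(\<forall>f\<in>N. \<not> g < f) \<and> causal_form G g (tube_vec N t) = tube_vec N t $ Inr top - tube_vec N t $ Inr g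
    \<or> (\<exists>h\<in>N. g < h \<and> (\<forall>f\<in>N. g < f \<longrightarrow> h \<le> f) \<and>
        causal_form G g (tube_vec N t) = tube_vec N t $ Inr top
          + (if Some h \<in> t then 1 else 0) - (if None \<in> t then 1 else 0) - tube_vec N t $ Inr g)"
proof -
  have "tube_vec N t \<in> double_space N" using tube_vec_support by (simp add: double_space_iff)
  note form = causal_form_nested[OF NG this g(1) top]
  show ?thesis
  proof (cases "\<exists>f\<in>N. g < f")
    case True
    then obtain h where h: "h \<in> N" "g < h" "\<And>k. k \<in> N \<Longrightarrow> g < k \<Longrightarrow> h \<le> k"
      using least_above[OF g(2)] by metis
    have "{f. f \<in> N \<and> g < f} = {f. f \<in> N \<and> h \<le> f}" using h by (auto intro: less_le_trans)
    moreover have "Some h \<in> V" "None \<in> V" using h by (auto simp: tree_vertices_def)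
    ultimately have "causal_form G g (tube_vec N t) = tube_vec N t $ Inr top
          + (if Some h \<in> t then 1 else 0) - (if None \<in> t then 1 else 0) - tube_vec N t $ Inr g"
      unfolding form by (simp add: sum_above_eq_height[OF h(1)] vertex_height_tube_vec)
    then show ?thesis using h by blast
  next
    case False
    then have e: "{f. f \<in> N \<and> g < f} = {}" by auto
    have "causal_form G g (tube_vec N t) = tube_vec N t $ Inr top - tube_vec N t $ Inr g"
      unfolding form e by simp
    then show ?thesis using False by blast
  qed
qed

lemma upper_end_maximal: "e \<in> N \<Longrightarrow> \<forall>f\<in>N. \<not> e < f \<Longrightarrow> upper_end N e = None"
  by (auto simp: upper_end_def)

text \<open>For a tube avoiding the root, the negative term at \<open>g\<close> only occurs when the vertex
  above \<open>g\<close> is in the tube, and then both cancel. If the tube contains the root, the causal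
  inequalities force the upper end of each edge into the tube, and then also its lower end, so
  the tube is the whole tree.\<close>

lemma tube_vec_causal_iff:
  assumes G: "nestable G" "N \<subseteq> G" and t: "tube N t" "t \<noteq> V"
  shows "tube_vec N t \<in> causal_cone G \<longleftrightarrow> None \<notin> t"
proof
  let ?w = "tube_vec N t"
  have top: "top \<in> G" and bot: "bot \<notin> G" using G(1) by (auto simp: nestable_def)
  have upper_top: "upper_end N top = None" by (auto simp: upper_end_def)
  {
    assume None: "None \<notin> t"
    have mtop: "?w $ Inr top = 0" using None upper_top by (simp add: tube_vec_Inr leaving_def)
    have "0 \<le> causal_form G g ?w" if g: "g \<in> G" for g
    proof (cases "g = top")
      case True then show ?thesis using mtop tube_vec_nonneg by (simp add: causal_form_top)
    next
      case False
      have gb: "g \<noteq> bot" using g bot by auto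
      from causal_form_tube_vec[OF G(2) top False gb, of t] show ?thesis
      proof (elim disjE bexE conjE)
        assume *: "\<forall>f\<in>N. \<not> g < f" "causal_form G g ?w = ?w $ Inr top - ?w $ Inr g"
        have "?w $ Inr g = 0" using None upper_end_maximal[OF _ *(1)] by (auto simp: tube_vec_Inr leaving_def)
        then show ?thesis using * mtop by simp
      next
        fix h assume h: "h \<in> N" "g < h" "\<forall>f\<in>N. g < f \<longrightarrow> h \<le> f"
          and F: "causal_form G g ?w = ?w $ Inr top + (if Some h \<in> t then 1 else 0)
            - (if None \<in> t then 1 else 0) - ?w $ Inr g"
        have "?w $ Inr g \<le> (if Some h \<in> t then 1 else 0)"
          using upper_end_eqI[of g h] h by (auto simp: tube_vec_Inr leaving_def)
        then show ?thesis using F None mtop by simp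
      qed
    qed
    moreover have "?w \<in> double_space G" unfolding double_space_iff
    proof (intro allI impI)
      fix i assume "i \<notin> half_edges G"
      then have "i \<notin> half_edges N" using G(2) by (auto simp: half_edges_def)
      then show "?w $ i = 0" by (rule tube_vec_support)
    qed
    ultimately show "?w \<in> causal_cone G" using mtop tube_vec_nonneg by (simp add: causal_cone_def)
  next
    assume w: "?w \<in> causal_cone G"
    show "None \<notin> t"
    proof
      assume None: "None \<in> t"
      have mtop: "?w $ Inr top = 0" using w by (simp add: causal_cone_def)
      have "Some g \<in> t" if g: "g \<in> N" for g
      proof (cases "g = top")
        case True
        then show ?thesis using mtop None upper_top g by (auto simp: tube_vec_Inr leaving_def split: if_splits)
      next
        case False
        have gb: "g \<noteq> bot" using g bot_notin by auto
        have pos: "0 \<le> causal_form G g ?w" using w g G(2) by (auto simp: causal_cone_def)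
        have nl: "?w $ Inr g = 0 \<Longrightarrow> upper_end N g \<in> t \<Longrightarrow> Some g \<in> t"
          using g by (auto simp: tube_vec_Inr leaving_def split: if_splits)
        from causal_form_tube_vec[OF G(2) top False gb, of t] show ?thesis
        proof (elim disjE bexE conjE)
          assume *: "\<forall>f\<in>N. \<not> g < f" "causal_form G g ?w = ?w $ Inr top - ?w $ Inr g"
          then have "?w $ Inr g = 0" using pos mtop tube_vec_nonneg[of t "Inr g"] by simp
          then show ?thesis using nl None upper_end_maximal[OF g *(1)] by simp
        next
          fix h assume h: "h \<in> N" "g < h" "\<forall>f\<in>N. g < f \<longrightarrow> h \<le> f"
            and F: "causal_form G g ?w = ?w $ Inr top + (if Some h \<in> t then 1 else 0)
              - (if None \<in> t then 1 else 0) - ?w $ Inr g"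
          have "Some h \<in> t \<and> ?w $ Inr g = 0"
            using F pos mtop None tube_vec_nonneg[of t "Inr g"] by (auto split: if_splits)
          then show ?thesis using nl upper_end_eqI[OF g h(1,2)] h(3) by simp
        qed
      qed
      then have "t = V" using None t(1) by (auto simp: tube_iff tree_vertices_def)
      then show False using t(2) by simp
    qed
  }
qed

end

lemma cone_faces_refl: "convex C \<Longrightarrow> C \<noteq> {} \<Longrightarrow> C \<in> cone_faces C"
  by (simp add: cone_faces_def face_of_refl)

lemma tubing_cone_in_induced_iff:
  assumes G: "nestable G" and NT: "(N, T) \<in> crossing_tubings G"
  shows "tubing_cone N T \<in> induced_triangulation G \<longleftrightarrow> (\<forall>t\<in>T. None \<notin> t)"
proof -
  note * = crossing_tubingsD[OF G NT]
  interpret forest N by (rule *)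
  have causal: "tube_vec N t \<in> causal_cone G \<longleftrightarrow> None \<notin> t" if "t \<in> T" for t
    using that *(4,5) by (intro tube_vec_causal_iff G *) (auto simp: tubing_def)
  have "tubing_cone N T \<in> maximal_lightcone_refinement G"
    using NT unfolding lightcone_refinement_eq[OF G] by blast
  moreover have "tubing_cone N T \<subseteq> \<Union> (universe_fan G) \<longleftrightarrow> (\<forall>t\<in>T. tube_vec N t \<in> causal_cone G)"
  proof
    assume sub: "tubing_cone N T \<subseteq> \<Union> (universe_fan G)"
    have "\<Union> (universe_fan G) \<subseteq> causal_cone G"
      unfolding universe_fan_def cone_faces_def using face_of_imp_subset by fast
    moreover have "tube_vec N t \<in> tubing_cone N T" if "t \<in> T" for t
      using that unfolding tubing_cone_def by (intro hull_inc) auto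
    ultimately show "\<forall>t\<in>T. tube_vec N t \<in> causal_cone G" using sub by blast
  next
    assume "\<forall>t\<in>T. tube_vec N t \<in> causal_cone G"
    then have "tubing_cone N T \<subseteq> causal_cone G" unfolding tubing_cone_def
      by (intro hull_minimal convex_cone_causal_cone) auto
    then have sub: "tubing_cone N T \<subseteq> double_cone N \<inter> causal_cone G"
      using tubing_cone_subset_double_cone by blast
    have cc: "convex (double_cone N)" "0 \<in> double_cone N" "convex (causal_cone G)" "0 \<in> causal_cone G"
      using convex_cone_double_cone[of N] convex_cone_causal_cone[of G]
      by (auto simp: convex_cone_def intro: convex_cone_contains_0 convex_cone_double_cone convex_cone_causal_cone)
    have "double_cone N \<in> double_fan G" unfolding double_fan_def
      using *(2) cc by (intro UN_I[of N] cone_faces_refl) auto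
    moreover have "double_cone N \<inter> causal_cone G \<in> cone_faces (double_cone N \<inter> causal_cone G)"
      using cc by (intro cone_faces_refl convex_Int) auto
    ultimately have "double_cone N \<inter> causal_cone G \<in> universe_fan G" unfolding universe_fan_def by blast
    then show "tubing_cone N T \<subseteq> \<Union> (universe_fan G)" using sub by blast
  qed
  ultimately show ?thesis using causal by (simp add: induced_triangulation_def)
qed

theorem proposition5p15:
  fixes G :: "'a::{finite,bounded_lattice} set"
  assumes "nestoid G"
  shows "(unimodular_simplicial_fan (double_lattice G) (maximal_lightcone_refinement G)
        \<and> maximal_lightcone_refinement G = {tubing_cone N T | N T. (N, T) \<in> crossing_tubings G})
    \<and> (bij_betw (\<lambda>(N, T). tubing_cone N T)
          {(N, T) \<in> crossing_tubings G. \<forall>t\<in>T. None \<notin> t} (induced_triangulation G)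
        \<and> (\<forall>(N, T) \<in> crossing_tubings G.
             tubing_cone N T \<in> induced_triangulation G \<longleftrightarrow> (\<forall>t\<in>T. None \<notin> t)))"
proof -
  have G: "nestable G" using assms by (simp add: nestoid_def)
  note eq = lightcone_refinement_eq[OF G] and iff = tubing_cone_in_induced_iff[OF G]
  let ?S = "{(N, T) \<in> crossing_tubings G. \<forall>t\<in>T. None \<notin> t}"
  have "bij_betw (\<lambda>(N, T). tubing_cone N T) ?S (induced_triangulation G)"
  proof (rule bij_betw_imageI)
    show "inj_on (\<lambda>(N, T). tubing_cone N T) ?S"
    proof (rule inj_onI)
      fix p q assume pq: "p \<in> ?S" "q \<in> ?S" "(\<lambda>(N, T). tubing_cone N T) p = (\<lambda>(N, T). tubing_cone N T) q"
      obtain N1 T1 N2 T2 where p: "p = (N1, T1)" and q: "q = (N2, T2)" by (cases p, cases q)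
      show "p = q" unfolding p q using crossing_tubing_unique[OF G, of N1 T1 N2 T2] pq by (simp add: p q)
    qed
    show "(\<lambda>(N, T). tubing_cone N T) ` ?S = induced_triangulation G"
    proof (intro antisym subsetI)
      fix \<sigma> assume "\<sigma> \<in> (\<lambda>(N, T). tubing_cone N T) ` ?S"
      then obtain N T where "\<sigma> = tubing_cone N T" "(N, T) \<in> crossing_tubings G" "\<forall>t\<in>T. None \<notin> t" by auto
      then show "\<sigma> \<in> induced_triangulation G" using iff[of N T] by simp
    next
      fix \<sigma> assume \<sigma>: "\<sigma> \<in> induced_triangulation G"
      then have "\<sigma> \<in> maximal_lightcone_refinement G" by (simp add: induced_triangulation_def)
      then obtain N T where NT: "(N, T) \<in> crossing_tubings G" "\<sigma> = tubing_cone N T" unfolding eq by blast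
      then have "(N, T) \<in> ?S" using iff[OF NT(1)] \<sigma> by simp
      then show "\<sigma> \<in> (\<lambda>(N, T). tubing_cone N T) ` ?S" unfolding NT(2) by (rule rev_image_eqI) simp
    qed
  qed
  moreover have "\<forall>(N, T) \<in> crossing_tubings G.
      tubing_cone N T \<in> induced_triangulation G \<longleftrightarrow> (\<forall>t\<in>T. None \<notin> t)"
    using iff by auto
  ultimately show ?thesis using unimodular_lightcone_refinement[OF G] eq by (intro conjI)
qed

end
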